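(* Let $p\in\Pi_{k\to\omega}Sym(n_k)$. Then $p\in\mathcal{GA}$ if and only if $p\big(St^{*}(L^\infty(X,\mu))\big)=St^{*}(L^\infty(X,\mu))$, where $p(f)=f\circ p$ for $f\in L^\infty(X_\omega,\mu_\omega)$; that is, if and only if $p$ is in the normaliser of $St^{*}(L^\infty(X,\mu))$ when $\Pi_{k\to\omega}Sym(n_k)$ and $L^\infty(X_\omega,\mu_\omega)$ are identified with subsets of $\Pi_{k\to\omega}M_{n_k}$.
   Context: Fix a non-principal ultrafilter $\omega$ on $\mathbb{N}$ and a (strictly) increasing sequence $(n_k)_k$ of natural numbers. Universal sofic group: for $p\in Sym(n)$ the normalised Hamming length is $\ell_H(p)=\frac1n Card\{i:p(i)\neq i\}$. The universal sofic group $\Pi_{k\to\omega}Sym(n_k)$ is the quotient of $\prod_k Sym(n_k)$ by the normal subgroup $\{(p_k)_k:\lim_{k\to\omega}\ell_H(p_k)=0\}$; the class of $(p_k)_k$ is written $\Pi_{k\to\omega}p_k$. Loeb space: $X_\omega=\prod_k\{1,\ldots,n_k\}/\sim$, where $(x_k)_k\sim(y_k)_k$ iff $\{k:x_k=y_k\}\in\omega$; the class of $(x_k)_k$ is still written $(x_k)_k$. For $A_k\subset\{1,\ldots,n_k\}$ put $\Pi_{k\to\omega}A_k=\{(x_k)_k\in X_\omega:\{k:x_k\in A_k\}\in\omega\}$ and $\mu_\omega(\Pi_{k\to\omega}A_k)=\lim_{k\to\omega}Card(A_k)/n_k$. These sets form an algebra on which $\mu_\omega$ is a pre-measure; $(X_\omega,\mathcal{B}_\omega,\mu_\omega)$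 is the completion of its Carathéodory extension to the generated $\sigma$-algebra. Action: $p=\Pi_{k\to\omega}p_k$ acts on $X_\omega$ by $p((x_k)_k)=(p_k(x_k))_k$; this is a measure-preserving automorphism of $(X_\omega,\mu_\omega)$, well defined up to a $\mu_\omega$-null set. For $f\in L^\infty(X_\omega,\mu_\omega)$, $p(f)(x)=f(p(x))$. Standard part: $X=[0,1]$ with Lebesgue measure $\mu$, and $St:X_\omega\to X$, $St((x_k)_k)=\lim_{k\to\omega}\frac{x_k}{n_k}$ (it is measure preserving). $St^*(L^\infty(X,\mu))=\{f\circ St:f\in L^\infty(X,\mu)\}\subset L^\infty(X_\omega,\mu_\omega)$. $p|_X$ and $\mathcal{GA}$: for $p\in\Pi_{k\to\omega}Sym(n_k)$ we say $p|_X$ exists, and write $p|_X=\varphi$, if there is $\varphi:X\to X$ with $St(p(x))=\varphi(St(x))$ for $\mu_\omega$-almost all $x\in X_\omega$ ($\varphi$ is then determined $\mu$-almost everywhere). $\mathcal{GA}$ is the set of $p\in\Pi_{k\to\omega}Sym(n_k)$ such that $p|_X$ exists and is an automorphism of $(X,\mu)$, i.e. a measure-preserving map invertible modulo null sets. Matrix picture: $\Pi_{k\to\omega}M_{n_k}$ is the tracial ultraproduct of the matrix algebras $M_{n_k}(\mathbb{C})$ (bounded sequences modulo those with $\lim_{k\to\omega}Tr(a_k^*a_k)=0$, $Tr$ the normalised trace). $L^\infty(X_\omega,\mu_\omega)$ is identified with the ultraproduct $\Pi_{k\to\omega}D_{n_k}$ of the diagonal subalgebras (a sequence of diagonal matrices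 with entries $d_k(i)$ corresponds to $(x_k)_k\mapsto\lim_{k\to\omega}d_k(x_k)$), and $\Pi_{k\to\omega}Sym(n_k)$ with the ultraproduct $\Pi_{k\to\omega}P_{n_k}$ of the permutation matrices (the matrix of $p_k$ sends the basis vector $e_i$ to $e_{p_k(i)}$). Under these identifications $p(f)=p^{-1}\cdot f\cdot p$. *)

theory Defs
  imports
    "HOL-Analysis.Analysis"
    "HOL-Algebra.Algebra"
    "Jordan_Normal_Form.Schur_Decomposition"
begin

section \<open>Ultrafilters and the universal sofic group\<close>

definition nonprincipal_ultrafilter :: "nat filter \<Rightarrow> bool" where
  "nonprincipal_ultrafilter \<omega> \<longleftrightarrow>
     \<omega> \<noteq> bot \<and>
     (\<forall>P. eventually P \<omega> \<or> eventually (\<lambda>k. \<not> P k) \<omega>) \<and>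
     (\<forall>m. eventually (\<lambda>k. k \<noteq> m) \<omega>)"

definition hamming_length :: "nat \<Rightarrow> (nat \<Rightarrow> nat) \<Rightarrow> real" where
  "hamming_length m p = real (card {i \<in> {1..m}. p i \<noteq> i}) / real m"

definition perm_seq_group :: "(nat \<Rightarrow> nat) \<Rightarrow> (nat \<Rightarrow> nat \<Rightarrow> nat) monoid" where
  "perm_seq_group n = product_group UNIV (\<lambda>k. sym_group (n k))"

definition hamming_null :: "nat filter \<Rightarrow> (nat \<Rightarrow> nat) \<Rightarrow> (nat \<Rightarrow> nat \<Rightarrow> nat) set" where
  "hamming_null \<omega> n =
     {p \<in> carrier (perm_seq_group n). ((\<lambda>k. hamming_length (n k) (p k)) \<longlongrightarrow> 0) \<omega>}"

definition universal_sofic_group ::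
  "nat filter \<Rightarrow> (nat \<Rightarrow> nat) \<Rightarrow> (nat \<Rightarrow> nat \<Rightarrow> nat) set monoid" where
  "universal_sofic_group \<omega> n = perm_seq_group n Mod hamming_null \<omega> n"

text \<open>A representing sequence of permutations; everything built from it below is independent of the
  choice (up to null sets, in the case of the action on the Loeb space).\<close>

definition sofic_rep :: "(nat \<Rightarrow> nat \<Rightarrow> nat) set \<Rightarrow> nat \<Rightarrow> nat \<Rightarrow> nat" where
  "sofic_rep p = (SOME q. q \<in> p)"

section \<open>The Loeb space\<close>

definition point_seqs :: "(nat \<Rightarrow> nat) \<Rightarrow> (nat \<Rightarrow> nat) set" where
  "point_seqs n = (\<Pi> k\<in>UNIV. {1..n k})"

definition loeb_rel :: "nat filter \<Rightarrow> (nat \<Rightarrow> nat) \<Rightarrow> ((nat \<Rightarrow> nat) \<times> (nat \<Rightarrow> nat)) set" where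
  "loeb_rel \<omega> n =
     {(x, y). x \<in> point_seqs n \<and> y \<in> point_seqs n \<and> eventually (\<lambda>k. x k = y k) \<omega>}"

definition loeb_class :: "nat filter \<Rightarrow> (nat \<Rightarrow> nat) \<Rightarrow> (nat \<Rightarrow> nat) \<Rightarrow> (nat \<Rightarrow> nat) set" where
  "loeb_class \<omega> n x = loeb_rel \<omega> n `` {x}"

definition loeb_points :: "nat filter \<Rightarrow> (nat \<Rightarrow> nat) \<Rightarrow> (nat \<Rightarrow> nat) set set" where
  "loeb_points \<omega> n = point_seqs n // loeb_rel \<omega> n"

definition loeb_rep :: "(nat \<Rightarrow> nat) set \<Rightarrow> nat \<Rightarrow> nat" where
  "loeb_rep c = (SOME x. x \<in> c)"

definition internal_set ::
  "nat filter \<Rightarrow> (nat \<Rightarrow> nat) \<Rightarrow> (nat \<Rightarrow> nat set) \<Rightarrow> (nat \<Rightarrow> nat) set set" where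
  "internal_set \<omega> n A =
     {loeb_class \<omega> n x | x. x \<in> point_seqs n \<and> eventually (\<lambda>k. x k \<in> A k) \<omega>}"

text \<open>\<^const>\<open>extend_measure\<close> is the extension of the pre-measure given on the
  internal sets to the sigma-algebra they generate (unique here, as the pre-measure is finite).\<close>

definition loeb_space :: "nat filter \<Rightarrow> (nat \<Rightarrow> nat) \<Rightarrow> (nat \<Rightarrow> nat) set measure" where
  "loeb_space \<omega> n =
     completion
       (extend_measure (loeb_points \<omega> n) {A. \<forall>k. A k \<subseteq> {1..n k}} (internal_set \<omega> n)
          (\<lambda>A. ennreal (Lim \<omega> (\<lambda>k. real (card (A k)) / real (n k)))))"

definition loeb_lim :: "nat filter \<Rightarrow> (nat \<Rightarrow> nat \<Rightarrow> 'a::t2_space) \<Rightarrow> (nat \<Rightarrow> nat) set \<Rightarrow> 'a" where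
  "loeb_lim \<omega> d c = Lim \<omega> (\<lambda>k. d k (loeb_rep c k))"

definition St :: "nat filter \<Rightarrow> (nat \<Rightarrow> nat) \<Rightarrow> (nat \<Rightarrow> nat) set \<Rightarrow> real" where
  "St \<omega> n = loeb_lim \<omega> (\<lambda>k i. real i / real (n k))"

definition sofic_act ::
  "nat filter \<Rightarrow> (nat \<Rightarrow> nat) \<Rightarrow> (nat \<Rightarrow> nat \<Rightarrow> nat) set \<Rightarrow>
   (nat \<Rightarrow> nat) set \<Rightarrow> (nat \<Rightarrow> nat) set" where
  "sofic_act \<omega> n p c = loeb_class \<omega> n (\<lambda>k. sofic_rep p k (loeb_rep c k))"

section \<open>Complex L-infinity spaces modulo null sets\<close>

definition ess_bounded_fns :: "'a measure \<Rightarrow> ('a \<Rightarrow> complex) set" where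
  "ess_bounded_fns M = {f \<in> borel_measurable M. \<exists>C. AE x in M. cmod (f x) \<le> C}"

definition ae_rel :: "'a measure \<Rightarrow> (('a \<Rightarrow> complex) \<times> ('a \<Rightarrow> complex)) set" where
  "ae_rel M = {(f, g). f \<in> ess_bounded_fns M \<and> g \<in> ess_bounded_fns M \<and> (AE x in M. f x = g x)}"

definition Linf :: "'a measure \<Rightarrow> ('a \<Rightarrow> complex) set set" where
  "Linf M = ess_bounded_fns M // ae_rel M"

text \<open>The map induced on classes by composition with \<open>T\<close>: the class of \<open>f\<close>
  goes to the class of \<open>f \<circ> T\<close>.\<close>

definition Linf_comp ::
  "'a measure \<Rightarrow> ('a \<Rightarrow> 'b) \<Rightarrow> ('b \<Rightarrow> complex) set \<Rightarrow> ('a \<Rightarrow> complex) set" where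
  "Linf_comp M T F = {g \<in> ess_bounded_fns M. \<exists>f\<in>F. AE x in M. g x = f (T x)}"

abbreviation unit_interval :: "real measure" where
  "unit_interval \<equiv> lebesgue_on {0..1}"

definition St_Linf :: "nat filter \<Rightarrow> (nat \<Rightarrow> nat) \<Rightarrow> ((nat \<Rightarrow> nat) set \<Rightarrow> complex) set set" where
  "St_Linf \<omega> n = Linf_comp (loeb_space \<omega> n) (St \<omega> n) ` Linf unit_interval"

section \<open>The set GA\<close>

definition measure_preserving_map :: "'a measure \<Rightarrow> ('a \<Rightarrow> 'a) \<Rightarrow> bool" where
  "measure_preserving_map M \<phi> \<longleftrightarrow>
     \<phi> \<in> measurable M M \<and> (\<forall>A\<in>sets M. emeasure M (\<phi> -` A \<inter> space M) = emeasure M A)"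

definition measure_automorphism :: "'a measure \<Rightarrow> ('a \<Rightarrow> 'a) \<Rightarrow> bool" where
  "measure_automorphism M \<phi> \<longleftrightarrow>
     measure_preserving_map M \<phi> \<and>
     (\<exists>\<psi>. measure_preserving_map M \<psi> \<and>
        (AE x in M. \<psi> (\<phi> x) = x) \<and> (AE x in M. \<phi> (\<psi> x) = x))"

definition restricts_to ::
  "nat filter \<Rightarrow> (nat \<Rightarrow> nat) \<Rightarrow> (nat \<Rightarrow> nat \<Rightarrow> nat) set \<Rightarrow> (real \<Rightarrow> real) \<Rightarrow> bool" where
  "restricts_to \<omega> n p \<phi> \<longleftrightarrow>
     \<phi> \<in> {0..1} \<rightarrow> {0..1} \<and>
     (AE c in loeb_space \<omega> n. St \<omega> n (sofic_act \<omega> n p c) = \<phi> (St \<omega> n c))"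

definition GA :: "nat filter \<Rightarrow> (nat \<Rightarrow> nat) \<Rightarrow> (nat \<Rightarrow> nat \<Rightarrow> nat) set set" where
  "GA \<omega> n =
     {p \<in> carrier (universal_sofic_group \<omega> n).
        \<exists>\<phi>. restricts_to \<omega> n p \<phi> \<and> measure_automorphism unit_interval \<phi>}"

section \<open>The tracial ultraproduct of matrix algebras\<close>

definition l2_norm_vec :: "complex vec \<Rightarrow> real" where
  "l2_norm_vec v = L2_set (\<lambda>i. cmod (vec_index v i)) {..<dim_vec v}"

definition norm_trace :: "complex mat \<Rightarrow> complex" where
  "norm_trace a = (\<Sum>i<dim_row a. a $$ (i, i)) / of_nat (dim_row a)"

definition op_bounded_seqs :: "(nat \<Rightarrow> nat) \<Rightarrow> (nat \<Rightarrow> complex mat) set" where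
  "op_bounded_seqs n =
     {a. (\<forall>k. a k \<in> carrier_mat (n k) (n k)) \<and>
         (\<exists>C. \<forall>k. \<forall>v\<in>carrier_vec (n k). l2_norm_vec (a k *\<^sub>v v) \<le> C * l2_norm_vec v)}"

definition mat_seq_ring :: "(nat \<Rightarrow> nat) \<Rightarrow> (nat \<Rightarrow> complex mat) ring" where
  "mat_seq_ring n =
     \<lparr>carrier = op_bounded_seqs n,
      monoid.mult = (\<lambda>a b k. a k * b k),
      monoid.one = (\<lambda>k. 1\<^sub>m (n k)),
      ring.zero = (\<lambda>k. 0\<^sub>m (n k) (n k)),
      ring.add = (\<lambda>a b k. a k + b k)\<rparr>"

definition trace_null :: "nat filter \<Rightarrow> (nat \<Rightarrow> nat) \<Rightarrow> (nat \<Rightarrow> complex mat) set" where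
  "trace_null \<omega> n =
     {a \<in> op_bounded_seqs n. ((\<lambda>k. norm_trace (mat_adjoint (a k) * a k)) \<longlongrightarrow> 0) \<omega>}"

definition matrix_ultraproduct ::
  "nat filter \<Rightarrow> (nat \<Rightarrow> nat) \<Rightarrow> (nat \<Rightarrow> complex mat) set ring" where
  "matrix_ultraproduct \<omega> n = mat_seq_ring n Quot trace_null \<omega> n"

definition mat_class ::
  "nat filter \<Rightarrow> (nat \<Rightarrow> nat) \<Rightarrow> (nat \<Rightarrow> complex mat) \<Rightarrow> (nat \<Rightarrow> complex mat) set" where
  "mat_class \<omega> n a = trace_null \<omega> n +>\<^bsub>mat_seq_ring n\<^esub> a"

definition ultra_adjoint ::
  "nat filter \<Rightarrow> (nat \<Rightarrow> nat) \<Rightarrow> (nat \<Rightarrow> complex mat) set \<Rightarrow> (nat \<Rightarrow> complex mat) set" where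
  "ultra_adjoint \<omega> n u = (\<Union>a\<in>u. mat_class \<omega> n (\<lambda>k. mat_adjoint (a k)))"

text \<open>As usual for operator algebras, the normaliser consists of unitaries.\<close>

definition ultra_normaliser ::
  "nat filter \<Rightarrow> (nat \<Rightarrow> nat) \<Rightarrow> (nat \<Rightarrow> complex mat) set set \<Rightarrow> (nat \<Rightarrow> complex mat) set set" where
  "ultra_normaliser \<omega> n B =
     (let M = matrix_ultraproduct \<omega> n in
      {u \<in> carrier M.
         ultra_adjoint \<omega> n u \<otimes>\<^bsub>M\<^esub> u = \<one>\<^bsub>M\<^esub> \<and>
         u \<otimes>\<^bsub>M\<^esub> ultra_adjoint \<omega> n u = \<one>\<^bsub>M\<^esub> \<and>
         (\<lambda>b. u \<otimes>\<^bsub>M\<^esub> b \<otimes>\<^bsub>M\<^esub> ultra_adjoint \<omega> n u) ` B = B})"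

text \<open>Matrix indices start at 0, points of \<open>{1..m}\<close> at 1; hence the shifts by \<^const>\<open>Suc\<close>.\<close>

definition perm_mat :: "nat \<Rightarrow> (nat \<Rightarrow> nat) \<Rightarrow> complex mat" where
  "perm_mat m q = mat m m (\<lambda>(i, j). if Suc i = q (Suc j) then 1 else 0)"

definition diag_mat_of :: "nat \<Rightarrow> (nat \<Rightarrow> complex) \<Rightarrow> complex mat" where
  "diag_mat_of m d = mat m m (\<lambda>(i, j). if i = j then d (Suc i) else 0)"

definition sofic_to_mat ::
  "nat filter \<Rightarrow> (nat \<Rightarrow> nat) \<Rightarrow> (nat \<Rightarrow> nat \<Rightarrow> nat) set \<Rightarrow> (nat \<Rightarrow> complex mat) set" where
  "sofic_to_mat \<omega> n p = mat_class \<omega> n (\<lambda>k. perm_mat (n k) (sofic_rep p k))"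

text \<open>The subset of the matrix ultraproduct that corresponds to a set \<open>B\<close> of elements of
  L-infinity of the Loeb space, under the identification of the class of a bounded sequence of
  diagonal matrices \<open>d\<close> with the class of the function \<^term>\<open>loeb_lim \<omega> d\<close>.\<close>

definition Linf_to_mat ::
  "nat filter \<Rightarrow> (nat \<Rightarrow> nat) \<Rightarrow> ((nat \<Rightarrow> nat) set \<Rightarrow> complex) set set \<Rightarrow>
   (nat \<Rightarrow> complex mat) set set" where
  "Linf_to_mat \<omega> n B =
     {mat_class \<omega> n (\<lambda>k. diag_mat_of (n k) (d k)) | d.
        (\<exists>C. \<forall>k. \<forall>i\<in>{1..n k}. cmod (d k i) \<le> C) \<and>
        ae_rel (loeb_space \<omega> n) `` {loeb_lim \<omega> d} \<in> B}"

end

theory Submission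
  imports Defs "HOL-Real_Asymp.Real_Asymp"
begin

text \<open>
  The standard part map \<open>S\<close> and the action \<open>T\<close> of \<open>p\<close> preserve the measure. If \<open>S \<circ> T = \<phi> \<circ> S\<close>
  almost everywhere with an automorphism \<open>\<phi>\<close>, then \<open>f \<circ> S \<circ> T = (f \<circ> \<phi>) \<circ> S\<close>, and every \<open>g\<close> has
  the form \<open>f \<circ> \<phi>\<close>. Conversely, applying the invariance to the identity function of the interval
  yields \<open>S \<circ> T = \<phi> \<circ> S\<close> and \<open>S = \<psi> \<circ> S \<circ> T\<close>; pulling back along \<open>S\<close> and \<open>S \<circ> T\<close> shows that \<open>\<phi>\<close>
  and \<open>\<psi>\<close> preserve the measure and are inverse to each other.

  For the normaliser, conjugation by the permutation matrices \<open>q k\<close> turns a diagonal sequence \<open>d\<close>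
  into \<open>d \<circ> q\<^sup>-\<^sup>1\<close>. Two bounded diagonal sequences agree in the ultraproduct if and only if the
  functions that they induce on the Loeb space agree almost everywhere, and every \<open>f \<circ> S\<close> is induced
  by such a sequence.
\<close>

section \<open>Measure-preserving maps\<close>

text \<open>The delicate point in the first equivalence is measurability. A Lebesgue measurable
  function on the interval need not pull Lebesgue null sets back to measurable sets, so
  \<open>\<phi>\<close> is at first only a map into the Borel interval. That it preserves the
  measure is computed upstairs, on the complete Loeb space, and only then does it become a map of
  the Lebesgue space. For this reason both spaces are treated as completions, and measures are
  compared on generators. Each inclusion in the set equation has its own task: one produces
  \<open>\<phi>\<close>, the other its inverse.

  In the second equivalence conjugation acts by the inverse permutation; this is harmless once the
  equation is rewritten as a two-sided membership condition, for which composition with T has to be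
  injective. The lift of f o S is the real construction: the value of f at i / n_k is meaningless
  for a class modulo null sets, whereas averages over intervals of length 1 / n_k are well defined
  and depend continuously on f in the mean, so that continuous approximants decide.\<close>

definition preserves_measure :: "'a measure \<Rightarrow> 'b measure \<Rightarrow> ('a \<Rightarrow> 'b) \<Rightarrow> bool" where
  "preserves_measure M N f \<longleftrightarrow>
     f \<in> measurable M N \<and> (\<forall>A\<in>sets N. emeasure M (f -` A \<inter> space M) = emeasure N A)"

lemma measure_preserving_map_iff: "measure_preserving_map M \<phi> \<longleftrightarrow> preserves_measure M M \<phi>"
  by (simp add: measure_preserving_map_def preserves_measure_def)

lemma preserves_measure_measurable: "preserves_measure M N f \<Longrightarrow> f \<in> measurable M N"
  by (simp add: preserves_measure_def)

lemma preserves_measure_emeasure: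
  "preserves_measure M N f \<Longrightarrow> A \<in> sets N \<Longrightarrow> emeasure M (f -` A \<inter> space M) = emeasure N A"
  by (simp add: preserves_measure_def)

lemma preserves_measure_iff_distr:
  "preserves_measure M N f \<longleftrightarrow> f \<in> measurable M N \<and> distr M N f = N"
proof -
  have "(\<forall>A\<in>sets N. emeasure M (f -` A \<inter> space M) = emeasure N A) \<longleftrightarrow> distr M N f = N"
    if "f \<in> measurable M N"
  proof
    assume "\<forall>A\<in>sets N. emeasure M (f -` A \<inter> space M) = emeasure N A"
    then show "distr M N f = N"
      by (intro measure_eqI) (simp_all add: emeasure_distr that)
  next
    assume "distr M N f = N"
    then show "\<forall>A\<in>sets N. emeasure M (f -` A \<inter> space M) = emeasure N A"
      by (metis emeasure_distr that)
  qed
  then show ?thesis by (auto simp: preserves_measure_def)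
qed

lemma preserves_measure_AE:
  assumes "preserves_measure M N f" "AE y in N. P y"
  shows "AE x in M. P (f x)"
proof -
  have f: "f \<in> measurable M N" and distr: "distr M N f = N"
    using assms(1) by (simp_all add: preserves_measure_iff_distr)
  show ?thesis
    by (rule AE_distrD [OF f]) (simp only: distr assms(2))
qed

text \<open>For the direction from M to N the exceptional set must be known to be measurable in N;
  only then does the measure of its preimage say anything about it.\<close>

lemma preserves_measure_AE_iff:
  assumes "preserves_measure M N f" "{y \<in> space N. P y} \<in> sets N"
  shows "(AE x in M. P (f x)) \<longleftrightarrow> (AE y in N. P y)"
proof -
  have f: "f \<in> measurable M N" and distr: "distr M N f = N"
    using assms(1) by (simp_all add: preserves_measure_iff_distr)
  show ?thesis
    using AE_distr_iff [OF f assms(2)] by (simp only: distr)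
qed

text \<open>A null set of N has a null preimage, and all subsets of that preimage are measurable in
  the complete M; so enlarging the target sigma-algebra by subsets of null sets costs
  nothing.\<close>

lemma preserves_measure_completion:
  assumes "complete_measure M" "preserves_measure M N f"
  shows "preserves_measure M (completion N) f"
proof -
  have f: "f \<in> measurable M N" and distr: "distr M N f = N"
    using assms(2) by (simp_all add: preserves_measure_iff_distr)
  have "null_sets (distr M N f) = null_sets N"
    by (simp add: distr)
  then show ?thesis
    using complete_measure.measurable_completion2 [OF assms(1) f]
      complete_measure.completion_distr_eq [OF assms(1) f] distr
    by (auto simp: preserves_measure_iff_distr)
qed

lemma preserves_measure_completion_both:
  assumes "preserves_measure M N f"
  shows "preserves_measure (completion M) (completion N) f"
proof (rule preserves_measure_completion [OF completion.complete_measure_axioms])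
  show "preserves_measure (completion M) N f"
    using assms by (auto simp: preserves_measure_iff_distr distr_completion measurable_completion)
qed

text \<open>Here \<open>\<phi>\<close> takes values in the uncompleted N, since this is all that a
  pointwise formula for it yields. The measure of a preimage under \<open>\<phi>\<close> is found in
  M: pulled back along S, it agrees with the preimage under R up to a null set. Completing the
  target comes last.\<close>

lemma preserves_measure_factor:
  assumes M: "complete_measure M"
    and S: "preserves_measure M (completion N) S" and R: "preserves_measure M (completion N) R"
    and \<phi>: "\<phi> \<in> measurable (completion N) N" and eq: "AE x in M. R x = \<phi> (S x)"
  shows "preserves_measure (completion N) (completion N) \<phi>"
proof (rule preserves_measure_completion [OF completion.complete_measure_axioms])
  show "preserves_measure (completion N) N \<phi>"
    unfolding preserves_measure_def
  proof (intro conjI ballI)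
    fix A assume A: "A \<in> sets N"
    have pre: "\<phi> -` A \<inter> space (completion N) \<in> sets (completion N)"
      by (rule measurable_sets [OF \<phi> A])
    have Sm: "S \<in> measurable M (completion N)" and Rm: "R \<in> measurable M (completion N)"
      using S R by (simp_all add: preserves_measure_def)
    have "emeasure (completion N) (\<phi> -` A \<inter> space (completion N))
        = emeasure M (S -` (\<phi> -` A \<inter> space (completion N)) \<inter> space M)"
      using S pre by (simp only: preserves_measure_def)
    also have "\<dots> = emeasure M (R -` A \<inter> space M)"
    proof (rule emeasure_eq_AE)
      show "AE x in M. x \<in> S -` (\<phi> -` A \<inter> space (completion N)) \<inter> space M \<longleftrightarrow> x \<in> R -` A \<inter> space M"
        using eq AE_space by eventually_elim (use measurable_space [OF Sm] in auto)
      show "S -` (\<phi> -` A \<inter> space (completion N)) \<inter> space M \<in> sets M"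
        by (rule measurable_sets [OF Sm pre])
      show "R -` A \<inter> space M \<in> sets M"
        using A by (intro measurable_sets [OF Rm]) simp
    qed
    also have "\<dots> = emeasure N A"
      using R A by (simp add: preserves_measure_def)
    finally show "emeasure (completion N) (\<phi> -` A \<inter> space (completion N)) = emeasure N A" .
  qed (rule \<phi>)
qed

section \<open>Lebesgue measure on the unit interval\<close>

text \<open>Restricting and completing commute, as traces of null sets on the interval are null sets
  of the restriction. This puts the interval into the form required by
  \<open>preserves_measure_completion\<close> and \<open>preserves_measure_factor\<close>.\<close>

lemma unit_interval_eq_completion:
  "unit_interval = completion (restrict_space lborel {0..1})"
proof (rule measure_eqI)
  have meas: "emeasure (restrict_space lborel {0..1::real}) Z = emeasure lborel Z" if "Z \<subseteq> {0..1}" for Z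
    by (rule emeasure_restrict_space) (use that in auto)
  have nulls: "N \<in> null_sets (restrict_space lborel {0..1::real}) \<longleftrightarrow> N \<subseteq> {0..1} \<and> N \<in> null_sets lborel" for N
    by (rule null_sets_restrict_space) simp
  have sets: "Z \<in> sets (restrict_space lborel {0..1::real}) \<longleftrightarrow> Z \<subseteq> {0..1} \<and> Z \<in> sets lborel" for Z
    by (subst sets_restrict_space_iff) auto
  show seq: "sets unit_interval = sets (completion (restrict_space lborel {0..1}))"
  proof (intro equalityI subsetI)
    fix Z assume "Z \<in> sets unit_interval"
    then have Z: "Z \<subseteq> {0..1}" "Z \<in> sets lebesgue"
      by (auto simp: sets_restrict_space_iff)
    then obtain A N N' where A: "Z = A \<union> N" "N \<subseteq> N'" "N' \<in> null_sets lborel" "A \<in> sets lborel"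
      by (auto elim: sets_completionE)
    show "Z \<in> sets (completion (restrict_space lborel {0..1}))"
    proof (rule sets_completionI)
      show "Z = A \<union> N" "N \<subseteq> N' \<inter> {0..1}"
        using A Z by auto
      show "N' \<inter> {0..1} \<in> null_sets (restrict_space lborel {0..1})"
        unfolding nulls using A(3) by (auto intro: null_set_Int2)
      show "A \<in> sets (restrict_space lborel {0..1})"
        using A Z by (auto simp: sets)
    qed
  next
    fix Z assume "Z \<in> sets (completion (restrict_space lborel {0..1::real}))"
    then obtain A N N' where A: "Z = A \<union> N" "N \<subseteq> N'" "N' \<in> null_sets (restrict_space lborel {0..1})"
      "A \<in> sets (restrict_space lborel {0..1})"
      by (auto elim: sets_completionE)
    then have "Z \<in> sets lebesgue"
      by (intro sets_completionI [of Z A N N']) (auto simp: sets nulls)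
    moreover have "Z \<subseteq> {0..1}"
      using A by (auto simp: sets nulls)
    ultimately show "Z \<in> sets unit_interval"
      by (auto simp: sets_restrict_space_iff)
  qed
  fix Z assume "Z \<in> sets unit_interval"
  then have Z: "Z \<in> sets (completion (restrict_space lborel {0..1}))" and Z01: "Z \<subseteq> {0..1}"
    and Zl: "Z \<in> sets lebesgue"
    by (auto simp: seq [symmetric] sets_restrict_space_iff)
  \<comment> \<open>A completed set is measured by its main part, which differs from it by a subset
    of a null set; so both sides can be evaluated on the Borel set \<open>?A\<close>.\<close>
  let ?A = "main_part (restrict_space lborel {0..1}) Z"
  have A: "?A \<in> sets (restrict_space lborel {0..1})"
    using Z by auto
  obtain N where N: "N \<in> null_sets (restrict_space lborel {0..1})"
      "null_part (restrict_space lborel {0..1}) Z \<subseteq> N"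
    using null_part [OF Z] by blast
  have ZA: "?A \<subseteq> Z" "Z \<subseteq> ?A \<union> N"
    using main_part_null_part_Un [OF Z] N(2) by blast+
  have "AE x in lebesgue. x \<notin> N"
    using N(1) by (intro AE_not_in null_sets_completionI) (simp add: nulls)
  then have "emeasure lebesgue Z = emeasure lebesgue ?A"
    by (intro emeasure_eq_AE) (use ZA Zl A in \<open>auto simp: sets elim!: eventually_mono\<close>)
  moreover have "emeasure unit_interval Z = emeasure lebesgue Z"
    by (rule emeasure_restrict_space) (use Z01 in auto)
  moreover have "emeasure lebesgue ?A = emeasure (restrict_space lborel {0..1}) ?A"
    using A meas by (simp add: sets)
  ultimately show "emeasure unit_interval Z = emeasure (completion (restrict_space lborel {0..1})) Z"
    using Z by simp
qed

text \<open>A finite Borel measure on the line is determined by its values on half-lines, so the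
  assumption \<open>meas\<close> fixes the law of S as the uniform one.\<close>

lemma preserves_measure_unit_intervalI:
  fixes S :: "'a \<Rightarrow> real"
  assumes M: "complete_measure M" and S: "S \<in> borel_measurable M"
    and S01: "\<And>x. x \<in> space M \<Longrightarrow> S x \<in> {0..1}"
    and meas: "\<And>a. 0 \<le> a \<Longrightarrow> a \<le> 1 \<Longrightarrow> emeasure M {x \<in> space M. S x > a} = ennreal (1 - a)"
    and space: "emeasure M (space M) = 1"
  shows "preserves_measure M unit_interval S"
  unfolding unit_interval_eq_completion
proof (rule preserves_measure_completion [OF M])
  \<comment> \<open>The uniform law as a measure on the whole line, so that both measures can be
    compared on all half-lines, also on those that start outside the interval.\<close>
  define \<nu> :: "real measure" where "\<nu> = density lborel (indicator {0..1})"
  have \<nu>: "emeasure \<nu> A = emeasure lborel (A \<inter> {0..1})" if "A \<in> sets borel" for A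
    using that by (simp add: \<nu>_def emeasure_density Int_commute flip: indicator_inter_arith)
  have distr: "distr M borel S = \<nu>"
  proof (rule measure_eqI_lessThan)
    have distr: "emeasure (distr M borel S) {x<..} = emeasure M {y \<in> space M. S y > x}" for x
      using S by (simp add: emeasure_distr vimage_def Int_def conj_commute)
    show "emeasure (distr M borel S) {x<..} = emeasure \<nu> {x<..}" for x
    proof -
      consider "x < 0" | "0 \<le> x" "x \<le> 1" | "x > 1" by linarith
      then show ?thesis
      proof cases
        case 1
        then have "{y \<in> space M. S y > x} = space M" "{x<..} \<inter> {0..1} = {0..1}"
          using S01 by fastforce+
        then show ?thesis by (simp add: distr \<nu> space)
      next
        case 2
        then have "{x<..} \<inter> {0..1} = {x<..1}" by auto
        with 2 show ?thesis by (simp add: distr \<nu> meas)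
      next
        case 3
        then have *: "{y \<in> space M. S y > x} = {}" "{x<..} \<inter> {0..1} = {}"
          using S01 by fastforce+
        show ?thesis by (simp add: distr \<nu> *)
      qed
    qed
    have "emeasure M {y \<in> space M. S y > x} \<le> emeasure M (space M)" for x
      by (rule emeasure_mono) auto
    also have "emeasure M (space M) < \<infinity>"
      by (simp add: space)
    finally show "emeasure (distr M borel S) {x<..} < \<infinity>" for x
      by (simp only: distr)
  qed (simp_all add: \<nu>_def)
  show "preserves_measure M (restrict_space lborel {0..1}) S"
    unfolding preserves_measure_def
  proof (intro conjI ballI)
    show "S \<in> M \<rightarrow>\<^sub>M restrict_space lborel {0..1}"
      by (rule measurable_restrict_space2) (use S01 S in auto)
    fix A assume "A \<in> sets (restrict_space lborel {0..1::real})"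
    then have A: "A \<in> sets borel" "A \<subseteq> {0..1}"
      by (subst (asm) sets_restrict_space_iff; simp)+
    have "emeasure M (S -` A \<inter> space M) = emeasure (distr M borel S) A"
      using S A by (simp add: emeasure_distr)
    also have "\<dots> = emeasure lborel A"
      using A by (simp add: distr \<nu> Int_absorb2)
    also have "\<dots> = emeasure (restrict_space lborel {0..1}) A"
      using A by (intro emeasure_restrict_space [symmetric]) auto
    finally show "emeasure M (S -` A \<inter> space M) = emeasure (restrict_space lborel {0..1}) A" .
  qed
qed

lemma preserves_measure_comp:
  assumes S: "preserves_measure N K S" and T: "preserves_measure M N T"
  shows "preserves_measure M K (\<lambda>c. S (T c))"
  unfolding preserves_measure_def
proof (intro conjI ballI)
  show "(\<lambda>c. S (T c)) \<in> measurable M K"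
    using S T by (auto intro: measurable_compose simp: preserves_measure_def)
  fix A assume A: "A \<in> sets K"
  have "(\<lambda>c. S (T c)) -` A \<inter> space M = T -` (S -` A \<inter> space N) \<inter> space M"
    using measurable_space [OF preserves_measure_measurable [OF T]] by auto
  moreover have "S -` A \<inter> space N \<in> sets N"
    using S A by (auto simp: preserves_measure_def intro: measurable_sets)
  ultimately show "emeasure M ((\<lambda>c. S (T c)) -` A \<inter> space M) = emeasure K A"
    by (simp only: preserves_measure_emeasure [OF S A] preserves_measure_emeasure [OF T])
qed

section \<open>Essentially bounded functions modulo null sets\<close>

lemma ess_bounded_fns_comp:
  assumes T: "preserves_measure M N T" and f: "f \<in> ess_bounded_fns N"
  shows "(\<lambda>x. f (T x)) \<in> ess_bounded_fns M"
proof -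
  obtain C where C: "AE y in N. cmod (f y) \<le> C"
    using f by (auto simp: ess_bounded_fns_def)
  have "AE x in M. cmod (f (T x)) \<le> C"
    by (rule preserves_measure_AE [OF T C])
  moreover have "(\<lambda>x. f (T x)) \<in> borel_measurable M"
    using measurable_compose [OF preserves_measure_measurable [OF T], of f borel] f
    by (simp add: ess_bounded_fns_def)
  ultimately show ?thesis
    by (auto simp: ess_bounded_fns_def)
qed

lemma equiv_ae_rel: "equiv (ess_bounded_fns M) (ae_rel M)"
proof (rule equivI)
  show "trans (ae_rel M)"
    unfolding trans_def ae_rel_def by auto
  show "sym (ae_rel M)"
    unfolding sym_def ae_rel_def by auto
qed (auto simp: refl_on_def ae_rel_def)

lemma ae_class_eq_iff:
  assumes "f \<in> ess_bounded_fns M" "g \<in> ess_bounded_fns M"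
  shows "ae_rel M `` {f} = ae_rel M `` {g} \<longleftrightarrow> (AE x in M. f x = g x)"
  using eq_equiv_class_iff [OF equiv_ae_rel assms] assms by (simp add: ae_rel_def)

lemma Linf_eq: "Linf M = (\<lambda>f. ae_rel M `` {f}) ` ess_bounded_fns M"
  unfolding Linf_def quotient_def by blast

text \<open>Letting f run over a whole class in \<open>Linf_comp\<close> still yields a single
  class: representatives differ on a null set of N, whose preimage under T is null.\<close>

lemma Linf_comp_class:
  assumes T: "preserves_measure M N T" and f: "f \<in> ess_bounded_fns N"
  shows "Linf_comp M T (ae_rel N `` {f}) = ae_rel M `` {\<lambda>x. f (T x)}"
proof (intro equalityI subsetI)
  fix g assume "g \<in> Linf_comp M T (ae_rel N `` {f})"
  then obtain f' where g: "g \<in> ess_bounded_fns M" "AE x in M. g x = f' (T x)" and "AE y in N. f y = f' y"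
    by (auto simp: Linf_comp_def ae_rel_def)
  from preserves_measure_AE [OF T this(3)] g(2) have "AE x in M. f (T x) = g x"
    by eventually_elim simp
  then show "g \<in> ae_rel M `` {\<lambda>x. f (T x)}"
    using g ess_bounded_fns_comp [OF T f] by (simp add: ae_rel_def)
next
  fix g assume g: "g \<in> ae_rel M `` {\<lambda>x. f (T x)}"
  then have "AE x in M. g x = f (T x)"
    by (auto simp: ae_rel_def elim: eventually_mono)
  moreover have "f \<in> ae_rel N `` {f}"
    using f by (simp add: ae_rel_def)
  ultimately show "g \<in> Linf_comp M T (ae_rel N `` {f})"
    using g by (auto simp: Linf_comp_def ae_rel_def)
qed

lemma Linf_comp_image_Linf:
  assumes "preserves_measure M N S"
  shows "Linf_comp M S ` Linf N = (\<lambda>f. ae_rel M `` {\<lambda>x. f (S x)}) ` ess_bounded_fns N"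
  unfolding Linf_eq image_image by (intro image_cong refl Linf_comp_class assms)

lemma Linf_comp_image_Linf2:
  assumes S: "preserves_measure M N S" and T: "preserves_measure M M T"
  shows "Linf_comp M T ` Linf_comp M S ` Linf N = (\<lambda>f. ae_rel M `` {\<lambda>x. f (S (T x))}) ` ess_bounded_fns N"
  unfolding Linf_comp_image_Linf [OF S] image_image
  by (intro image_cong refl Linf_comp_class [OF T] ess_bounded_fns_comp [OF S])

text \<open>If f o T and g o T agree almost everywhere, then the preimage of the measurable set
  where f and g differ is null; preservation of the measure makes that set null itself.\<close>

lemma inj_on_Linf_comp:
  assumes T: "preserves_measure M N T"
  shows "inj_on (Linf_comp M T) (Linf N)"
proof (rule inj_onI)
  fix F G assume "F \<in> Linf N" "G \<in> Linf N" and eq: "Linf_comp M T F = Linf_comp M T G"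
  then obtain f g where fg: "f \<in> ess_bounded_fns N" "g \<in> ess_bounded_fns N"
    "F = ae_rel N `` {f}" "G = ae_rel N `` {g}"
    by (auto simp: Linf_eq)
  have "AE x in M. f (T x) = g (T x)"
    using eq fg by (simp add: Linf_comp_class [OF T] ae_class_eq_iff ess_bounded_fns_comp [OF T])
  moreover have "{y \<in> space N. f y = g y} \<in> sets N"
  proof -
    have "(\<lambda>y. f y - g y) \<in> borel_measurable N"
      using fg(1,2) by (auto simp: ess_bounded_fns_def)
    then have "(\<lambda>y. f y - g y) -` {0} \<inter> space N \<in> sets N"
      by (rule measurable_sets) simp
    moreover have "(\<lambda>y. f y - g y) -` {0} \<inter> space N = {y \<in> space N. f y = g y}"
      by auto
    ultimately show ?thesis by simp
  qed
  ultimately have "AE y in N. f y = g y"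
    using preserves_measure_AE_iff [OF T, of "\<lambda>y. f y = g y"] by simp
  then show "F = G"
    using fg by (simp add: ae_class_eq_iff)
qed

section \<open>Automorphisms of the interval and invariance under composition\<close>

text \<open>Values are forced into the interval everywhere, so that the target can be the Borel
  space on it, as \<open>preserves_measure_factor\<close> demands.\<close>

lemma clip_measurable:
  assumes "g \<in> borel_measurable unit_interval"
  shows "(\<lambda>x. max 0 (min 1 (Re (g x)))) \<in> measurable unit_interval (restrict_space lborel {0..1})"
  by (rule measurable_restrict_space2) (use assms in \<open>auto intro!: borel_measurable_max borel_measurable_min borel_measurable_Re\<close>)

lemma automorphism_iff_Linf_comp_eq:
  assumes M: "complete_measure M"
    and S: "preserves_measure M unit_interval S" and T: "preserves_measure M M T"
  shows "(\<exists>\<phi>. \<phi> \<in> {0..1} \<rightarrow> {0..1} \<and> (AE c in M. S (T c) = \<phi> (S c)) \<and> measure_automorphism unit_interval \<phi>)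
     \<longleftrightarrow> Linf_comp M T ` Linf_comp M S ` Linf unit_interval = Linf_comp M S ` Linf unit_interval"
    (is "?lhs \<longleftrightarrow> ?rhs")
proof
  let ?EB = "ess_bounded_fns unit_interval"
  note comp = ess_bounded_fns_comp [OF S] ess_bounded_fns_comp [OF T ess_bounded_fns_comp [OF S]]
  assume ?lhs
  then obtain \<phi> \<psi> where \<phi>: "AE c in M. S (T c) = \<phi> (S c)" "preserves_measure unit_interval unit_interval \<phi>"
    and \<psi>: "preserves_measure unit_interval unit_interval \<psi>" "AE x in unit_interval. \<psi> (\<phi> x) = x"
    by (auto simp: measure_automorphism_def measure_preserving_map_iff)
  show ?rhs
  proof (intro equalityI subsetI)
    fix F assume "F \<in> Linf_comp M T ` Linf_comp M S ` Linf unit_interval"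
    then obtain f where f: "f \<in> ?EB" "F = ae_rel M `` {\<lambda>c. f (S (T c))}"
      unfolding Linf_comp_image_Linf2 [OF S T] by blast
    have f': "(\<lambda>x. f (\<phi> x)) \<in> ?EB"
      by (rule ess_bounded_fns_comp [OF \<phi>(2) f(1)])
    have "F = ae_rel M `` {\<lambda>c. f (\<phi> (S c))}"
      unfolding f(2) by (subst ae_class_eq_iff) (use f(1) f' comp \<phi>(1) in \<open>auto elim: eventually_mono\<close>)
    then show "F \<in> Linf_comp M S ` Linf unit_interval"
      unfolding Linf_comp_image_Linf [OF S] by (rule image_eqI [OF _ f'])
  next
    fix F assume "F \<in> Linf_comp M S ` Linf unit_interval"
    then obtain f where f: "f \<in> ?EB" "F = ae_rel M `` {\<lambda>c. f (S c)}"
      unfolding Linf_comp_image_Linf [OF S] by blast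
    have f': "(\<lambda>x. f (\<psi> x)) \<in> ?EB"
      by (rule ess_bounded_fns_comp [OF \<psi>(1) f(1)])
    \<comment> \<open>\<open>\<psi>\<close> inverts \<open>\<phi>\<close> almost everywhere on the
      interval. Pulled back along S this gives \<open>\<psi>\<close> (S (T c)) = S c, so f o
      \<open>\<psi>\<close> witnesses the reverse inclusion.\<close>
    have "AE c in M. f (S c) = f (\<psi> (S (T c)))"
      using \<phi>(1) preserves_measure_AE [OF S \<psi>(2)] by eventually_elim simp
    then have "F = ae_rel M `` {\<lambda>c. f (\<psi> (S (T c)))}"
      unfolding f(2) by (subst ae_class_eq_iff) (use f(1) f' comp in auto)
    then show "F \<in> Linf_comp M T ` Linf_comp M S ` Linf unit_interval"
      unfolding Linf_comp_image_Linf2 [OF S T] by (rule image_eqI [OF _ f'])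
  qed
next
  let ?EB = "ess_bounded_fns unit_interval"
  note comp = ess_bounded_fns_comp [OF S] ess_bounded_fns_comp [OF T ess_bounded_fns_comp [OF S]]
  assume ?rhs
  then have eq: "(\<lambda>f. ae_rel M `` {\<lambda>c. f (S (T c))}) ` ?EB = (\<lambda>f. ae_rel M `` {\<lambda>c. f (S c)}) ` ?EB"
    unfolding Linf_comp_image_Linf2 [OF S T] unfolding Linf_comp_image_Linf [OF S] .
  have S01: "S c \<in> {0..1}" if "c \<in> space M" for c
    using measurable_space [OF preserves_measure_measurable [OF S] that] by simp
  have T_space: "T c \<in> space M" if "c \<in> space M" for c
    by (rule measurable_space [OF preserves_measure_measurable [OF T] that])
  \<comment> \<open>The pullbacks of the coordinate function along S and S o T are S and S o T
    themselves, so invariance applied to it becomes an equation between points of the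
    interval.\<close>
  have id: "complex_of_real \<in> ?EB"
  proof -
    have "AE x in unit_interval. cmod (complex_of_real x) \<le> 1"
      by (rule AE_I2) simp
    moreover have "complex_of_real \<in> borel_measurable unit_interval"
      using measurable_compose [OF id_borel_measurable_lebesgue_on [of "{0..1::real}"] borel_measurable_of_real]
      by simp
    ultimately show ?thesis
      by (auto simp: ess_bounded_fns_def)
  qed
  obtain g where g: "g \<in> ?EB" "AE c in M. complex_of_real (S (T c)) = g (S c)"
  proof -
    have "ae_rel M `` {\<lambda>c. complex_of_real (S (T c))} \<in> (\<lambda>f. ae_rel M `` {\<lambda>c. f (S c)}) ` ?EB"
      using id unfolding eq [symmetric] by blast
    then show thesis
      using that comp id by (auto simp: ae_class_eq_iff)
  qed
  obtain h where h: "h \<in> ?EB" "AE c in M. complex_of_real (S c) = h (S (T c))"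
  proof -
    have "ae_rel M `` {\<lambda>c. complex_of_real (S c)} \<in> (\<lambda>f. ae_rel M `` {\<lambda>c. f (S (T c))}) ` ?EB"
      using id unfolding eq by blast
    then show thesis
      using that comp id by (auto simp: ae_class_eq_iff)
  qed
  \<comment> \<open>g and h are complex valued and correct only almost everywhere. Real part and
    clipping give maps into the interval and change nothing where the value already is S (T c) or S
    c.\<close>
  define \<phi> where "\<phi> x = max 0 (min 1 (Re (g x)))" for x
  define \<psi> where "\<psi> x = max 0 (min 1 (Re (h x)))" for x
  have meas: "\<phi> \<in> measurable unit_interval (restrict_space lborel {0..1})"
      "\<psi> \<in> measurable unit_interval (restrict_space lborel {0..1})"
    unfolding \<phi>_def [abs_def] \<psi>_def [abs_def] using g(1) h(1)
    by (auto intro!: clip_measurable simp: ess_bounded_fns_def)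
  have clip: "max 0 (min 1 (Re (complex_of_real x))) = x" if "x \<in> {0..1}" for x
    using that by auto
  have \<phi>: "AE c in M. S (T c) = \<phi> (S c)"
    using g(2) AE_space
  proof eventually_elim
    case (elim c)
    then show ?case
      using clip [OF S01 [OF T_space [OF elim(2)]]] unfolding \<phi>_def by (simp add: elim(1) [symmetric])
  qed
  have \<psi>: "AE c in M. S c = \<psi> (S (T c))"
    using h(2) AE_space
  proof eventually_elim
    case (elim c)
    then show ?case
      using clip [OF S01 [OF elim(2)]] unfolding \<psi>_def by (simp add: elim(1) [symmetric])
  qed
  have ST: "preserves_measure M unit_interval (\<lambda>c. S (T c))"
    by (rule preserves_measure_comp [OF S T])
  have \<phi>_pres: "preserves_measure unit_interval unit_interval \<phi>"
    using preserves_measure_factor [OF M S [unfolded unit_interval_eq_completion]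
        ST [unfolded unit_interval_eq_completion] meas(1) [unfolded unit_interval_eq_completion] \<phi>]
    unfolding unit_interval_eq_completion .
  have \<psi>_pres: "preserves_measure unit_interval unit_interval \<psi>"
    using preserves_measure_factor [OF M ST [unfolded unit_interval_eq_completion]
        S [unfolded unit_interval_eq_completion] meas(2) [unfolded unit_interval_eq_completion] \<psi>]
    unfolding unit_interval_eq_completion .
  \<comment> \<open>The inverse relations are first known on M; to descend to the interval, the sets
    on which they hold have to be measurable.\<close>
  have fix_sets: "{x \<in> space unit_interval. f x = x} \<in> sets unit_interval"
    if "preserves_measure unit_interval unit_interval f" for f
  proof (rule borel_measurable_eq)
    have id: "(\<lambda>x. x) \<in> borel_measurable unit_interval"
      using id_borel_measurable_lebesgue_on [of "{0..1}"] by (simp add: id_def)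
    then show "(\<lambda>x. x) \<in> borel_measurable unit_interval" .
    show "f \<in> borel_measurable unit_interval"
      using measurable_compose [OF preserves_measure_measurable [OF that] id] .
  qed
  have "AE c in M. \<psi> (\<phi> (S c)) = S c"
    using \<phi> \<psi> by eventually_elim simp
  then have inv1: "AE x in unit_interval. \<psi> (\<phi> x) = x"
    using preserves_measure_AE_iff [OF S fix_sets [OF preserves_measure_comp [OF \<psi>_pres \<phi>_pres]]] by blast
  \<comment> \<open>The map \<open>\<psi>\<close> is known at the points S (T c), so this relation
    descends along S o T and not along S.\<close>
  have "AE c in M. \<phi> (\<psi> (S (T c))) = S (T c)"
    using \<phi> \<psi> by eventually_elim simp
  then have inv2: "AE x in unit_interval. \<phi> (\<psi> x) = x"
    using preserves_measure_AE_iff [OF ST fix_sets [OF preserves_measure_comp [OF \<phi>_pres \<psi>_pres]]] by blast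
  have "\<phi> \<in> {0..1} \<rightarrow> {0..1}"
    by (auto simp: \<phi>_def)
  then show ?lhs
    using \<phi> \<phi>_pres \<psi>_pres inv1 inv2
    by (auto simp: measure_automorphism_def measure_preserving_map_iff)
qed

section \<open>Averages over finite partitions of the unit interval\<close>

text \<open>Closed on the right: cell i contains i / m, the point that the standard part sees at i.
  The cells with numbers 1 to m partition the interval without the point 0.\<close>

definition cell :: "nat \<Rightarrow> nat \<Rightarrow> real set" where
  "cell m i = {(real i - 1) / real m <.. real i / real m}"

text \<open>A mean value, since the cell has length 1 / m. Means ignore null sets, unlike the value
  at i / m.\<close>

definition cell_average :: "nat \<Rightarrow> (real \<Rightarrow> complex) \<Rightarrow> nat \<Rightarrow> complex" where
  "cell_average m F i = real m *\<^sub>R (\<integral>x. indicator (cell m i) x *\<^sub>R F x \<partial>unit_interval)"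

lemma finite_measure_unit_interval: "finite_measure unit_interval"
  by (rule finite_measure_lebesgue_on) simp

lemma cell_subset:
  assumes i: "i \<in> {1..m}"
  shows "cell m i \<subseteq> {0..1}"
proof
  fix x assume "x \<in> cell m i"
  then have x: "(real i - 1) / real m < x" "x \<le> real i / real m"
    by (auto simp: cell_def)
  moreover have "0 \<le> (real i - 1) / real m" "real i / real m \<le> 1"
    using i by (auto simp: divide_simps)
  ultimately show "x \<in> {0..1}" by simp
qed

lemma cell_in_sets [measurable]: "i \<in> {1..m} \<Longrightarrow> cell m i \<in> sets unit_interval"
  using cell_subset [of i m] by (simp add: sets_restrict_space_iff cell_def)

lemma measure_cell: "i \<in> {1..m} \<Longrightarrow> measure unit_interval (cell m i) = 1 / real m"
  using cell_subset [of i m]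
  by (subst measure_restrict_space) (auto simp: cell_def field_simps)

lemma integrable_cell:
  "i \<in> {1..m} \<Longrightarrow> integrable unit_interval F \<Longrightarrow> integrable unit_interval (\<lambda>x. indicator (cell m i) x *\<^sub>R F x)"
  for F :: "real \<Rightarrow> 'a::{banach, second_countable_topology}"
  by (intro integrable_mult_indicator cell_in_sets)

lemma cell_average_diff:
  assumes "i \<in> {1..m}" "integrable unit_interval F" "integrable unit_interval G"
  shows "cell_average m (\<lambda>x. F x - G x) i = cell_average m F i - cell_average m G i"
  unfolding cell_average_def using assms by (simp add: scaleR_diff_right integrable_cell)

lemma integral_cell_const:
  fixes z :: "'a::{banach, second_countable_topology}"
  assumes i: "i \<in> {1..m}"
  shows "(\<integral>x. indicator (cell m i) x *\<^sub>R z \<partial>unit_interval) = (1 / real m) *\<^sub>R z"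
proof -
  have "integrable unit_interval (indicator (cell m i) :: real \<Rightarrow> real)"
    using integrable_cell [OF i finite_measure.integrable_const [OF finite_measure_unit_interval, of "1 :: real"]]
    by simp
  then show ?thesis
    using measure_cell [OF i] cell_subset [OF i]
    by (subst Bochner_Integration.integral_scaleR_left) (simp_all add: Int_absorb2)
qed

lemma cell_average_const:
  assumes "i \<in> {1..m}"
  shows "cell_average m (\<lambda>x. z) i = z"
  using assms by (simp add: cell_average_def integral_cell_const)

lemma cell_average_bound:
  assumes i: "i \<in> {1..m}" and F: "integrable unit_interval F"
    and e: "\<And>x. x \<in> cell m i \<Longrightarrow> cmod (F x) \<le> e"
  shows "cmod (cell_average m F i) \<le> e"
proof -
  have "cmod (\<integral>x. indicator (cell m i) x *\<^sub>R F x \<partial>unit_interval) \<le> (\<integral>x. indicator (cell m i) x *\<^sub>R e \<partial>unit_interval)"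
    by (rule Bochner_Integration.integral_norm_bound_integral [OF integrable_cell [OF i F]])
      (use e in \<open>auto intro: integrable_cell [OF i finite_measure.integrable_const [OF finite_measure_unit_interval]]
         simp del: real_scaleR_def split: split_indicator\<close>)
  also have "\<dots> = e / real m"
    unfolding integral_cell_const [OF i] by simp
  finally show ?thesis
    using i by (simp add: cell_average_def field_simps)
qed

text \<open>Distinct cells are disjoint: a common point forces i and j to differ by less than
  1.\<close>

lemma sum_indicator_cell_le_1: "(\<Sum>i=1..m. indicator (cell m i) x :: real) \<le> 1"
proof -
  have "i = j" if "i \<in> {1..m}" "x \<in> cell m i" "x \<in> cell m j" for i j
  proof -
    have "real i - 1 < real j" "real j - 1 < real i"
      using that by (auto simp: cell_def field_simps)
    then show ?thesis by linarith
  qed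
  then have "card {i \<in> {1..m}. x \<in> cell m i} \<le> 1"
    by (auto simp: card_le_Suc0_iff_eq)
  moreover have "(\<Sum>i=1..m. indicator (cell m i) x :: real) = real (card {i \<in> {1..m}. x \<in> cell m i})"
    by (simp add: indicator_def of_bool_def sum.If_cases Int_def)
  ultimately show ?thesis by simp
qed

text \<open>Integrals over disjoint cells add up to at most the integral over the interval. Divided
  by m, this says that averaging contracts the L1 norm.\<close>

lemma sum_cell_average_le:
  assumes F: "integrable unit_interval F"
  shows "(\<Sum>i=1..m. cmod (cell_average m F i)) \<le> real m * (\<integral>x. cmod (F x) \<partial>unit_interval)"
proof -
  have nF: "integrable unit_interval (\<lambda>x. cmod (F x))"
    using F by simp
  have "(\<Sum>i=1..m. cmod (cell_average m F i)) \<le>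
      (\<Sum>i=1..m. real m * (\<integral>x. indicator (cell m i) x *\<^sub>R cmod (F x) \<partial>unit_interval))"
  proof (rule sum_mono)
    fix i assume i: "i \<in> {1..m}"
    have "cmod (\<integral>x. indicator (cell m i) x *\<^sub>R F x \<partial>unit_interval)
        \<le> (\<integral>x. indicator (cell m i) x *\<^sub>R cmod (F x) \<partial>unit_interval)"
      by (rule Bochner_Integration.integral_norm_bound_integral) (use i F nF in \<open>auto intro: integrable_cell simp del: real_scaleR_def split: split_indicator\<close>)
    then show "cmod (cell_average m F i) \<le> real m * (\<integral>x. indicator (cell m i) x *\<^sub>R cmod (F x) \<partial>unit_interval)"
      by (simp add: cell_average_def mult_left_mono)
  qed
  also have "\<dots> = real m * (\<integral>x. (\<Sum>i=1..m. indicator (cell m i) x *\<^sub>R cmod (F x)) \<partial>unit_interval)"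
    by (subst Bochner_Integration.integral_sum) (auto simp: sum_distrib_left simp del: real_scaleR_def intro: integrable_cell [OF _ nF])
  also have "\<dots> \<le> real m * (\<integral>x. cmod (F x) \<partial>unit_interval)"
  proof (intro mult_left_mono integral_mono)
    show "integrable unit_interval (\<lambda>x. \<Sum>i=1..m. indicator (cell m i) x *\<^sub>R cmod (F x))"
      by (intro Bochner_Integration.integrable_sum integrable_cell nF)
    show "(\<Sum>i=1..m. indicator (cell m i) x *\<^sub>R cmod (F x)) \<le> cmod (F x)" for x
      using mult_right_mono [OF sum_indicator_cell_le_1 [of m x] norm_ge_zero [of "F x"]]
      by (simp add: sum_distrib_right)
  qed (use nF in auto)
  finally show ?thesis .
qed

lemma bounded_integrable_unit_interval:
  fixes f :: "real \<Rightarrow> complex"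
  assumes "f \<in> borel_measurable unit_interval" "\<And>x. cmod (f x) \<le> C"
  shows "integrable unit_interval f"
  by (rule finite_measure.integrable_const_bound [OF finite_measure_unit_interval, of f C])
    (use assms in auto)

text \<open>The representative F and its approximants obey one bound C everywhere, not only almost
  everywhere: the lifts have to be uniformly bounded, and C + C dominates the differences in the
  limit.\<close>

lemma continuous_approximation_unit_interval:
  assumes f: "f \<in> ess_bounded_fns unit_interval"
  obtains F C g where
    "AE x in unit_interval. f x = F x" "F \<in> borel_measurable unit_interval" "\<And>x. cmod (F x) \<le> C"
    "\<And>j. continuous_on UNIV (g j)" "\<And>j x. cmod (g j x) \<le> C"
    "(\<lambda>j. \<integral>x. cmod (F x - g j x) \<partial>unit_interval) \<longlonglongrightarrow> 0"
proof -
  obtain C0 where C0: "AE x in unit_interval. cmod (f x) \<le> C0" and fm: "f \<in> borel_measurable unit_interval"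
    using f by (auto simp: ess_bounded_fns_def)
  \<comment> \<open>The maximum with 0 keeps the disc of radius C nonempty and admits the default
    value 0 of F.\<close>
  define C where "C = max 0 C0"
  define F where "F x = (if cmod (f x) \<le> C then f x else 0)" for x
  have F_le: "cmod (F x) \<le> C" for x
    by (simp add: F_def C_def)
  have F_meas: "F \<in> borel_measurable unit_interval"
    unfolding F_def [abs_def] using fm by measurable
  have fF: "AE x in unit_interval. f x = F x"
    using C0 by eventually_elim (simp add: F_def C_def)
  \<comment> \<open>Measurability in the sense of \<open>measurable_on\<close> provides continuous
    functions that converge pointwise off a negligible set to the extension by 0.\<close>
  have "(\<lambda>x. if x \<in> {0..1} then F x else 0) measurable_on {0..1}"
    by (rule lebesgue_measurable_imp_measurable_on [OF borel_measurable_if_I [OF F_meas]]) auto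
  then obtain N h where N: "negligible N" and h: "\<And>j. continuous_on UNIV (h j)"
    and lim: "\<And>x. x \<notin> N \<Longrightarrow> (\<lambda>j. h j x) \<longlonglongrightarrow> (if x \<in> {0..1} then if x \<in> {0..1} then F x else 0 else 0)"
    unfolding measurable_on_def by blast
  \<comment> \<open>The nearest-point retraction onto the disc truncates complex values
    continuously; it fixes the values of F, so the limits survive.\<close>
  define P where "P = closest_point (cball (0::complex) C)"
  have P_le: "cmod (P z) \<le> C" for z
    using closest_point_in_set [of "cball (0::complex) C" z] by (auto simp: P_def C_def)
  have P_self: "P z = z" if "cmod z \<le> C" for z
    unfolding P_def by (rule closest_point_self) (use that in auto)
  have P_cont: "continuous_on UNIV P"
    unfolding P_def by (rule continuous_on_closest_point) (auto simp: C_def)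
  define g where "g j x = P (h j x)" for j x
  have g_cont: "continuous_on UNIV (g j)" for j
    unfolding g_def [abs_def] by (rule continuous_on_compose2 [OF P_cont h]) simp
  have g_lim: "(\<lambda>j. g j x) \<longlonglongrightarrow> F x" if "x \<notin> N" "x \<in> {0..1}" for x
  proof -
    have "(\<lambda>j. P (h j x)) \<longlonglongrightarrow> P (F x)"
    proof -
      have "isCont P (F x)"
        using P_cont by (simp add: continuous_on_eq_continuous_at)
      moreover have "(\<lambda>j. h j x) \<longlonglongrightarrow> F x"
        using lim [OF that(1)] that(2) by simp
      ultimately show ?thesis
        by (rule isCont_tendsto_compose)
    qed
    then show ?thesis
      by (simp add: g_def P_self [OF F_le])
  qed
  have g_meas: "g j \<in> borel_measurable unit_interval" for j
    by (rule continuous_imp_measurable_on_sets_lebesgue [OF continuous_on_subset [OF g_cont]]) auto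
  have "(\<lambda>j. \<integral>x. cmod (F x - g j x) \<partial>unit_interval) \<longlonglongrightarrow> (\<integral>x. 0 \<partial>unit_interval)"
  proof (rule integral_dominated_convergence [where w = "\<lambda>_. C + C"])
    show "(\<lambda>x. cmod (F x - g j x)) \<in> borel_measurable unit_interval" for j
      using F_meas g_meas by measurable
    show "integrable unit_interval (\<lambda>_. C + C)"
      by (rule finite_measure.integrable_const [OF finite_measure_unit_interval])
    have "N \<inter> {0..1} \<in> null_sets unit_interval"
      using N by (subst null_sets_restrict_space) (auto simp: negligible_iff_null_sets intro: null_set_Int2)
    then have "AE x in unit_interval. x \<notin> N \<inter> {0..1}"
      by (rule AE_not_in)
    then show "AE x in unit_interval. (\<lambda>j. cmod (F x - g j x)) \<longlonglongrightarrow> 0"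
      using AE_space
    proof eventually_elim
      case (elim x)
      then have "(\<lambda>j. cmod (F x - g j x)) \<longlonglongrightarrow> cmod (F x - F x)"
        by (intro tendsto_intros g_lim) auto
      then show ?case by simp
    qed
    show "AE x in unit_interval. norm (cmod (F x - g j x)) \<le> C + C" for j
    proof (rule AE_I2)
      fix x
      show "norm (cmod (F x - g j x)) \<le> C + C"
        using norm_triangle_ineq4 [of "F x" "g j x"] F_le [of x] P_le [of "h j x"] by (simp add: g_def)
    qed
  qed auto
  then show thesis
    using that [OF fF F_meas F_le g_cont, of "\<lambda>j. j" ] P_le by (simp add: g_def)
qed

text \<open>The indices with i / m > b are those above the floor of b m, and that floor divided by m
  tends to b. This is the uniform law of the standard part, seen at the finite stages.\<close>

lemma tendsto_fraction_above:
  assumes "filterlim n at_top F" and "0 \<le> b" "b \<le> 1"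
  shows "((\<lambda>k. real (card {i \<in> {1..n k}. real i / real (n k) > b}) / real (n k)) \<longlongrightarrow> 1 - b) F"
proof (rule Lim_transform_eventually)
  have card: "real (card {i \<in> {1..m}. real i / real m > b}) = real m - real (nat \<lfloor>b * real m\<rfloor>)"
    if "m > 0" for m :: nat
  proof -
    have le: "nat \<lfloor>b * real m\<rfloor> \<le> m"
      using assms(2,3) mult_left_le_one_le [of "real m" b] by (simp add: nat_le_iff floor_le_iff)
    have "b * real m \<ge> 0"
      using assms(2) by simp
    then have "i > 0" if "b * real m < real i" for i
      using that by (cases i) auto
    then have "{i \<in> {1..m}. real i / real m > b} = {Suc (nat \<lfloor>b * real m\<rfloor>)..m}"
      using that assms(2) by (auto simp: field_simps Suc_le_eq nat_less_iff floor_less_iff)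
    then show ?thesis using le by (simp add: of_nat_diff)
  qed
  have "eventually (\<lambda>k. n k > 0) F"
    using eventually_compose_filterlim [OF eventually_gt_at_top [of 0] assms(1)] .
  then show "eventually (\<lambda>k. 1 - of_int \<lfloor>b * real (n k)\<rfloor> / real (n k) =
      real (card {i \<in> {1..n k}. real i / real (n k) > b}) / real (n k)) F"
  proof eventually_elim
    case (elim k)
    then show ?case
      using card [OF elim] assms(2) by (simp add: diff_divide_distrib)
  qed
  have "((\<lambda>x::real. of_int \<lfloor>b * x\<rfloor> / x) \<longlongrightarrow> b) at_top"
  proof (rule tendsto_sandwich)
    show "((\<lambda>x. (b * x - 1) / x) \<longlongrightarrow> b) at_top"
      by real_asymp
    show "((\<lambda>x. (b * x) / x) \<longlongrightarrow> b) at_top"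
      by real_asymp
    show "eventually (\<lambda>x. (b * x - 1) / x \<le> of_int \<lfloor>b * x\<rfloor> / x) at_top"
      using eventually_gt_at_top [of 0] by eventually_elim (intro divide_right_mono; linarith)
    show "eventually (\<lambda>x. of_int \<lfloor>b * x\<rfloor> / x \<le> (b * x) / x) at_top"
      using eventually_gt_at_top [of 0] by eventually_elim (intro divide_right_mono; linarith)
  qed
  then have "((\<lambda>k. of_int \<lfloor>b * real (n k)\<rfloor> / real (n k)) \<longlongrightarrow> b) F"
    by (rule filterlim_compose) (rule filterlim_compose [OF filterlim_real_sequentially assms(1)])
  then show "((\<lambda>k. 1 - of_int \<lfloor>b * real (n k)\<rfloor> / real (n k)) \<longlongrightarrow> 1 - b) F"
    by (intro tendsto_intros)
qed

text \<open>Markov's inequality for the uniform distribution on m points.\<close>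

lemma card_le_average:
  fixes d :: "nat \<Rightarrow> real"
  assumes "\<And>i. i \<in> {1..m} \<Longrightarrow> 0 \<le> d i" and "e > 0"
  shows "real (card {i \<in> {1..m}. d i > e}) / real m \<le> ((\<Sum>i=1..m. d i) / real m) / e"
proof -
  have "real (card {i \<in> {1..m}. d i > e}) * e = (\<Sum>i\<in>{i \<in> {1..m}. d i > e}. e)"
    by simp
  also have "\<dots> \<le> (\<Sum>i\<in>{i \<in> {1..m}. d i > e}. d i)"
    by (rule sum_mono) auto
  also have "\<dots> \<le> (\<Sum>i=1..m. d i)"
    by (rule sum_mono2) (use assms(1) in auto)
  finally have "real (card {i \<in> {1..m}. d i > e}) \<le> (\<Sum>i=1..m. d i) / e"
    using assms(2) by (simp add: pos_le_divide_eq)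
  then have "real (card {i \<in> {1..m}. d i > e}) / real m \<le> ((\<Sum>i=1..m. d i) / e) / real m"
    by (rule divide_right_mono) simp
  then show ?thesis by (simp add: field_simps)
qed

text \<open>Converse to the Markov bound: terms up to the threshold e contribute at most e to the
  mean, the others at most C each.\<close>

lemma average_le_card:
  fixes d :: "nat \<Rightarrow> real"
  assumes "\<And>i. i \<in> {1..m} \<Longrightarrow> d i \<le> C" and "e > 0" "C \<ge> 0" "m > 0"
  shows "(\<Sum>i=1..m. d i) / real m \<le> e + C * (real (card {i \<in> {1..m}. d i > e}) / real m)"
proof -
  have "(\<Sum>i=1..m. d i) \<le> (\<Sum>i=1..m. e + (if d i > e then C else 0))"
    by (rule sum_mono) (use assms in \<open>auto simp: add_increasing\<close>)
  also have "\<dots> = real m * e + real (card {i \<in> {1..m}. d i > e}) * C"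
    by (simp add: sum.distrib sum.If_cases Int_def)
  finally show ?thesis
    using assms(4) by (simp add: field_simps)
qed

section \<open>Matrix sequences and the tracial ultraproduct\<close>

lemma mult_mat_index_sum:
  assumes "A \<in> carrier_mat m m" "B \<in> carrier_mat m m" "i < m" "j < m"
  shows "(A * B) $$ (i, j) = (\<Sum>l<m. A $$ (i, l) * B $$ (l, j))"
  using assms by (auto simp: scalar_prod_def atLeast0LessThan intro!: sum.cong)

lemma mult_mat_vec_index_sum:
  assumes "A \<in> carrier_mat m m" "v \<in> carrier_vec m" "i < m"
  shows "vec_index (A *\<^sub>v v) i = (\<Sum>l<m. A $$ (i, l) * vec_index v l)"
  using assms by (auto simp: scalar_prod_def atLeast0LessThan intro!: sum.cong)

lemma dim_mat_adjoint [simp]: "dim_row (mat_adjoint A) = dim_col A" "dim_col (mat_adjoint A) = dim_row A"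
  by (simp_all add: mat_adjoint_def mat_of_rows_def)

lemma mat_adjoint_carrier [simp]:
  "A \<in> carrier_mat m m \<Longrightarrow> mat_adjoint A \<in> carrier_mat m m"
  by (auto intro: carrier_matI)

lemma mat_adjoint_index:
  fixes A :: "complex mat"
  assumes "A \<in> carrier_mat m m" "i < m" "j < m"
  shows "mat_adjoint A $$ (i, j) = cnj (A $$ (j, i))"
  using assms unfolding mat_adjoint_def by (auto simp: mat_of_rows_index)

lemma mat_adjoint_mult:
  fixes A :: "complex mat"
  assumes A: "A \<in> carrier_mat m m" and B: "B \<in> carrier_mat m m"
  shows "mat_adjoint (A * B) = mat_adjoint B * mat_adjoint A"
proof (rule eq_matI)
  have AB: "A * B \<in> carrier_mat m m" using A B by simp
  have car: "mat_adjoint (A * B) \<in> carrier_mat m m" "mat_adjoint B * mat_adjoint A \<in> carrier_mat m m"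
    using mat_adjoint_carrier [OF A] mat_adjoint_carrier [OF B] mat_adjoint_carrier [OF AB] by simp_all
  fix i j assume "i < dim_row (mat_adjoint B * mat_adjoint A)" "j < dim_col (mat_adjoint B * mat_adjoint A)"
  then have ij: "i < m" "j < m" using car by auto
  have "mat_adjoint (A * B) $$ (i, j) = (\<Sum>l<m. cnj (A $$ (j, l) * B $$ (l, i)))"
    by (simp add: mat_adjoint_index [OF AB ij] mult_mat_index_sum [OF A B ij(2) ij(1)])
  also have "\<dots> = (mat_adjoint B * mat_adjoint A) $$ (i, j)"
    unfolding mult_mat_index_sum [OF mat_adjoint_carrier [OF B] mat_adjoint_carrier [OF A] ij]
    by (rule sum.cong) (auto simp: mat_adjoint_index [OF A] mat_adjoint_index [OF B] ij)
  finally show "mat_adjoint (A * B) $$ (i, j) = (mat_adjoint B * mat_adjoint A) $$ (i, j)" .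
qed (use A B mat_adjoint_carrier [OF A] mat_adjoint_carrier [OF B] mat_adjoint_carrier [of "A * B" m] in auto)

lemma mat_adjoint_diff:
  fixes A :: "complex mat"
  assumes A: "A \<in> carrier_mat m m" and B: "B \<in> carrier_mat m m"
  shows "mat_adjoint (A - B) = mat_adjoint A - mat_adjoint B"
proof (rule eq_matI)
  have AB: "A - B \<in> carrier_mat m m" using A B by (simp add: minus_carrier_mat)
  note c = mat_adjoint_carrier [OF A] mat_adjoint_carrier [OF B] mat_adjoint_carrier [OF AB]
  show "dim_row (mat_adjoint (A - B)) = dim_row (mat_adjoint A - mat_adjoint B)"
    "dim_col (mat_adjoint (A - B)) = dim_col (mat_adjoint A - mat_adjoint B)"
    using c by auto
  fix i j assume "i < dim_row (mat_adjoint A - mat_adjoint B)" "j < dim_col (mat_adjoint A - mat_adjoint B)"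
  then have "i < m" "j < m" using c by auto
  then show "mat_adjoint (A - B) $$ (i, j) = (mat_adjoint A - mat_adjoint B) $$ (i, j)"
    using A B carrier_matD [OF c(1)] carrier_matD [OF c(2)]
    by (simp add: mat_adjoint_index [OF AB] mat_adjoint_index [OF A] mat_adjoint_index [OF B])
qed

section \<open>Operator norm bounds\<close>

definition op_bounded_by :: "nat \<Rightarrow> real \<Rightarrow> complex mat \<Rightarrow> bool" where
  "op_bounded_by m C A \<longleftrightarrow> (\<forall>v\<in>carrier_vec m. l2_norm_vec (A *\<^sub>v v) \<le> C * l2_norm_vec v)"

lemma l2_norm_vec_nonneg [simp]: "0 \<le> l2_norm_vec v"
  by (simp add: l2_norm_vec_def)

lemma l2_norm_vec_power2:
  "v \<in> carrier_vec m \<Longrightarrow> (l2_norm_vec v)\<^sup>2 = (\<Sum>i<m. (cmod (vec_index v i))\<^sup>2)"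
  by (simp add: l2_norm_vec_def L2_set_def sum_nonneg)

lemma adjoint_inner:
  assumes A: "A \<in> carrier_mat m m" and v: "v \<in> carrier_vec m" and w: "w \<in> carrier_vec m"
  shows "(\<Sum>i<m. cnj (vec_index (A *\<^sub>v w) i) * vec_index v i) =
    (\<Sum>j<m. cnj (vec_index w j) * vec_index (mat_adjoint A *\<^sub>v v) j)"
proof -
  have "(\<Sum>i<m. cnj (vec_index (A *\<^sub>v w) i) * vec_index v i) =
      (\<Sum>i<m. \<Sum>j<m. cnj (A $$ (i, j)) * cnj (vec_index w j) * vec_index v i)"
    by (rule sum.cong) (auto simp: mult_mat_vec_index_sum [OF A w] sum_distrib_right simp del: index_mult_mat_vec)
  also have "\<dots> = (\<Sum>j<m. \<Sum>i<m. cnj (A $$ (i, j)) * cnj (vec_index w j) * vec_index v i)"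
    by (rule sum.swap)
  also have "\<dots> = (\<Sum>j<m. cnj (vec_index w j) * vec_index (mat_adjoint A *\<^sub>v v) j)"
    by (rule sum.cong)
      (auto simp: mult_mat_vec_index_sum [OF mat_adjoint_carrier [OF A] v] mat_adjoint_index [OF A]
        sum_distrib_left algebra_simps simp del: index_mult_mat_vec)
  finally show ?thesis .
qed

lemma sum_cnj_self: "(\<Sum>j<m. cnj (f j) * f j) = complex_of_real (\<Sum>j<m. (cmod (f j))\<^sup>2)"
  unfolding of_real_sum complex_norm_square by (simp only: mult.commute)

text \<open>With w the image of v under the adjoint, the squared norm of w is the inner product of A
  w and v, hence at most C times the norms of w and v by Cauchy-Schwarz; then one norm of w is
  cancelled.\<close>

lemma op_bounded_by_adjoint:
  assumes A: "A \<in> carrier_mat m m" and C: "op_bounded_by m C A"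
  shows "op_bounded_by m C (mat_adjoint A)"
  unfolding op_bounded_by_def
proof
  fix v :: "complex vec" assume v: "v \<in> carrier_vec m"
  define w where "w = mat_adjoint A *\<^sub>v v"
  have w: "w \<in> carrier_vec m"
    using mat_adjoint_carrier [OF A] v by (simp add: w_def)
  have Aw: "A *\<^sub>v w \<in> carrier_vec m" using A w by simp
  have le: "l2_norm_vec (A *\<^sub>v w) \<le> C * l2_norm_vec w"
    using C w by (simp add: op_bounded_by_def)
  have "complex_of_real ((l2_norm_vec w)\<^sup>2) = (\<Sum>i<m. cnj (vec_index (A *\<^sub>v w) i) * vec_index v i)"
    unfolding adjoint_inner [OF A v w] w_def [symmetric] sum_cnj_self l2_norm_vec_power2 [OF w] ..
  then have "(l2_norm_vec w)\<^sup>2 = cmod (\<Sum>i<m. cnj (vec_index (A *\<^sub>v w) i) * vec_index v i)"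
    by (metis norm_of_real abs_of_nonneg zero_le_power2)
  also have "\<dots> \<le> (\<Sum>i<m. \<bar>cmod (vec_index (A *\<^sub>v w) i)\<bar> * \<bar>cmod (vec_index v i)\<bar>)"
    by (rule order_trans [OF norm_sum]) (simp add: norm_mult del: index_mult_mat_vec)
  also have "\<dots> \<le> l2_norm_vec (A *\<^sub>v w) * l2_norm_vec v"
    using L2_set_mult_ineq [of "\<lambda>i. cmod (vec_index (A *\<^sub>v w) i)" "\<lambda>i. cmod (vec_index v i)" "{..<m}"] A v
    by (simp add: l2_norm_vec_def del: index_mult_mat_vec)
  also have "\<dots> \<le> (C * l2_norm_vec w) * l2_norm_vec v"
    by (rule mult_right_mono [OF le]) simp
  finally have *: "l2_norm_vec w * l2_norm_vec w \<le> l2_norm_vec w * (C * l2_norm_vec v)"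
    by (simp add: power2_eq_square algebra_simps)
  show "l2_norm_vec (mat_adjoint A *\<^sub>v v) \<le> C * l2_norm_vec v"
  \<comment> \<open>Cancelling needs a nonzero norm. Otherwise the claim is that C times the norm of
    v is nonnegative, which follows from the bound for A at v itself.\<close>
  proof (cases "l2_norm_vec w = 0")
    case True
    have "0 \<le> C * l2_norm_vec v"
      using order_trans [OF l2_norm_vec_nonneg] C v by (auto simp: op_bounded_by_def)
    with True show ?thesis by (simp add: w_def)
  next
    case False
    then have "l2_norm_vec w > 0"
      using l2_norm_vec_nonneg [of w] by linarith
    with * show ?thesis
      unfolding w_def by (simp add: mult_le_cancel_left_pos)
  qed
qed

lemma op_bounded_by_isometry:
  assumes A: "A \<in> carrier_mat m m" and iso: "mat_adjoint A * A = 1\<^sub>m m"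
  shows "op_bounded_by m 1 A"
  unfolding op_bounded_by_def
proof
  fix v :: "complex vec" assume v: "v \<in> carrier_vec m"
  have Av: "A *\<^sub>v v \<in> carrier_vec m" using A v by simp
  have "mat_adjoint A *\<^sub>v (A *\<^sub>v v) = v"
    using assoc_mult_mat_vec [OF mat_adjoint_carrier [OF A] A v] iso v by simp
  then have "complex_of_real ((l2_norm_vec (A *\<^sub>v v))\<^sup>2) = complex_of_real ((l2_norm_vec v)\<^sup>2)"
    using adjoint_inner [OF A Av v] unfolding sum_cnj_self l2_norm_vec_power2 [OF Av] l2_norm_vec_power2 [OF v]
    by (simp only: sum_cnj_self)
  then have "(l2_norm_vec (A *\<^sub>v v))\<^sup>2 = (l2_norm_vec v)\<^sup>2"
    by (simp only: of_real_eq_iff)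
  then show "l2_norm_vec (A *\<^sub>v v) \<le> 1 * l2_norm_vec v"
    by (simp add: power2_eq_iff_nonneg)
qed

lemma l2_norm_vec_add:
  assumes "v \<in> carrier_vec m" "w \<in> carrier_vec m"
  shows "l2_norm_vec (v + w) \<le> l2_norm_vec v + l2_norm_vec w"
proof -
  have "l2_norm_vec (v + w) \<le> L2_set (\<lambda>i. cmod (vec_index v i) + cmod (vec_index w i)) {..<m}"
    using assms unfolding l2_norm_vec_def by (auto intro!: L2_set_mono norm_triangle_ineq)
  also have "\<dots> \<le> l2_norm_vec v + l2_norm_vec w"
    using L2_set_triangle_ineq [of "\<lambda>i. cmod (vec_index v i)" "\<lambda>i. cmod (vec_index w i)" "{..<m}"] assms
    by (simp add: l2_norm_vec_def)
  finally show ?thesis .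
qed

lemma op_bounded_by_add:
  assumes "A \<in> carrier_mat m m" "B \<in> carrier_mat m m" "op_bounded_by m C A" "op_bounded_by m D B"
  shows "op_bounded_by m (C + D) (A + B)"
  unfolding op_bounded_by_def
proof
  fix v :: "complex vec" assume v: "v \<in> carrier_vec m"
  have "l2_norm_vec ((A + B) *\<^sub>v v) \<le> l2_norm_vec (A *\<^sub>v v) + l2_norm_vec (B *\<^sub>v v)"
    unfolding add_mult_distrib_mat_vec [OF assms(1,2) v] by (rule l2_norm_vec_add [of _ m]) (use assms v in auto)
  also have "\<dots> \<le> C * l2_norm_vec v + D * l2_norm_vec v"
    using assms(3,4) v by (intro add_mono) (auto simp: op_bounded_by_def)
  finally show "l2_norm_vec ((A + B) *\<^sub>v v) \<le> (C + D) * l2_norm_vec v"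
    by (simp add: algebra_simps)
qed

lemma op_bounded_by_mult:
  assumes "A \<in> carrier_mat m m" "B \<in> carrier_mat m m" "op_bounded_by m C A" "op_bounded_by m D B" "C \<ge> 0"
  shows "op_bounded_by m (C * D) (A * B)"
  unfolding op_bounded_by_def
proof
  fix v :: "complex vec" assume v: "v \<in> carrier_vec m"
  have "l2_norm_vec ((A * B) *\<^sub>v v) \<le> C * l2_norm_vec (B *\<^sub>v v)"
    unfolding assoc_mult_mat_vec [OF assms(1,2) v] using assms(2,3) v by (auto simp: op_bounded_by_def)
  also have "\<dots> \<le> C * (D * l2_norm_vec v)"
    using assms(4,5) v by (intro mult_left_mono) (auto simp: op_bounded_by_def)
  finally show "l2_norm_vec ((A * B) *\<^sub>v v) \<le> C * D * l2_norm_vec v"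
    by (simp add: mult.assoc)
qed

lemma op_bounded_by_uminus:
  assumes "A \<in> carrier_mat m m" "op_bounded_by m C A"
  shows "op_bounded_by m C (- A)"
  unfolding op_bounded_by_def
proof
  fix v :: "complex vec" assume v: "v \<in> carrier_vec m"
  have "l2_norm_vec ((- A) *\<^sub>v v) = l2_norm_vec (A *\<^sub>v v)"
    unfolding l2_norm_vec_def using assms(1) v
    by (auto intro!: L2_set_cong simp: uminus_mult_mat_vec)
  then show "l2_norm_vec ((- A) *\<^sub>v v) \<le> C * l2_norm_vec v"
    using assms(2) v by (simp add: op_bounded_by_def)
qed

lemma op_bounded_by_diag:
  assumes "\<And>i. i \<in> {1..m} \<Longrightarrow> cmod (d i) \<le> C"
  shows "op_bounded_by m C (diag_mat_of m d)"
  unfolding op_bounded_by_def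
proof
  fix v :: "complex vec" assume v: "v \<in> carrier_vec m"
  have car: "diag_mat_of m d \<in> carrier_mat m m" by (simp add: diag_mat_of_def)
  have ent: "vec_index (diag_mat_of m d *\<^sub>v v) i = d (Suc i) * vec_index v i" if "i < m" for i
    unfolding mult_mat_vec_index_sum [OF car v that] using that
    by (simp add: diag_mat_of_def if_distrib [of "\<lambda>x. x * _"] cong: if_cong)
  have "l2_norm_vec (diag_mat_of m d *\<^sub>v v) = L2_set (\<lambda>i. cmod (d (Suc i)) * cmod (vec_index v i)) {..<m}"
    unfolding l2_norm_vec_def using car by (auto intro!: L2_set_cong simp: ent norm_mult simp del: index_mult_mat_vec)
  also have "\<dots> \<le> L2_set (\<lambda>i. C * cmod (vec_index v i)) {..<m}"
    by (rule L2_set_mono) (auto intro!: mult_right_mono assms)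
  also have "\<dots> = C * l2_norm_vec v"
  \<comment> \<open>With no indices the assumption says nothing about the sign of C, but then all
    norms vanish.\<close>
  proof (cases "m = 0")
    case True then show ?thesis using v by (simp add: l2_norm_vec_def)
  next
    case False
    then have "C \<ge> 0"
      using assms [of 1] norm_ge_zero [of "d 1"] by (simp add: order_trans del: norm_ge_zero)
    then show ?thesis using v by (simp add: l2_norm_vec_def L2_set_right_distrib)
  qed
  finally show "l2_norm_vec (diag_mat_of m d *\<^sub>v v) \<le> C * l2_norm_vec v" .
qed

section \<open>The Hilbert-Schmidt norm\<close>

text \<open>The squared Hilbert-Schmidt norm. Divided by the dimension it is the normalised trace in
  \<open>trace_null\<close>, but as a real number, to which order arguments apply.\<close>

definition frobenius2 :: "complex mat \<Rightarrow> real" where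
  "frobenius2 A = (\<Sum>j<dim_col A. \<Sum>i<dim_row A. (cmod (A $$ (i, j)))\<^sup>2)"

lemma frobenius2_nonneg: "0 \<le> frobenius2 A"
  by (simp add: frobenius2_def sum_nonneg)

lemma frobenius2_adjoint:
  assumes A: "A \<in> carrier_mat m m"
  shows "frobenius2 (mat_adjoint A) = frobenius2 A"
  using A mat_adjoint_carrier [OF A] unfolding frobenius2_def
  by (subst sum.swap) (auto intro!: sum.cong simp: mat_adjoint_index [OF A])

lemma norm_trace_adjoint_mult:
  assumes A: "A \<in> carrier_mat m m"
  shows "norm_trace (mat_adjoint A * A) = complex_of_real (frobenius2 A / real m)"
proof -
  have "(\<Sum>i<m. (mat_adjoint A * A) $$ (i, i)) = (\<Sum>i<m. \<Sum>l<m. cnj (A $$ (l, i)) * A $$ (l, i))"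
    by (intro sum.cong refl) (auto simp: mult_mat_index_sum [OF mat_adjoint_carrier [OF A] A] mat_adjoint_index [OF A])
  also have "\<dots> = complex_of_real (frobenius2 A)"
    using A by (simp add: frobenius2_def sum_cnj_self)
  finally show ?thesis
    using A by (simp add: norm_trace_def del: index_mult_mat(1))
qed

text \<open>A acts on each column of B separately and enlarges its norm by at most the factor C; the
  squares are then summed over the columns.\<close>

lemma frobenius2_mult_left:
  assumes A: "A \<in> carrier_mat m m" and B: "B \<in> carrier_mat m m" and C: "op_bounded_by m C A"
  shows "frobenius2 (A * B) \<le> C\<^sup>2 * frobenius2 B"
proof -
  have cols: "frobenius2 D = (\<Sum>j<m. (l2_norm_vec (col D j))\<^sup>2)" if "D \<in> carrier_mat m m" for D
    using that by (auto simp: frobenius2_def l2_norm_vec_power2 [of _ m] intro!: sum.cong)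
  have AB: "A * B \<in> carrier_mat m m" using A B by simp
  have "(l2_norm_vec (col (A * B) j))\<^sup>2 \<le> C\<^sup>2 * (l2_norm_vec (col B j))\<^sup>2" if "j < m" for j
  proof -
    have "l2_norm_vec (A *\<^sub>v col B j) \<le> C * l2_norm_vec (col B j)"
      using C B that by (auto simp: op_bounded_by_def)
    then have "(l2_norm_vec (A *\<^sub>v col B j))\<^sup>2 \<le> (C * l2_norm_vec (col B j))\<^sup>2"
      by (intro power_mono) auto
    then show ?thesis
      by (simp add: col_mult2 [OF A B that] power_mult_distrib)
  qed
  then show ?thesis
    unfolding cols [OF AB] cols [OF B] sum_distrib_left by (intro sum_mono) auto
qed

text \<open>The adjoint reverses products and keeps both the Hilbert-Schmidt norm and operator
  bounds, which reduces the right factor to the left one.\<close>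

lemma frobenius2_mult_right:
  assumes A: "A \<in> carrier_mat m m" and B: "B \<in> carrier_mat m m" and C: "op_bounded_by m C B"
  shows "frobenius2 (A * B) \<le> C\<^sup>2 * frobenius2 A"
proof -
  have AB: "A * B \<in> carrier_mat m m" using A B by simp
  have "frobenius2 (A * B) = frobenius2 (mat_adjoint B * mat_adjoint A)"
    by (simp only: frobenius2_adjoint [OF AB, symmetric] mat_adjoint_mult [OF A B])
  also have "\<dots> \<le> C\<^sup>2 * frobenius2 (mat_adjoint A)"
    by (rule frobenius2_mult_left [OF mat_adjoint_carrier [OF B] mat_adjoint_carrier [OF A] op_bounded_by_adjoint [OF B C]])
  finally show ?thesis
    by (simp only: frobenius2_adjoint [OF A])
qed

text \<open>The factors 2 replace the triangle inequality and its square roots; convergence to 0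
  does not see them.\<close>

lemma frobenius2_add:
  assumes A: "A \<in> carrier_mat m m" and B: "B \<in> carrier_mat m m"
  shows "frobenius2 (A + B) \<le> 2 * frobenius2 A + 2 * frobenius2 B"
proof -
  have sq: "(cmod (x + y))\<^sup>2 \<le> 2 * (cmod x)\<^sup>2 + 2 * (cmod y)\<^sup>2" for x y
  proof -
    have "(cmod (x + y))\<^sup>2 \<le> (cmod x + cmod y)\<^sup>2"
      by (intro power_mono norm_triangle_ineq) simp
    also have "\<dots> \<le> 2 * (cmod x)\<^sup>2 + 2 * (cmod y)\<^sup>2"
      using zero_le_power2 [of "cmod x - cmod y"] by (simp add: power2_eq_square algebra_simps)
    finally show ?thesis .
  qed
  have "frobenius2 (A + B) = (\<Sum>j<m. \<Sum>i<m. (cmod (A $$ (i, j) + B $$ (i, j)))\<^sup>2)"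
    using A B by (simp add: frobenius2_def)
  also have "\<dots> \<le> (\<Sum>j<m. \<Sum>i<m. 2 * (cmod (A $$ (i, j)))\<^sup>2 + 2 * (cmod (B $$ (i, j)))\<^sup>2)"
    by (intro sum_mono sq)
  also have "\<dots> = 2 * frobenius2 A + 2 * frobenius2 B"
    using A B by (simp add: frobenius2_def sum.distrib sum_distrib_left)
  finally show ?thesis .
qed

lemma frobenius2_uminus: "frobenius2 (- A) = frobenius2 A"
  by (auto simp: frobenius2_def intro!: sum.cong)

section \<open>Diagonal and permutation matrices\<close>

lemma frobenius2_diag: "frobenius2 (diag_mat_of m d) = (\<Sum>i=1..m. (cmod (d i))\<^sup>2)"
proof -
  have "frobenius2 (diag_mat_of m d) = (\<Sum>j<m. \<Sum>i<m. if i = j then (cmod (d (Suc i)))\<^sup>2 else 0)"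
  proof -
    have "(cmod (diag_mat_of m d $$ (i, j)))\<^sup>2 = (if i = j then (cmod (d (Suc i)))\<^sup>2 else 0)" if "i < m" "j < m" for i j
      using that by (simp add: diag_mat_of_def)
    moreover have "dim_row (diag_mat_of m d) = m" "dim_col (diag_mat_of m d) = m"
      by (simp_all add: diag_mat_of_def)
    ultimately show ?thesis
      unfolding frobenius2_def by (intro sum.cong) auto
  qed
  also have "\<dots> = (\<Sum>j<m. (cmod (d (Suc j)))\<^sup>2)"
    by simp
  also have "\<dots> = (\<Sum>i=1..m. (cmod (d i))\<^sup>2)"
    by (rule sum.reindex_bij_witness [of _ "\<lambda>i. i - 1" Suc]) auto
  finally show ?thesis .
qed

lemma diag_mat_of_diff: "diag_mat_of m d - diag_mat_of m e = diag_mat_of m (\<lambda>i. d i - e i)"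
  by (rule eq_matI) (auto simp: diag_mat_of_def)

lemma perm_mat_carrier [simp]: "perm_mat m q \<in> carrier_mat m m"
  by (simp add: perm_mat_def)

lemma diag_mat_of_carrier [simp]: "diag_mat_of m d \<in> carrier_mat m m"
  by (simp add: diag_mat_of_def)

lemma perm_mat_adjoint_mult:
  assumes q: "q permutes {1..m}"
  shows "mat_adjoint (perm_mat m q) * perm_mat m q = 1\<^sub>m m"
proof (rule eq_matI)
  let ?U = "perm_mat m q"
  note Ua = mat_adjoint_carrier [OF perm_mat_carrier [of m q]]
  fix i j assume "i < dim_row (1\<^sub>m m :: complex mat)" "j < dim_col (1\<^sub>m m :: complex mat)"
  then have ij: "i < m" "j < m" by auto
  \<comment> \<open>Column i of \<open>?U\<close> has its only entry 1 in row l, so only k = l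
    contributes to the sum.\<close>
  obtain l where l: "l < m" "q (Suc i) = Suc l"
    using permutes_in_image [OF q, of "Suc i"] ij(1) by (cases "q (Suc i)") auto
  have "(mat_adjoint ?U * ?U) $$ (i, j) = (\<Sum>k<m. if k = l then (if i = j then 1 else 0) else 0)"
    unfolding mult_mat_index_sum [OF Ua perm_mat_carrier ij]
  proof (rule sum.cong [OF refl])
    fix k assume "k \<in> {..<m}"
    then have k: "k < m" by simp
    have "mat_adjoint ?U $$ (i, k) = (if k = l then 1 else 0)"
      unfolding mat_adjoint_index [OF perm_mat_carrier ij(1) k] using ij k l by (simp add: perm_mat_def)
    moreover have "?U $$ (k, j) = (if Suc k = q (Suc j) then 1 else 0)"
      using ij k by (simp add: perm_mat_def)
    moreover have "Suc l = q (Suc j) \<longleftrightarrow> i = j"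
      using inj_eq [OF permutes_inj [OF q], of "Suc i" "Suc j"] l(2) by simp
    ultimately show "mat_adjoint ?U $$ (i, k) * ?U $$ (k, j) = (if k = l then (if i = j then 1 else 0) else 0)"
      by simp
  qed
  also have "\<dots> = 1\<^sub>m m $$ (i, j)"
    using l ij by simp
  finally show "(mat_adjoint ?U * ?U) $$ (i, j) = 1\<^sub>m m $$ (i, j)" .
qed (use carrier_matD [OF perm_mat_carrier [of m q]] in \<open>auto simp: diag_mat_of_def\<close>)

text \<open>The permutation matrix carries the basis vector at i to the one at q i, so the diagonal
  entry at i reappears at q i; hence the inverse on the right-hand side.\<close>

lemma perm_mat_conj_diag:
  assumes q: "q permutes {1..m}"
  shows "perm_mat m q * diag_mat_of m d * mat_adjoint (perm_mat m q) = diag_mat_of m (\<lambda>i. d (Hilbert_Choice.inv q i))"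
proof (rule eq_matI)
  let ?U = "perm_mat m q" and ?D = "diag_mat_of m d"
  note Ua = mat_adjoint_carrier [OF perm_mat_carrier [of m q]]
  have UD: "?U * ?D \<in> carrier_mat m m"
    by (rule mult_carrier_mat [OF perm_mat_carrier diag_mat_of_carrier])
  fix i j assume "i < dim_row (diag_mat_of m (\<lambda>i. d (Hilbert_Choice.inv q i)))" "j < dim_col (diag_mat_of m (\<lambda>i. d (Hilbert_Choice.inv q i)))"
  then have ij: "i < m" "j < m" by (auto simp: diag_mat_of_def)
  have "Hilbert_Choice.inv q (Suc i) \<in> {1..m}"
    using permutes_in_image [OF permutes_inv [OF q], of "Suc i"] ij(1) by simp
  \<comment> \<open>The zero-based number of the inverse image of row i; this row of
    \<open>?U\<close> has its only entry 1 in column l.\<close>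
  then obtain l where l: "l < m" "Hilbert_Choice.inv q (Suc i) = Suc l"
    by (cases "Hilbert_Choice.inv q (Suc i)") auto
  then have l': "q (Suc l) = Suc i"
    using permutes_inverses(1) [OF q, of "Suc i"] by simp
  have UDe: "(?U * ?D) $$ (i, k) = (if k = l then d (Suc l) else 0)" if k: "k < m" for k
  proof -
    have "(?U * ?D) $$ (i, k) = (\<Sum>r<m. if r = k then (if k = l then d (Suc l) else 0) else 0)"
      unfolding mult_mat_index_sum [OF perm_mat_carrier diag_mat_of_carrier ij(1) k]
    proof (rule sum.cong [OF refl])
      fix r assume "r \<in> {..<m}"
      moreover have "Suc i = q (Suc k) \<longleftrightarrow> k = l"
        using inj_eq [OF permutes_inj [OF q], of "Suc l" "Suc k"] l' by auto
      ultimately show "?U $$ (i, r) * ?D $$ (r, k) = (if r = k then (if k = l then d (Suc l) else 0) else 0)"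
        using ij k by (auto simp: perm_mat_def diag_mat_of_def)
    qed
    then show ?thesis using k by simp
  qed
  have "(?U * ?D * mat_adjoint ?U) $$ (i, j) = (\<Sum>k<m. if k = l then (if i = j then d (Suc l) else 0) else 0)"
    unfolding mult_mat_index_sum [OF UD Ua ij]
  proof (rule sum.cong [OF refl])
    fix k assume "k \<in> {..<m}"
    then have k: "k < m" by simp
    have "mat_adjoint ?U $$ (k, j) = (if Suc j = q (Suc k) then 1 else 0)"
      unfolding mat_adjoint_index [OF perm_mat_carrier k ij(2)] using ij k by (simp add: perm_mat_def)
    then show "(?U * ?D) $$ (i, k) * mat_adjoint ?U $$ (k, j) = (if k = l then (if i = j then d (Suc l) else 0) else 0)"
      using l' by (auto simp: UDe [OF k])
  qed
  also have "\<dots> = diag_mat_of m (\<lambda>i. d (Hilbert_Choice.inv q i)) $$ (i, j)"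
    using l ij by (auto simp: diag_mat_of_def)
  finally show "(?U * ?D * mat_adjoint ?U) $$ (i, j) = diag_mat_of m (\<lambda>i. d (Hilbert_Choice.inv q i)) $$ (i, j)" .
qed (use carrier_matD [OF perm_mat_carrier [of m q]] in \<open>auto simp: diag_mat_of_def\<close>)

text \<open>Conjugation of the identity matrix, seen as the constant diagonal 1, which no
  permutation changes.\<close>

lemma perm_mat_mult_adjoint:
  assumes q: "q permutes {1..m}"
  shows "perm_mat m q * mat_adjoint (perm_mat m q) = 1\<^sub>m m"
proof -
  have "diag_mat_of m (\<lambda>i. 1) = 1\<^sub>m m"
    by (rule eq_matI) (auto simp: diag_mat_of_def)
  then show ?thesis
    using perm_mat_conj_diag [OF q, of "\<lambda>i. 1"] right_mult_one_mat [OF perm_mat_carrier] by simp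
qed

section \<open>Bounded matrix sequences as a ring\<close>

text \<open>The common bound can be replaced by its maximum with 0; multiplying bounds requires a
  nonnegative one.\<close>

lemma op_bounded_seqs_iff:
  "a \<in> op_bounded_seqs n \<longleftrightarrow>
     (\<forall>k. a k \<in> carrier_mat (n k) (n k)) \<and> (\<exists>C\<ge>0. \<forall>k. op_bounded_by (n k) C (a k))"
proof -
  have "op_bounded_by m (max 0 C) A" if "op_bounded_by m C A" for m C A
    using that unfolding op_bounded_by_def
    by (meson l2_norm_vec_nonneg max.cobounded2 mult_right_mono order_trans)
  then have "(\<exists>C. \<forall>k. op_bounded_by (n k) C (a k)) \<longleftrightarrow> (\<exists>C\<ge>0. \<forall>k. op_bounded_by (n k) C (a k))"
    by (metis max.cobounded1)
  then show ?thesis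
    by (simp add: op_bounded_seqs_def op_bounded_by_def)
qed

lemma op_bounded_seqs_carrier: "a \<in> op_bounded_seqs n \<Longrightarrow> a k \<in> carrier_mat (n k) (n k)"
  by (simp add: op_bounded_seqs_iff)

lemma op_bounded_seqsE:
  assumes "a \<in> op_bounded_seqs n"
  obtains C where "C \<ge> 0" "\<And>k. op_bounded_by (n k) C (a k)"
  using assms by (auto simp: op_bounded_seqs_iff)

lemma op_bounded_seqsI:
  assumes "\<And>k. a k \<in> carrier_mat (n k) (n k)" "C \<ge> 0" "\<And>k. op_bounded_by (n k) C (a k)"
  shows "a \<in> op_bounded_seqs n"
  using assms by (auto simp: op_bounded_seqs_iff)

lemma op_bounded_seqs_add:
  assumes "a \<in> op_bounded_seqs n" "b \<in> op_bounded_seqs n"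
  shows "(\<lambda>k. a k + b k) \<in> op_bounded_seqs n"
proof -
  obtain C D where "C \<ge> 0" "\<And>k. op_bounded_by (n k) C (a k)" "D \<ge> 0" "\<And>k. op_bounded_by (n k) D (b k)"
    using assms by (auto elim!: op_bounded_seqsE)
  then show ?thesis
    using assms by (intro op_bounded_seqsI [of _ _ "C + D"])
      (auto intro!: op_bounded_by_add add_carrier_mat intro: op_bounded_seqs_carrier)
qed

lemma op_bounded_seqs_mult:
  assumes "a \<in> op_bounded_seqs n" "b \<in> op_bounded_seqs n"
  shows "(\<lambda>k. a k * b k) \<in> op_bounded_seqs n"
proof -
  obtain C D where "C \<ge> 0" "\<And>k. op_bounded_by (n k) C (a k)" "D \<ge> 0" "\<And>k. op_bounded_by (n k) D (b k)"
    using assms by (auto elim!: op_bounded_seqsE)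
  then show ?thesis
    using assms by (intro op_bounded_seqsI [of _ _ "C * D"])
      (auto intro!: op_bounded_by_mult mult_carrier_mat intro: op_bounded_seqs_carrier)
qed

lemma op_bounded_seqs_uminus:
  assumes "a \<in> op_bounded_seqs n"
  shows "(\<lambda>k. - a k) \<in> op_bounded_seqs n"
proof -
  obtain C where "C \<ge> 0" "\<And>k. op_bounded_by (n k) C (a k)"
    using assms by (auto elim!: op_bounded_seqsE)
  then show ?thesis
    using assms op_bounded_seqs_carrier [OF assms]
    by (intro op_bounded_seqsI [of _ _ C]) (auto intro: op_bounded_by_uminus)
qed

lemma op_bounded_seqs_adjoint:
  assumes "a \<in> op_bounded_seqs n"
  shows "(\<lambda>k. mat_adjoint (a k)) \<in> op_bounded_seqs n"
proof -
  obtain C where "C \<ge> 0" "\<And>k. op_bounded_by (n k) C (a k)"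
    using assms by (auto elim!: op_bounded_seqsE)
  then show ?thesis
    using assms op_bounded_seqs_carrier [OF assms]
    by (intro op_bounded_seqsI [of _ _ C]) (auto intro: op_bounded_by_adjoint)
qed

lemma op_bounded_seqs_diag:
  assumes "\<And>k i. i \<in> {1..n k} \<Longrightarrow> cmod (d k i) \<le> C"
  shows "(\<lambda>k. diag_mat_of (n k) (d k)) \<in> op_bounded_seqs n"
proof (rule op_bounded_seqsI [of _ _ "max 0 C"])
  show "op_bounded_by (n k) (max 0 C) (diag_mat_of (n k) (d k))" for k
    by (rule op_bounded_by_diag) (use assms in \<open>force simp: le_max_iff_disj\<close>)
qed auto

lemma op_bounded_seqs_zero: "(\<lambda>k. 0\<^sub>m (n k) (n k)) \<in> op_bounded_seqs n"
proof -
  have "0\<^sub>m m m = diag_mat_of m (\<lambda>i. 0)" for m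
    by (rule eq_matI) (auto simp: diag_mat_of_def)
  then show ?thesis
    using op_bounded_seqs_diag [of n "\<lambda>k i. 0" 0] by simp
qed

lemma one_mat_eq_diag: "1\<^sub>m m = diag_mat_of m (\<lambda>i. 1)"
  by (rule eq_matI) (auto simp: diag_mat_of_def)

lemma op_bounded_seqs_one: "(\<lambda>k. 1\<^sub>m (n k)) \<in> op_bounded_seqs n"
  unfolding one_mat_eq_diag by (rule op_bounded_seqs_diag [of _ _ 1]) simp

lemma op_bounded_seqs_perm:
  assumes "\<And>k. q k permutes {1..n k}"
  shows "(\<lambda>k. perm_mat (n k) (q k)) \<in> op_bounded_seqs n"
  by (rule op_bounded_seqsI [of _ _ 1])
    (simp_all add: op_bounded_by_isometry [OF perm_mat_carrier perm_mat_adjoint_mult [OF assms]])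

lemma mat_seq_ring_simps [simp]:
  "carrier (mat_seq_ring n) = op_bounded_seqs n"
  "a \<otimes>\<^bsub>mat_seq_ring n\<^esub> b = (\<lambda>k. a k * b k)"
  "\<one>\<^bsub>mat_seq_ring n\<^esub> = (\<lambda>k. 1\<^sub>m (n k))"
  "\<zero>\<^bsub>mat_seq_ring n\<^esub> = (\<lambda>k. 0\<^sub>m (n k) (n k))"
  "a \<oplus>\<^bsub>mat_seq_ring n\<^esub> b = (\<lambda>k. a k + b k)"
  by (simp_all add: mat_seq_ring_def)

lemma ring_mat_seq_ring: "ring (mat_seq_ring n)"
proof (rule ringI)
  note car = op_bounded_seqs_carrier
  show "abelian_group (mat_seq_ring n)"
  proof (rule abelian_groupI)
    show "\<exists>y\<in>carrier (mat_seq_ring n). y \<oplus>\<^bsub>mat_seq_ring n\<^esub> x = \<zero>\<^bsub>mat_seq_ring n\<^esub>"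
      if "x \<in> carrier (mat_seq_ring n)" for x
    proof (rule bexI [of _ "\<lambda>k. - x k"])
      have "- x k + x k = 0\<^sub>m (n k) (n k)" for k
        using car [of x n k] that by (intro eq_matI) auto
      then show "(\<lambda>k. - x k) \<oplus>\<^bsub>mat_seq_ring n\<^esub> x = \<zero>\<^bsub>mat_seq_ring n\<^esub>"
        by simp
    qed (use that op_bounded_seqs_uminus in simp)
  qed (auto intro!: op_bounded_seqs_add op_bounded_seqs_zero assoc_add_mat comm_add_mat car ext
      simp: left_add_zero_mat [OF car])
  show "monoid (mat_seq_ring n)"
    by (rule monoidI) (auto intro!: op_bounded_seqs_mult op_bounded_seqs_one assoc_mult_mat car ext
      simp: left_mult_one_mat [OF car] right_mult_one_mat [OF car])
qed (auto intro!: ext add_mult_distrib_mat mult_add_distrib_mat op_bounded_seqs_carrier)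

lemma a_inv_mat_seq_ring:
  assumes "a \<in> op_bounded_seqs n"
  shows "\<ominus>\<^bsub>mat_seq_ring n\<^esub> a = (\<lambda>k. - a k)"
proof -
  interpret ring "mat_seq_ring n" by (rule ring_mat_seq_ring)
  have "- a k + a k = 0\<^sub>m (n k) (n k)" for k
    using op_bounded_seqs_carrier [OF assms, of k] by (intro eq_matI) auto
  then show ?thesis
    using assms op_bounded_seqs_uminus [OF assms] by (intro minus_equality) auto
qed

section \<open>The trace ideal and its cosets\<close>

lemma trace_null_iff:
  "a \<in> trace_null \<omega> n \<longleftrightarrow>
     a \<in> op_bounded_seqs n \<and> ((\<lambda>k. frobenius2 (a k) / real (n k)) \<longlongrightarrow> 0) \<omega>"
proof -
  have "((\<lambda>k. norm_trace (mat_adjoint (a k) * a k)) \<longlongrightarrow> 0) \<omega> \<longleftrightarrow> ((\<lambda>k. frobenius2 (a k) / real (n k)) \<longlongrightarrow> 0) \<omega>"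
    if "a \<in> op_bounded_seqs n"
    unfolding norm_trace_adjoint_mult [OF op_bounded_seqs_carrier [OF that]]
    using tendsto_of_real_iff [of "\<lambda>k. frobenius2 (a k) / real (n k)" 0 \<omega>, where 'a = complex] by simp
  then show ?thesis
    unfolding trace_null_def by blast
qed

lemma trace_null_dominated:
  assumes "a \<in> op_bounded_seqs n" "((\<lambda>k. u k / real (n k)) \<longlongrightarrow> 0) \<omega>"
    and "\<And>k. frobenius2 (a k) \<le> u k"
  shows "a \<in> trace_null \<omega> n"
  unfolding trace_null_iff
  by (intro conjI assms(1) tendsto_sandwich [OF _ _ tendsto_const assms(2)] always_eventually allI)
    (auto intro!: divide_right_mono divide_nonneg_nonneg frobenius2_nonneg assms(3))

text \<open>Sums are controlled by \<open>frobenius2_add\<close>. A factor from a bounded sequence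
  enlarges the squared norm by at most C squared, with one C for all k, so the limit stays 0 on
  either side.\<close>

lemma ideal_trace_null: "ideal (trace_null \<omega> n) (mat_seq_ring n)"
proof (rule idealI [OF ring_mat_seq_ring])
  interpret ring "mat_seq_ring n" by (rule ring_mat_seq_ring)
  have bounded: "a \<in> op_bounded_seqs n" and lim: "((\<lambda>k. frobenius2 (a k) / real (n k)) \<longlongrightarrow> 0) \<omega>"
    if "a \<in> trace_null \<omega> n" for a
    using that by (simp_all add: trace_null_iff)
  show "subgroup (trace_null \<omega> n) (add_monoid (mat_seq_ring n))"
  proof (rule add.subgroupI)
    have "(\<lambda>k. 0\<^sub>m (n k) (n k)) \<in> trace_null \<omega> n"
      by (simp add: trace_null_iff op_bounded_seqs_zero frobenius2_def)
    then show "trace_null \<omega> n \<noteq> {}" by blast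
    show "\<ominus>\<^bsub>mat_seq_ring n\<^esub> a \<in> trace_null \<omega> n" if "a \<in> trace_null \<omega> n" for a
      using bounded [OF that] lim [OF that]
      by (simp add: a_inv_mat_seq_ring trace_null_iff frobenius2_uminus op_bounded_seqs_uminus)
    show "a \<oplus>\<^bsub>mat_seq_ring n\<^esub> b \<in> trace_null \<omega> n" if "a \<in> trace_null \<omega> n" "b \<in> trace_null \<omega> n" for a b
      unfolding mat_seq_ring_simps
    proof (rule trace_null_dominated)
      have "((\<lambda>k. 2 * (frobenius2 (a k) / real (n k)) + 2 * (frobenius2 (b k) / real (n k))) \<longlongrightarrow> 2 * 0 + 2 * 0) \<omega>"
        by (intro tendsto_add tendsto_mult tendsto_const lim that)
      then show "((\<lambda>k. (2 * frobenius2 (a k) + 2 * frobenius2 (b k)) / real (n k)) \<longlongrightarrow> 0) \<omega>"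
        by (simp add: add_divide_distrib)
      show "frobenius2 (a k + b k) \<le> 2 * frobenius2 (a k) + 2 * frobenius2 (b k)" for k
        by (rule frobenius2_add [OF op_bounded_seqs_carrier [OF bounded [OF that(1)]] op_bounded_seqs_carrier [OF bounded [OF that(2)]]])
    qed (intro op_bounded_seqs_add bounded that)
  qed (auto dest: bounded)
  fix a x assume a: "a \<in> trace_null \<omega> n" and x: "x \<in> carrier (mat_seq_ring n)"
  then have xb: "x \<in> op_bounded_seqs n" by simp
  obtain C where C: "\<And>k. op_bounded_by (n k) C (x k)"
    using op_bounded_seqsE [OF xb] by blast
  note car = op_bounded_seqs_carrier [OF bounded [OF a]] op_bounded_seqs_carrier [OF xb]
  have "((\<lambda>k. C\<^sup>2 * (frobenius2 (a k) / real (n k))) \<longlongrightarrow> C\<^sup>2 * 0) \<omega>"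
    by (intro tendsto_mult tendsto_const lim a)
  then have dom: "((\<lambda>k. (C\<^sup>2 * frobenius2 (a k)) / real (n k)) \<longlongrightarrow> 0) \<omega>"
    by simp
  show "x \<otimes>\<^bsub>mat_seq_ring n\<^esub> a \<in> trace_null \<omega> n"
    unfolding mat_seq_ring_simps
    by (rule trace_null_dominated [OF op_bounded_seqs_mult [OF xb bounded [OF a]] dom])
      (rule frobenius2_mult_left [OF car(2) car(1) C])
  show "a \<otimes>\<^bsub>mat_seq_ring n\<^esub> x \<in> trace_null \<omega> n"
    unfolding mat_seq_ring_simps
    by (rule trace_null_dominated [OF op_bounded_seqs_mult [OF bounded [OF a] xb] dom])
      (rule frobenius2_mult_right [OF car(1) car(2) C])
qed

lemma mat_class_eq_iff:
  assumes a: "a \<in> op_bounded_seqs n" and b: "b \<in> op_bounded_seqs n"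
  shows "mat_class \<omega> n a = mat_class \<omega> n b \<longleftrightarrow> ((\<lambda>k. frobenius2 (a k - b k) / real (n k)) \<longlongrightarrow> 0) \<omega>"
proof -
  interpret ring "mat_seq_ring n" by (rule ring_mat_seq_ring)
  have "a \<ominus>\<^bsub>mat_seq_ring n\<^esub> b = (\<lambda>k. a k - b k)"
    unfolding a_minus_def a_inv_mat_seq_ring [OF b] mat_seq_ring_simps
    by (rule ext) (rule add_uminus_minus_mat [OF op_bounded_seqs_carrier [OF a] op_bounded_seqs_carrier [OF b]])
  moreover from this have "(\<lambda>k. a k - b k) \<in> op_bounded_seqs n"
    using minus_closed [of a b] a b by simp
  ultimately show ?thesis
    using quotient_eq_iff_same_a_r_cos [OF ideal_trace_null, of a b \<omega>] a b
    by (simp add: mat_class_def trace_null_iff)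
qed

lemma mat_class_self:
  assumes "a \<in> op_bounded_seqs n"
  shows "a \<in> mat_class \<omega> n a"
proof -
  interpret ideal "trace_null \<omega> n" "mat_seq_ring n" by (rule ideal_trace_null)
  show ?thesis
    unfolding mat_class_def using a_rcos_self assms by simp
qed

lemma mat_class_mem:
  assumes a: "a \<in> op_bounded_seqs n" and b: "b \<in> mat_class \<omega> n a"
  shows "b \<in> op_bounded_seqs n" "mat_class \<omega> n b = mat_class \<omega> n a"
proof -
  interpret ideal "trace_null \<omega> n" "mat_seq_ring n" by (rule ideal_trace_null)
  show "mat_class \<omega> n b = mat_class \<omega> n a"
    using a_repr_independence' [of b a] a b unfolding mat_class_def by simp
  show "b \<in> op_bounded_seqs n"
    using a b a_elemrcos_carrier unfolding mat_class_def by auto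
qed

text \<open>The adjoint preserves the Hilbert-Schmidt norm of differences, so the union over all
  representatives is a union of equal classes over a nonempty family.\<close>

lemma ultra_adjoint_class:
  assumes a: "a \<in> op_bounded_seqs n"
  shows "ultra_adjoint \<omega> n (mat_class \<omega> n a) = mat_class \<omega> n (\<lambda>k. mat_adjoint (a k))"
proof -
  have "mat_class \<omega> n (\<lambda>k. mat_adjoint (b k)) = mat_class \<omega> n (\<lambda>k. mat_adjoint (a k))"
    if b: "b \<in> mat_class \<omega> n a" for b
  proof -
    note bb = mat_class_mem [OF a b]
    have "frobenius2 (mat_adjoint (b k) - mat_adjoint (a k)) = frobenius2 (b k - a k)" for k
    proof -
      note car = op_bounded_seqs_carrier [OF bb(1), of k] op_bounded_seqs_carrier [OF a, of k]
      have "b k - a k \<in> carrier_mat (n k) (n k)"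
        by (rule minus_carrier_mat [OF car(2)])
      then show ?thesis
        by (simp only: mat_adjoint_diff [OF car, symmetric] frobenius2_adjoint)
    qed
    then show ?thesis
      using bb mat_class_eq_iff [OF bb(1) a, of \<omega>]
      by (simp add: mat_class_eq_iff op_bounded_seqs_adjoint a)
  qed
  then show ?thesis
    unfolding ultra_adjoint_def using mat_class_self [OF a, of \<omega>] by blast
qed

lemma mat_class_mult:
  assumes "a \<in> op_bounded_seqs n" "b \<in> op_bounded_seqs n"
  shows "mat_class \<omega> n a \<otimes>\<^bsub>matrix_ultraproduct \<omega> n\<^esub> mat_class \<omega> n b = mat_class \<omega> n (\<lambda>k. a k * b k)"
  using ideal.rcoset_mult_add [OF ideal_trace_null, of a n b \<omega>] assms
  by (simp add: matrix_ultraproduct_def FactRing_def mat_class_def)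

lemma one_matrix_ultraproduct:
  "\<one>\<^bsub>matrix_ultraproduct \<omega> n\<^esub> = mat_class \<omega> n (\<lambda>k. 1\<^sub>m (n k))"
  by (simp add: matrix_ultraproduct_def FactRing_def mat_class_def)

lemma mat_class_in_carrier:
  assumes "a \<in> op_bounded_seqs n"
  shows "mat_class \<omega> n a \<in> carrier (matrix_ultraproduct \<omega> n)"
proof -
  interpret ideal "trace_null \<omega> n" "mat_seq_ring n" by (rule ideal_trace_null)
  show ?thesis
    using a_rcosetsI [OF a_subset, of a] assms
    by (simp add: matrix_ultraproduct_def FactRing_def mat_class_def)
qed

section \<open>The Loeb space\<close>

text \<open>\<open>SOME\<close> is informative once the coset is seen to be nonempty: the identity
  sequence has Hamming length 0, so the coset of a contains a.\<close>

lemma sofic_rep_permutes: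
  assumes "p \<in> carrier (universal_sofic_group \<omega> n)"
  shows "sofic_rep p k permutes {1..n k}"
proof -
  let ?G = "perm_seq_group n" and ?H = "hamming_null \<omega> n"
  have G: "group ?G"
    unfolding perm_seq_group_def by (rule product_group) (rule sym_group_is_group)
  obtain a where a: "a \<in> carrier ?G" "p = ?H #>\<^bsub>?G\<^esub> a"
    using assms unfolding universal_sofic_group_def FactGroup_def RCOSETS_def by auto
  have "\<one>\<^bsub>?G\<^esub> \<in> ?H"
    using group.is_monoid [OF G, THEN monoid.one_closed]
    by (simp add: hamming_null_def perm_seq_group_def sym_group_def hamming_length_def)
  then have "\<one>\<^bsub>?G\<^esub> \<otimes>\<^bsub>?G\<^esub> a \<in> p"
    unfolding a(2) r_coset_def by blast
  then have "sofic_rep p \<in> p"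
    unfolding sofic_rep_def by (simp add: some_in_eq) blast
  moreover have "p \<subseteq> carrier ?G"
    unfolding a(2) r_coset_def using group.is_monoid [OF G] a(1)
    by (auto simp: hamming_null_def intro: monoid.m_closed)
  ultimately have "sofic_rep p \<in> carrier ?G" by blast
  then have "sofic_rep p k \<in> carrier (sym_group (n k))"
    unfolding perm_seq_group_def by auto
  then show ?thesis
    by (simp add: sym_group_carrier)
qed

definition bounded_diagonals :: "(nat \<Rightarrow> nat) \<Rightarrow> (nat \<Rightarrow> nat \<Rightarrow> complex) set" where
  "bounded_diagonals n = {d. \<exists>C. \<forall>k. \<forall>i\<in>{1..n k}. cmod (d k i) \<le> C}"

lemma bounded_diagonalsE:
  assumes "d \<in> bounded_diagonals n"
  obtains C where "\<forall>k. \<forall>i\<in>{1..n k}. cmod (d k i) \<le> C"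
  using assms unfolding bounded_diagonals_def by blast

lemma bounded_diagonals_permute:
  assumes "d \<in> bounded_diagonals n" "\<And>k. q k permutes {1..n k}"
  shows "(\<lambda>k i. d k (q k i)) \<in> bounded_diagonals n"
proof -
  obtain C where "\<forall>k. \<forall>i\<in>{1..n k}. cmod (d k i) \<le> C"
    using bounded_diagonalsE [OF assms(1)] .
  then have C: "\<And>k i. i \<in> {1..n k} \<Longrightarrow> cmod (d k i) \<le> C"
    by blast
  have "cmod (d k (q k i)) \<le> C" if "i \<in> {1..n k}" for k i
    by (rule C) (use permutes_in_image [OF assms(2)] that in blast)
  then show ?thesis
    unfolding bounded_diagonals_def by blast
qed

locale loeb_ultraproduct =
  fixes \<omega> :: "nat filter" and n :: "nat \<Rightarrow> nat"
  assumes ultra: "nonprincipal_ultrafilter \<omega>"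
    and n_mono: "strict_mono n"
    and n_pos: "n k > 0"
begin

section \<open>Limits along the ultrafilter\<close>

lemma omega_neq_bot [simp]: "\<omega> \<noteq> bot"
  using ultra by (simp add: nonprincipal_ultrafilter_def)

lemma not_eventually_iff: "\<not> eventually P \<omega> \<longleftrightarrow> eventually (\<lambda>k. \<not> P k) \<omega>"
proof
  assume "\<not> eventually P \<omega>"
  then show "eventually (\<lambda>k. \<not> P k) \<omega>"
    using ultra unfolding nonprincipal_ultrafilter_def by blast
next
  assume *: "eventually (\<lambda>k. \<not> P k) \<omega>"
  show "\<not> eventually P \<omega>"
  proof
    assume "eventually P \<omega>"
    with * have "eventually (\<lambda>k. False) \<omega>"
      by eventually_elim simp
    then show False by simp
  qed
qed

lemma eventually_disj_iff:
  "eventually (\<lambda>k. P k \<or> Q k) \<omega> \<longleftrightarrow> eventually P \<omega> \<or> eventually Q \<omega>"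
proof -
  have "\<not> eventually (\<lambda>k. P k \<or> Q k) \<omega> \<longleftrightarrow> \<not> eventually P \<omega> \<and> \<not> eventually Q \<omega>"
    unfolding not_eventually_iff eventually_conj_iff [symmetric] by simp
  then show ?thesis by blast
qed

lemma eventually_omega_ge: "eventually (\<lambda>k. k \<ge> m) \<omega>"
proof (induction m)
  case (Suc m)
  moreover have "eventually (\<lambda>k. k \<noteq> m) \<omega>"
    using ultra by (simp add: nonprincipal_ultrafilter_def)
  ultimately show ?case
    by eventually_elim simp
qed simp

lemma omega_le_sequentially: "\<omega> \<le> sequentially"
  unfolding le_filter_def eventually_sequentially
proof (intro allI impI)
  fix P :: "nat \<Rightarrow> bool"
  assume "\<exists>N. \<forall>k\<ge>N. P k"
  then obtain N where "\<And>k. k \<ge> N \<Longrightarrow> P k" by blast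
  with eventually_omega_ge [of N] show "eventually P \<omega>"
    by (rule eventually_mono)
qed

lemma n_at_top: "filterlim n at_top \<omega>"
  using filterlim_mono [OF filterlim_subseq [OF n_mono] order_refl omega_le_sequentially] .

lemma one_over_n_tendsto: "((\<lambda>k. 1 / real (n k)) \<longlongrightarrow> 0) \<omega>"
  using tendsto_compose_filtermap [of "\<lambda>m. 1 / real m" n 0 \<omega>] 
    filterlim_compose [OF lim_inverse_n' n_at_top] by simp

text \<open>A filter on a compact set has a cluster point. For an ultrafilter, a neighbourhood that
  is not eventually occupied is eventually avoided, so the cluster point is a limit.\<close>

lemma tendsto_Lim_omega_compact:
  fixes f :: "nat \<Rightarrow> 'a::t2_space"
  assumes "compact S" and "eventually (\<lambda>k. f k \<in> S) \<omega>"
  shows "(f \<longlongrightarrow> Lim \<omega> f) \<omega>" "Lim \<omega> f \<in> S"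
proof -
  have "eventually (\<lambda>x. x \<in> S) (filtermap f \<omega>)"
    using assms(2) by (simp add: eventually_filtermap)
  moreover have "filtermap f \<omega> \<noteq> bot"
    by (simp add: filtermap_bot_iff)
  ultimately obtain l where l: "l \<in> S" "inf (nhds l) (filtermap f \<omega>) \<noteq> bot"
    using assms(1) unfolding compact_filter by blast
  have "(f \<longlongrightarrow> l) \<omega>"
  proof (rule topological_tendstoI, rule ccontr)
    fix U assume U: "open U" "l \<in> U" "\<not> eventually (\<lambda>k. f k \<in> U) \<omega>"
    have "eventually (\<lambda>x. x \<in> U) (nhds l)"
      using U by (simp add: eventually_nhds_in_open)
    moreover have "eventually (\<lambda>x. x \<notin> U) (filtermap f \<omega>)"
      using U(3) by (simp add: not_eventually_iff eventually_filtermap)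
    ultimately have "eventually (\<lambda>x. False) (inf (nhds l) (filtermap f \<omega>))"
      unfolding eventually_inf by blast
    then show False using l(2) by simp
  qed
  then show "(f \<longlongrightarrow> Lim \<omega> f) \<omega>" "Lim \<omega> f \<in> S"
    using l(1) tendsto_Lim [OF omega_neq_bot] by auto
qed

lemma tendsto_Lim_omega_bounded:
  fixes f :: "nat \<Rightarrow> 'a::{heine_borel,real_normed_vector}"
  assumes "eventually (\<lambda>k. norm (f k) \<le> C) \<omega>"
  shows "(f \<longlongrightarrow> Lim \<omega> f) \<omega>" "norm (Lim \<omega> f) \<le> C"
  using tendsto_Lim_omega_compact [of "cball 0 C" f] assms
  by auto

lemma Lim_omega_cong:
  assumes "eventually (\<lambda>k. f k = g k) \<omega>"
  shows "Lim \<omega> f = Lim \<omega> g"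
  using tendsto_cong [OF assms] by (simp add: Topological_Spaces.Lim_def)

text \<open>That f k > a eventually only gives a limit of at least a. The gaps 1 / (m + 1) restore
  strictness and are countable in number, as measurability will require.\<close>

lemma Lim_omega_gt_iff:
  fixes f :: "nat \<Rightarrow> real"
  assumes "(f \<longlongrightarrow> l) \<omega>"
  shows "l > a \<longleftrightarrow> (\<exists>m. eventually (\<lambda>k. f k > a + 1 / real (Suc m)) \<omega>)"
proof
  assume "l > a"
  then obtain m where "a + 1 / real (Suc m) < l"
    by (metis add.commute less_diff_eq nat_approx_posE diff_gt_0_iff_gt)
  then show "\<exists>m. eventually (\<lambda>k. f k > a + 1 / real (Suc m)) \<omega>"
    using order_tendstoD(1) [OF assms] by blast
next
  assume "\<exists>m. eventually (\<lambda>k. f k > a + 1 / real (Suc m)) \<omega>"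
  then obtain m where "eventually (\<lambda>k. f k > a + 1 / real (Suc m)) \<omega>" by blast
  then have "eventually (\<lambda>k. a + 1 / real (Suc m) \<le> f k) \<omega>"
    by eventually_elim simp
  then have "a + 1 / real (Suc m) \<le> l"
    by (intro tendsto_lowerbound [OF assms]) auto
  moreover have "0 < 1 / real (Suc m)" by simp
  ultimately show "l > a" by linarith
qed

section \<open>Loeb points and internal sets\<close>

lemma equiv_loeb_rel: "equiv (point_seqs n) (loeb_rel \<omega> n)"
proof (rule equivI)
  show "trans (loeb_rel \<omega> n)"
    unfolding trans_def loeb_rel_def by (auto elim: eventually_elim2)
  show "loeb_rel \<omega> n \<subseteq> point_seqs n \<times> point_seqs n"
    "refl_on (point_seqs n) (loeb_rel \<omega> n)"
    by (auto simp: refl_on_def loeb_rel_def)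
  show "sym (loeb_rel \<omega> n)"
    by (auto simp: sym_def loeb_rel_def eq_commute)
qed

lemma loeb_class_in_points: "x \<in> point_seqs n \<Longrightarrow> loeb_class \<omega> n x \<in> loeb_points \<omega> n"
  unfolding loeb_class_def loeb_points_def by (rule quotientI)

lemma loeb_class_eq_iff:
  assumes "x \<in> point_seqs n" "y \<in> point_seqs n"
  shows "loeb_class \<omega> n x = loeb_class \<omega> n y \<longleftrightarrow> eventually (\<lambda>k. x k = y k) \<omega>"
  using eq_equiv_class_iff [OF equiv_loeb_rel assms] assms
  unfolding loeb_class_def by (simp add: loeb_rel_def)

lemma loeb_rep_class:
  assumes "x \<in> point_seqs n"
  shows "eventually (\<lambda>k. loeb_rep (loeb_class \<omega> n x) k = x k) \<omega>"
proof -
  have "x \<in> loeb_class \<omega> n x"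
    using assms by (simp add: loeb_class_def loeb_rel_def)
  then have "loeb_rep (loeb_class \<omega> n x) \<in> loeb_class \<omega> n x"
    unfolding loeb_rep_def by (simp add: some_in_eq) blast
  then show ?thesis
    by (auto simp: loeb_class_def loeb_rel_def eq_commute)
qed

lemma
  assumes "c \<in> loeb_points \<omega> n"
  shows loeb_rep_in: "loeb_rep c \<in> point_seqs n"
    and loeb_class_rep: "loeb_class \<omega> n (loeb_rep c) = c"
proof -
  obtain x where x: "x \<in> point_seqs n" "c = loeb_class \<omega> n x"
    using assms unfolding loeb_points_def loeb_class_def by (auto elim: quotientE)
  then have "x \<in> c"
    by (simp add: loeb_class_def loeb_rel_def)
  then have "loeb_rep c \<in> c"
    unfolding loeb_rep_def by (simp add: some_in_eq) blast
  then show *: "loeb_rep c \<in> point_seqs n"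
    unfolding x(2) loeb_class_def loeb_rel_def by blast
  then show "loeb_class \<omega> n (loeb_rep c) = c"
    using loeb_rep_class [OF x(1)] x by (simp add: loeb_class_eq_iff)
qed

lemma loeb_rep_range:
  "c \<in> loeb_points \<omega> n \<Longrightarrow> loeb_rep c k \<in> {1..n k}"
  using loeb_rep_in [of c] by (auto simp: point_seqs_def)

abbreviation internal_families :: "(nat \<Rightarrow> nat set) set" where
  "internal_families \<equiv> {A. \<forall>k. A k \<subseteq> {1..n k}}"

text \<open>Membership can be read off from the chosen representative, because two representatives
  agree along \<omega>.\<close>

lemma internal_set_iff:
  "c \<in> internal_set \<omega> n A \<longleftrightarrow>
     c \<in> loeb_points \<omega> n \<and> eventually (\<lambda>k. loeb_rep c k \<in> A k) \<omega>"
proof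
  assume "c \<in> internal_set \<omega> n A"
  then obtain x where x: "x \<in> point_seqs n" "eventually (\<lambda>k. x k \<in> A k) \<omega>"
    "c = loeb_class \<omega> n x"
    unfolding internal_set_def by blast
  have "eventually (\<lambda>k. loeb_rep c k \<in> A k) \<omega>"
    using loeb_rep_class [OF x(1)] x(2) unfolding x(3) by eventually_elim simp
  then show "c \<in> loeb_points \<omega> n \<and> eventually (\<lambda>k. loeb_rep c k \<in> A k) \<omega>"
    using x loeb_class_in_points by blast
next
  assume "c \<in> loeb_points \<omega> n \<and> eventually (\<lambda>k. loeb_rep c k \<in> A k) \<omega>"
  then show "c \<in> internal_set \<omega> n A"
    using loeb_rep_in [of c] loeb_class_rep [of c, symmetric] unfolding internal_set_def by blast
qed

lemma class_in_internal_set_iff: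
  assumes "x \<in> point_seqs n"
  shows "loeb_class \<omega> n x \<in> internal_set \<omega> n A \<longleftrightarrow> eventually (\<lambda>k. x k \<in> A k) \<omega>"
proof -
  have "eventually (\<lambda>k. loeb_rep (loeb_class \<omega> n x) k \<in> A k) \<omega> \<longleftrightarrow> eventually (\<lambda>k. x k \<in> A k) \<omega>"
    by (rule eventually_cong [OF loeb_rep_class [OF assms]]) simp
  then show ?thesis
    using assms by (simp add: internal_set_iff loeb_class_in_points)
qed

lemma internal_set_subset: "internal_set \<omega> n A \<subseteq> loeb_points \<omega> n"
  by (auto simp: internal_set_iff)

lemma internal_set_Un:
  "internal_set \<omega> n A \<union> internal_set \<omega> n B = internal_set \<omega> n (\<lambda>k. A k \<union> B k)"
  by (auto simp: internal_set_iff eventually_disj_iff)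

lemma internal_set_Int:
  "internal_set \<omega> n A \<inter> internal_set \<omega> n B = internal_set \<omega> n (\<lambda>k. A k \<inter> B k)"
  by (auto simp: internal_set_iff eventually_conj_iff)

text \<open>The ultrafilter property enters here: for a general filter, not being eventually in A is
  weaker than being eventually outside A.\<close>

lemma internal_set_compl:
  "loeb_points \<omega> n - internal_set \<omega> n A = internal_set \<omega> n (\<lambda>k. {1..n k} - A k)"
proof -
  have "eventually (\<lambda>k. loeb_rep c k \<in> {1..n k} - A k) \<omega> \<longleftrightarrow> \<not> eventually (\<lambda>k. loeb_rep c k \<in> A k) \<omega>"
    if "c \<in> loeb_points \<omega> n" for c
    using loeb_rep_range [OF that] by (simp add: not_eventually_iff)
  then show ?thesis
    by (auto simp: internal_set_iff)
qed

lemma internal_set_empty [simp]: "internal_set \<omega> n (\<lambda>k. {}) = {}"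
  by (auto simp: internal_set_iff)

lemma internal_set_full: "internal_set \<omega> n (\<lambda>k. {1..n k}) = loeb_points \<omega> n"
  using internal_set_compl [of "\<lambda>k. {}"] by simp

text \<open>If the inclusion fails along \<omega>, a point of A k - B k picked at each such k gives
  one Loeb point in the first set and outside the second.\<close>

lemma internal_set_mono_iff:
  assumes "A \<in> internal_families"
  shows "internal_set \<omega> n A \<subseteq> internal_set \<omega> n B \<longleftrightarrow> eventually (\<lambda>k. A k \<subseteq> B k) \<omega>"
proof
  assume ev: "eventually (\<lambda>k. A k \<subseteq> B k) \<omega>"
  show "internal_set \<omega> n A \<subseteq> internal_set \<omega> n B"
  proof
    fix c assume c: "c \<in> internal_set \<omega> n A"
    then have "eventually (\<lambda>k. loeb_rep c k \<in> A k) \<omega>"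
      by (simp add: internal_set_iff)
    with ev have "eventually (\<lambda>k. loeb_rep c k \<in> B k) \<omega>"
      by eventually_elim blast
    with c show "c \<in> internal_set \<omega> n B"
      by (simp add: internal_set_iff)
  qed
next
  assume sub: "internal_set \<omega> n A \<subseteq> internal_set \<omega> n B"
  \<comment> \<open>The default 1 is a legal point because n k > 0.\<close>
  define x where "x k = (if A k \<subseteq> B k then 1 else SOME i. i \<in> A k - B k)" for k
  have x: "x k \<in> A k - B k" if "\<not> A k \<subseteq> B k" for k
    unfolding x_def using that by simp (metis (mono_tags, lifting) someI_ex subsetI)
  have "x k \<in> {1..n k}" for k
  proof (cases "A k \<subseteq> B k")
    case True then show ?thesis using n_pos [of k] by (simp add: x_def)
  next
    case False then show ?thesis using x [OF False] assms by blast
  qed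
  then have x_in: "x \<in> point_seqs n" by (simp add: point_seqs_def)
  show "eventually (\<lambda>k. A k \<subseteq> B k) \<omega>"
  proof (rule ccontr)
    assume "\<not> eventually (\<lambda>k. A k \<subseteq> B k) \<omega>"
    then have ev: "eventually (\<lambda>k. x k \<in> A k - B k) \<omega>"
      unfolding not_eventually_iff using x by (rule eventually_mono)
    then have "loeb_class \<omega> n x \<in> internal_set \<omega> n A"
      unfolding class_in_internal_set_iff [OF x_in] by (rule eventually_mono) simp
    then have "eventually (\<lambda>k. x k \<in> B k) \<omega>"
      using sub class_in_internal_set_iff [OF x_in] by blast
    moreover have "eventually (\<lambda>k. \<not> x k \<in> B k) \<omega>"
      using ev by eventually_elim simp
    ultimately show False
      using not_eventually_iff by blast
  qed
qed

text \<open>An internal set determines its family along \<omega>, which makes the counting limit a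
  function of the set.\<close>

lemma internal_set_eq_iff:
  assumes "A \<in> internal_families" "B \<in> internal_families"
  shows "internal_set \<omega> n A = internal_set \<omega> n B \<longleftrightarrow> eventually (\<lambda>k. A k = B k) \<omega>"
  unfolding set_eq_subset internal_set_mono_iff [OF assms(1)] internal_set_mono_iff [OF assms(2)]
  by (simp add: eventually_conj_iff)

section \<open>The counting pre-measure and its extension\<close>

definition counting_lim :: "(nat \<Rightarrow> nat set) \<Rightarrow> real" where
  "counting_lim A = Lim \<omega> (\<lambda>k. real (card (A k)) / real (n k))"

lemma counting_density_le_1: "A k \<subseteq> {1..n k} \<Longrightarrow> real (card (A k)) / real (n k) \<le> 1"
  using card_mono [of "{1..n k}" "A k"] n_pos [of k] by (simp add: divide_simps)

lemma
  assumes "A \<in> internal_families"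
  shows tendsto_counting_lim: "((\<lambda>k. real (card (A k)) / real (n k)) \<longlongrightarrow> counting_lim A) \<omega>"
    and counting_lim_nonneg: "counting_lim A \<ge> 0"
proof -
  have "real (card (A k)) / real (n k) \<in> {0..1}" for k
    using counting_density_le_1 [of A k] assms by simp
  then have *: "eventually (\<lambda>k. real (card (A k)) / real (n k) \<in> {0..1}) \<omega>"
    by (rule always_eventually [OF allI])
  show "((\<lambda>k. real (card (A k)) / real (n k)) \<longlongrightarrow> counting_lim A) \<omega>" "counting_lim A \<ge> 0"
    using tendsto_Lim_omega_compact [OF compact_Icc *] by (simp_all add: counting_lim_def)
qed

lemma counting_lim_Un:
  assumes "A \<in> internal_families" "B \<in> internal_families"
    and "eventually (\<lambda>k. A k \<inter> B k = {}) \<omega>"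
  shows "counting_lim (\<lambda>k. A k \<union> B k) = counting_lim A + counting_lim B"
proof -
  have fin: "finite (A k)" "finite (B k)" for k
    using assms(1,2) finite_subset [OF _ finite_atLeastAtMost] by blast+
  have "((\<lambda>k. real (card (A k)) / real (n k) + real (card (B k)) / real (n k))
     \<longlongrightarrow> counting_lim A + counting_lim B) \<omega>"
    by (intro tendsto_add tendsto_counting_lim assms)
  moreover have "eventually (\<lambda>k. real (card (A k)) / real (n k) + real (card (B k)) / real (n k) =
       real (card (A k \<union> B k)) / real (n k)) \<omega>"
    using assms(3) by eventually_elim (simp add: card_Un_disjoint fin add_divide_distrib)
  ultimately have "((\<lambda>k. real (card (A k \<union> B k)) / real (n k)) \<longlongrightarrow> counting_lim A + counting_lim B) \<omega>"
    by (simp add: tendsto_cong)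
  then show ?thesis
    unfolding counting_lim_def [of "\<lambda>k. A k \<union> B k"] by (rule tendsto_Lim [OF omega_neq_bot])
qed

text \<open>Pick a point of the intersection of the first \<open>j\<close> sets at stage \<open>k\<close>, with \<open>j \<le> k\<close> as
  large as possible.\<close>

lemma countable_saturation:
  assumes B: "\<And>i. B i \<in> internal_families"
    and ne: "\<And>i. internal_set \<omega> n (B i) \<noteq> {}"
    and dec: "decseq (\<lambda>i. internal_set \<omega> n (B i))"
  shows "(\<Inter>i. internal_set \<omega> n (B i)) \<noteq> {}"
proof -
  \<comment> \<open>The internal sets decrease, but at the finite stages the sets B i k do so only
    for \<omega>-most k, depending on i. Finite intersections decrease at every k.\<close>
  define C where "C i k = (\<Inter>j\<in>{..i}. B j k)" for i k
  have evC: "eventually (\<lambda>k. C i k \<noteq> {}) \<omega>" for i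
  proof -
    have "eventually (\<lambda>k. \<forall>j\<in>{..i}. B i k \<subseteq> B j k) \<omega>"
      by (rule eventually_ball_finite)
        (use decseqD [OF dec] internal_set_mono_iff [OF B] in auto)
    moreover have "\<not> eventually (\<lambda>k. B i k = {}) \<omega>"
      using ne [of i] internal_set_eq_iff [OF B, of "\<lambda>k. {}" i] by simp
    then have "eventually (\<lambda>k. B i k \<noteq> {}) \<omega>"
      by (simp add: not_eventually_iff)
    ultimately show ?thesis
    proof eventually_elim
      case (elim k)
      then have "B i k \<subseteq> C i k" by (auto simp: C_def)
      with elim(2) show ?case by blast
    qed
  qed
  \<comment> \<open>The condition j \<le> k bounds the candidates, so that a greatest one exists,
    and every fixed j satisfies it eventually.\<close>
  define P where "P k j \<longleftrightarrow> j \<le> k \<and> C j k \<noteq> {}" for k j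
  define x where "x k = (if \<exists>j. P k j then SOME i. i \<in> C (GREATEST j. P k j) k else 1)" for k
  have x: "x k \<in> C j k" if "P k j" for j k
  proof -
    have bound: "\<forall>i. P k i \<longrightarrow> i \<le> k"
      by (simp add: P_def)
    have g: "P k (GREATEST j. P k j)" "j \<le> (GREATEST j. P k j)"
      using GreatestI_nat [of "P k" j k] Greatest_le_nat [of "P k" j k] that bound by blast+
    then have "(SOME i. i \<in> C (GREATEST j. P k j) k) \<in> C (GREATEST j. P k j) k"
      by (simp add: P_def some_in_eq)
    then have "x k \<in> C (GREATEST j. P k j) k"
      using that unfolding x_def by auto
    then show ?thesis
      using g(2) by (auto simp: C_def)
  qed
  have "x k \<in> {1..n k}" for k
  proof (cases "\<exists>j. P k j")
    case True
    then obtain j where "P k j" by blast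
    with x have "x k \<in> B j k" by (auto simp: C_def)
    then show ?thesis using B by blast
  next
    case False
    then show ?thesis using n_pos [of k] by (simp add: x_def)
  qed
  then have x_in: "x \<in> point_seqs n" by (simp add: point_seqs_def)
  have "loeb_class \<omega> n x \<in> internal_set \<omega> n (B j)" for j
    unfolding class_in_internal_set_iff [OF x_in]
    using evC [of j] eventually_omega_ge [of j]
  proof eventually_elim
    case (elim k)
    then have "x k \<in> C j k" by (intro x) (simp add: P_def)
    then show ?case by (simp add: C_def)
  qed
  then show ?thesis by blast
qed

abbreviation internal_algebra :: "(nat \<Rightarrow> nat) set set set" where
  "internal_algebra \<equiv> internal_set \<omega> n ` internal_families"

lemma algebra_internal: "Sigma_Algebra.algebra (loeb_points \<omega> n) internal_algebra"
  unfolding algebra_iff_Un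
proof (intro conjI ballI)
  show "internal_algebra \<subseteq> Pow (loeb_points \<omega> n)"
    using internal_set_subset by auto
  show "{} \<in> internal_algebra"
    by (rule image_eqI [of _ _ "\<lambda>k. {}"]) auto
  show "loeb_points \<omega> n - a \<in> internal_algebra" if "a \<in> internal_algebra" for a
    using that by (auto simp: internal_set_compl)
  show "a \<union> b \<in> internal_algebra" if "a \<in> internal_algebra" "b \<in> internal_algebra" for a b
  proof -
    obtain A B where "A \<in> internal_families" "B \<in> internal_families"
      "a = internal_set \<omega> n A" "b = internal_set \<omega> n B"
      using \<open>a \<in> _\<close> \<open>b \<in> _\<close> by blast
    then show ?thesis
      by (intro image_eqI [of _ _ "\<lambda>k. A k \<union> B k"]) (auto simp: internal_set_Un)
  qed
qed

lemma counting_lim_cong: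
  assumes "eventually (\<lambda>k. A k = B k) \<omega>"
  shows "counting_lim A = counting_lim B"
  unfolding counting_lim_def
  by (rule Lim_omega_cong) (use assms in eventually_elim, simp)

text \<open>Caratheodory's theorem asks for continuity at the empty set. By saturation, a decreasing
  sequence of internal sets with empty intersection reaches the empty set, so the values are
  eventually 0.\<close>

lemma counting_premeasure_extends:
  "\<exists>\<mu>. (\<forall>A\<in>internal_families. \<mu> (internal_set \<omega> n A) = ennreal (counting_lim A)) \<and>
     measure_space (loeb_points \<omega> n) (sigma_sets (loeb_points \<omega> n) internal_algebra) \<mu>"
proof -
  interpret Sigma_Algebra.algebra "loeb_points \<omega> n" internal_algebra
    by (rule algebra_internal)
  \<comment> \<open>A set has many defining families; by \<open>internal_set_eq_iff\<close> they
    agree along \<omega>, so the choice has no effect on the limit.\<close>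
  define f where "f s = ennreal (counting_lim (SOME A. A \<in> internal_families \<and> s = internal_set \<omega> n A))"
    for s
  have f: "f (internal_set \<omega> n A) = ennreal (counting_lim A)" if A: "A \<in> internal_families" for A
  proof -
    let ?B = "SOME B. B \<in> internal_families \<and> internal_set \<omega> n A = internal_set \<omega> n B"
    have "?B \<in> internal_families \<and> internal_set \<omega> n A = internal_set \<omega> n ?B"
      by (rule someI [of "\<lambda>B. B \<in> internal_families \<and> internal_set \<omega> n A = internal_set \<omega> n B" A])
        (rule conjI [OF A refl])
    then have "eventually (\<lambda>k. A k = ?B k) \<omega>"
      using A internal_set_eq_iff by blast
    then show ?thesis
      unfolding f_def by (simp add: counting_lim_cong)
  qed
  have f0: "f {} = 0"
  proof -
    have "counting_lim (\<lambda>k. {}) = 0"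
      unfolding counting_lim_def by (rule tendsto_Lim [OF omega_neq_bot]) simp
    then show ?thesis using f [of "\<lambda>k. {}"] by simp
  qed
  have "\<exists>\<mu>. (\<forall>s\<in>internal_algebra. \<mu> s = f s) \<and>
      measure_space (loeb_points \<omega> n) (sigma_sets (loeb_points \<omega> n) internal_algebra) \<mu>"
  proof (rule caratheodory_empty_continuous)
    show "positive internal_algebra f"
      using f0 by (simp add: positive_def)
    show "additive internal_algebra f"
      unfolding additive_def
    proof (intro ballI impI)
      fix a b assume "a \<in> internal_algebra" "b \<in> internal_algebra" and dis: "a \<inter> b = {}"
      then obtain A B where AB: "A \<in> internal_families" "B \<in> internal_families"
        "a = internal_set \<omega> n A" "b = internal_set \<omega> n B"
        by blast
      have AB': "(\<lambda>k. A k \<inter> B k) \<in> internal_families" "(\<lambda>k. A k \<union> B k) \<in> internal_families"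
        using AB(1,2) by auto
      have "internal_set \<omega> n (\<lambda>k. A k \<inter> B k) = internal_set \<omega> n (\<lambda>k. {})"
        using dis AB by (simp add: internal_set_Int)
      then have "eventually (\<lambda>k. A k \<inter> B k = {}) \<omega>"
        using internal_set_eq_iff [OF AB'(1), of "\<lambda>k. {}"] by simp
      then show "f (a \<union> b) = f a + f b"
        using AB AB' by (simp add: internal_set_Un f counting_lim_Un ennreal_plus counting_lim_nonneg)
    qed
    show "f A \<noteq> \<infinity>" for A
      by (simp add: f_def)
    show "(\<lambda>i. f (A i)) \<longlonglongrightarrow> 0"
      if A: "range A \<subseteq> internal_algebra" "decseq A" "(\<Inter>i. A i) = {}" for A
    proof -
      have "\<forall>i. \<exists>B. B \<in> internal_families \<and> A i = internal_set \<omega> n B"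
        using A(1) by blast
      then obtain B where B: "\<And>i. B i \<in> internal_families" "\<And>i. A i = internal_set \<omega> n (B i)"
        by metis
      have "\<exists>i. A i = {}"
      proof (rule ccontr)
        assume ne: "\<nexists>i. A i = {}"
        have "(\<Inter>i. internal_set \<omega> n (B i)) \<noteq> {}"
          using ne A(2) by (intro countable_saturation B(1)) (simp_all add: B(2) [abs_def])
        then show False using A(3) B(2) by simp
      qed
      then obtain i where "A i = {}" by blast
      then have "A j = {}" if "j \<ge> i" for j
        using decseqD [OF A(2) that] by blast
      then have "eventually (\<lambda>j. f (A j) = 0) sequentially"
        unfolding eventually_sequentially by (intro exI [of _ i]) (simp add: f0)
      then show ?thesis by (rule tendsto_eventually)
    qed
  qed
  then show ?thesis
    using f by auto
qed

text \<open>The Loeb measure before completion: its sigma-algebra is generated by the internal sets,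
  so measures on it can be compared on these.\<close>

definition loeb_base :: "(nat \<Rightarrow> nat) set measure" where
  "loeb_base = extend_measure (loeb_points \<omega> n) internal_families (internal_set \<omega> n)
     (\<lambda>A. ennreal (Lim \<omega> (\<lambda>k. real (card (A k)) / real (n k))))"

lemma loeb_space_eq: "loeb_space \<omega> n = completion loeb_base"
  by (simp add: loeb_space_def loeb_base_def)

lemma space_loeb_base [simp]: "space loeb_base = loeb_points \<omega> n"
  unfolding loeb_base_def by (rule space_extend_measure) (use internal_set_subset in auto)

lemma sets_loeb_base: "sets loeb_base = sigma_sets (loeb_points \<omega> n) internal_algebra"
  unfolding loeb_base_def by (rule sets_extend_measure) (use internal_set_subset in auto)

text \<open>\<open>extend_measure\<close> takes the prescribed values once some measure is known to
  take them; the witness comes from \<open>counting_premeasure_extends\<close>.\<close>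

lemma emeasure_loeb_base_internal:
  assumes "A \<in> internal_families"
  shows "emeasure loeb_base (internal_set \<omega> n A) = ennreal (counting_lim A)"
proof -
  obtain \<mu> where \<mu>: "\<And>A. A \<in> internal_families \<Longrightarrow> \<mu> (internal_set \<omega> n A) = ennreal (counting_lim A)"
    "measure_space (loeb_points \<omega> n) (sigma_sets (loeb_points \<omega> n) internal_algebra) \<mu>"
    using counting_premeasure_extends by blast
  show ?thesis
    unfolding counting_lim_def
  proof (rule emeasure_extend_measure [OF loeb_base_def])
    show "positive (sets loeb_base) \<mu>" "countably_additive (sets loeb_base) \<mu>"
      using \<mu>(2) by (simp_all add: sets_loeb_base measure_space_def)
    show "internal_set \<omega> n ` internal_families \<subseteq> Pow (loeb_points \<omega> n)"
      using internal_set_subset by blast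
  qed (use \<mu>(1) assms in \<open>auto simp: counting_lim_def\<close>)
qed

lemma space_loeb [simp]: "space (loeb_space \<omega> n) = loeb_points \<omega> n"
  by (simp add: loeb_space_eq)

text \<open>Trimming makes families given by a bare condition, such as
  \<open>{i. d k i > a}\<close>, eligible as generators.\<close>

lemma internal_restrict:
  "internal_set \<omega> n A = internal_set \<omega> n (\<lambda>k. A k \<inter> {1..n k})"
  using internal_set_Int [of A "\<lambda>k. {1..n k}"] internal_set_subset [of A]
  by (simp add: internal_set_full Int_absorb2 del: One_nat_def)

lemma internal_set_in_base: "internal_set \<omega> n A \<in> sets loeb_base"
proof -
  have "internal_set \<omega> n (\<lambda>k. A k \<inter> {1..n k}) \<in> internal_algebra"
    by (rule imageI) auto
  then show ?thesis
    unfolding sets_loeb_base internal_restrict [of A] by (rule sigma_sets.Basic)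
qed

lemma internal_set_in_sets [simp, intro]: "internal_set \<omega> n A \<in> sets (loeb_space \<omega> n)"
  using internal_set_in_base by (simp add: loeb_space_eq)

lemma emeasure_internal:
  assumes "A \<in> internal_families"
  shows "emeasure (loeb_space \<omega> n) (internal_set \<omega> n A) = ennreal (counting_lim A)"
  using assms internal_set_in_base
  by (simp add: loeb_space_eq emeasure_loeb_base_internal)

lemma counting_lim_full: "counting_lim (\<lambda>k. {1..n k}) = 1"
  unfolding counting_lim_def
  by (rule tendsto_Lim [OF omega_neq_bot]) (simp add: n_pos less_imp_neq [OF n_pos, symmetric])

lemma emeasure_space_loeb_base: "emeasure loeb_base (space loeb_base) = 1"
  using emeasure_loeb_base_internal [of "\<lambda>k. {1..n k}"]
  by (simp add: internal_set_full counting_lim_full del: One_nat_def)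

lemma complete_loeb: "complete_measure (loeb_space \<omega> n)"
  unfolding loeb_space_eq by (rule completion.complete_measure_axioms)

section \<open>Loeb limits of functions on the finite stages\<close>

lemma
  fixes d :: "nat \<Rightarrow> nat \<Rightarrow> 'a::{heine_borel,real_normed_vector}"
  assumes d: "\<And>k i. i \<in> {1..n k} \<Longrightarrow> norm (d k i) \<le> C" and c: "c \<in> loeb_points \<omega> n"
  shows tendsto_loeb_lim: "((\<lambda>k. d k (loeb_rep c k)) \<longlongrightarrow> loeb_lim \<omega> d c) \<omega>"
    and norm_loeb_lim_le: "norm (loeb_lim \<omega> d c) \<le> C"
  unfolding loeb_lim_def
  using tendsto_Lim_omega_bounded [of "\<lambda>k. d k (loeb_rep c k)" C] d loeb_rep_range [OF c]
  by simp_all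

lemma loeb_lim_eqI:
  assumes "((\<lambda>k. d k (loeb_rep c k)) \<longlongrightarrow> l) \<omega>"
  shows "loeb_lim \<omega> d c = l"
  unfolding loeb_lim_def by (rule tendsto_Lim [OF omega_neq_bot assms])

text \<open>A limit along \<omega> is not a sequential limit, so the usual closure of measurable
  functions does not apply; the countably many gaps give measurability instead.\<close>

lemma loeb_lim_gt_eq:
  fixes d :: "nat \<Rightarrow> nat \<Rightarrow> real"
  assumes "\<And>k i. i \<in> {1..n k} \<Longrightarrow> norm (d k i) \<le> C"
  shows "{c \<in> loeb_points \<omega> n. loeb_lim \<omega> d c > a} =
     (\<Union>m. internal_set \<omega> n (\<lambda>k. {i. d k i > a + 1 / real (Suc m)}))"
  using Lim_omega_gt_iff [OF tendsto_loeb_lim [OF assms]] by (auto simp: internal_set_iff)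

lemma loeb_lim_measurable_real:
  fixes d :: "nat \<Rightarrow> nat \<Rightarrow> real"
  assumes "\<And>k i. i \<in> {1..n k} \<Longrightarrow> norm (d k i) \<le> C"
  shows "loeb_lim \<omega> d \<in> borel_measurable (loeb_space \<omega> n)"
  unfolding borel_measurable_iff_greater
proof
  fix a
  have "{c \<in> loeb_points \<omega> n. loeb_lim \<omega> d c > a} \<in> sets (loeb_space \<omega> n)"
    by (subst loeb_lim_gt_eq [OF assms]) auto
  then show "{c \<in> space (loeb_space \<omega> n). loeb_lim \<omega> d c > a} \<in> sets (loeb_space \<omega> n)"
    by simp
qed

lemma loeb_lim_measurable:
  fixes d :: "nat \<Rightarrow> nat \<Rightarrow> complex"
  assumes d: "\<And>k i. i \<in> {1..n k} \<Longrightarrow> cmod (d k i) \<le> C"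
  shows "loeb_lim \<omega> d \<in> borel_measurable (loeb_space \<omega> n)"
proof -
  have ReIm: "norm (Re (d k i)) \<le> C" "norm (Im (d k i)) \<le> C" if "i \<in> {1..n k}" for k i
    using d [OF that] abs_Re_le_cmod [of "d k i"] abs_Im_le_cmod [of "d k i"] by auto
  have meas: "loeb_lim \<omega> (\<lambda>k i. Re (d k i)) \<in> borel_measurable (loeb_space \<omega> n)"
    "loeb_lim \<omega> (\<lambda>k i. Im (d k i)) \<in> borel_measurable (loeb_space \<omega> n)"
    by (rule loeb_lim_measurable_real, erule ReIm)+
  have eq: "loeb_lim \<omega> d c = Complex (loeb_lim \<omega> (\<lambda>k i. Re (d k i)) c) (loeb_lim \<omega> (\<lambda>k i. Im (d k i)) c)"
    if "c \<in> space (loeb_space \<omega> n)" for c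
  proof (rule loeb_lim_eqI)
    have "((\<lambda>k. Complex (Re (d k (loeb_rep c k))) (Im (d k (loeb_rep c k)))) \<longlongrightarrow>
        Complex (loeb_lim \<omega> (\<lambda>k i. Re (d k i)) c) (loeb_lim \<omega> (\<lambda>k i. Im (d k i)) c)) \<omega>"
      using ReIm that by (intro tendsto_Complex tendsto_loeb_lim) auto
    then show "((\<lambda>k. d k (loeb_rep c k)) \<longlongrightarrow>
        Complex (loeb_lim \<omega> (\<lambda>k i. Re (d k i)) c) (loeb_lim \<omega> (\<lambda>k i. Im (d k i)) c)) \<omega>"
      by simp
  qed
  have "(\<lambda>c. Complex (loeb_lim \<omega> (\<lambda>k i. Re (d k i)) c) (loeb_lim \<omega> (\<lambda>k i. Im (d k i)) c))
      \<in> borel_measurable (loeb_space \<omega> n)"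
    unfolding Complex_eq using meas by (intro borel_measurable_add borel_measurable_times borel_measurable_const measurable_compose [OF _ borel_measurable_of_real])
  then show ?thesis
    by (subst measurable_cong [OF eq])
qed

lemma loeb_lim_ess_bounded:
  assumes d: "\<And>k i. i \<in> {1..n k} \<Longrightarrow> cmod (d k i) \<le> C"
  shows "loeb_lim \<omega> d \<in> ess_bounded_fns (loeb_space \<omega> n)"
proof -
  have "AE c in loeb_space \<omega> n. cmod (loeb_lim \<omega> d c) \<le> C"
    by (rule AE_I2) (use norm_loeb_lim_le [OF d] in simp)
  then show ?thesis
    using loeb_lim_measurable [OF d] by (auto simp: ess_bounded_fns_def)
qed

section \<open>The standard part map\<close>

lemma St_bound: "i \<in> {1..n k} \<Longrightarrow> norm (real i / real (n k)) \<le> 1"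
  using n_pos [of k] by simp

lemma tendsto_St:
  "c \<in> loeb_points \<omega> n \<Longrightarrow> ((\<lambda>k. real (loeb_rep c k) / real (n k)) \<longlongrightarrow> St \<omega> n c) \<omega>"
  unfolding St_def by (rule tendsto_loeb_lim [OF St_bound])

lemma St_range: "c \<in> loeb_points \<omega> n \<Longrightarrow> St \<omega> n c \<in> {0..1}"
  using tendsto_lowerbound [OF tendsto_St [of c], of 0] norm_loeb_lim_le [OF St_bound]
  by (force simp: St_def)

lemma emeasure_space_loeb: "emeasure (loeb_space \<omega> n) (space (loeb_space \<omega> n)) = 1"
  using emeasure_internal [of "\<lambda>k. {1..n k}"]
  by (simp add: internal_set_full counting_lim_full del: One_nat_def)

text \<open>The event that the standard part exceeds a is squeezed between internal events: i / n_k
  > a + e forces a limit of at least a + e, and a limit above a forces i / n_k > a eventually. Their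
  measures are 1 - a - e and 1 - a.\<close>

lemma St_preserves_measure: "preserves_measure (loeb_space \<omega> n) unit_interval (St \<omega> n)"
proof (rule preserves_measure_unit_intervalI [OF complete_loeb])
  show St_meas: "St \<omega> n \<in> borel_measurable (loeb_space \<omega> n)"
    unfolding St_def by (rule loeb_lim_measurable_real [OF St_bound])
  show "St \<omega> n c \<in> {0..1}" if "c \<in> space (loeb_space \<omega> n)" for c
    using that St_range by simp
  show "emeasure (loeb_space \<omega> n) (space (loeb_space \<omega> n)) = 1"
    by (rule emeasure_space_loeb)
  fix a :: real assume a: "0 \<le> a" "a \<le> 1"
  let ?A = "\<lambda>b k. {i \<in> {1..n k}. real i / real (n k) > b}"
  let ?E = "emeasure (loeb_space \<omega> n)"
  have internal: "?E (internal_set \<omega> n (?A b)) = ennreal (1 - b)" if "0 \<le> b" "b \<le> 1" for b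
  proof -
    have "counting_lim (?A b) = 1 - b"
      unfolding counting_lim_def
      by (rule tendsto_Lim [OF omega_neq_bot tendsto_fraction_above [OF n_at_top that]])
    then show ?thesis
      by (subst emeasure_internal) auto
  qed
  have meas: "{c \<in> space (loeb_space \<omega> n). St \<omega> n c > a} \<in> sets (loeb_space \<omega> n)"
    using St_meas unfolding borel_measurable_iff_greater by blast
  show "?E {c \<in> space (loeb_space \<omega> n). St \<omega> n c > a} = ennreal (1 - a)"
  proof (rule antisym)
    have "{c \<in> space (loeb_space \<omega> n). St \<omega> n c > a} \<subseteq> internal_set \<omega> n (?A a)"
    proof safe
      fix c assume c: "c \<in> space (loeb_space \<omega> n)" "St \<omega> n c > a"
      then have "eventually (\<lambda>k. real (loeb_rep c k) / real (n k) > a) \<omega>"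
        using order_tendstoD(1) [OF tendsto_St] by auto
      then show "c \<in> internal_set \<omega> n (?A a)"
        using c(1) loeb_rep_range [of c] unfolding internal_set_iff by simp
    qed
    then have "?E {c \<in> space (loeb_space \<omega> n). St \<omega> n c > a} \<le> ?E (internal_set \<omega> n (?A a))"
      by (rule emeasure_mono) simp
    then show "?E {c \<in> space (loeb_space \<omega> n). St \<omega> n c > a} \<le> ennreal (1 - a)"
      by (simp only: internal [OF a])
    show "ennreal (1 - a) \<le> ?E {c \<in> space (loeb_space \<omega> n). St \<omega> n c > a}"
    proof (rule ennreal_le_epsilon)
      fix e :: real assume e: "0 < e"
      show "ennreal (1 - a) \<le> ?E {c \<in> space (loeb_space \<omega> n). St \<omega> n c > a} + ennreal e"
      proof (cases "a + e \<le> 1")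
        case True
        have "internal_set \<omega> n (?A (a + e)) \<subseteq> {c \<in> space (loeb_space \<omega> n). St \<omega> n c > a}"
        proof
          fix c assume c: "c \<in> internal_set \<omega> n (?A (a + e))"
          then have "eventually (\<lambda>k. a + e \<le> real (loeb_rep c k) / real (n k)) \<omega>"
            unfolding internal_set_iff by (auto elim: eventually_mono)
          then have "a + e \<le> St \<omega> n c"
            using c by (intro tendsto_lowerbound [OF tendsto_St]) (auto simp: internal_set_iff)
          then show "c \<in> {c \<in> space (loeb_space \<omega> n). St \<omega> n c > a}"
            using c e by (simp add: internal_set_iff)
        qed
        then have "?E (internal_set \<omega> n (?A (a + e))) \<le> ?E {c \<in> space (loeb_space \<omega> n). St \<omega> n c > a}"
          by (rule emeasure_mono [OF _ meas])
        then have "ennreal (1 - (a + e)) + ennreal e \<le> ?E {c \<in> space (loeb_space \<omega> n). St \<omega> n c > a} + ennreal e"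
          using internal [of "a + e"] a e True by (intro add_right_mono) simp
        moreover have "ennreal (1 - (a + e)) + ennreal e = ennreal (1 - a)"
          using True e by (subst ennreal_plus [symmetric]) auto
        ultimately show ?thesis by simp
      next
        case False
        \<comment> \<open>The threshold a + e lies beyond the interval, but then 1 - a is below the
          error e itself.\<close>
        then have "ennreal (1 - a) \<le> ennreal e" by (intro ennreal_leI) simp
        then show ?thesis by (simp add: add_increasing)
      qed
    qed
  qed
qed

section \<open>The action of permutation sequences\<close>

text \<open>\<open>sofic_act\<close> for an explicit sequence q, which keeps the choice made by
  \<open>sofic_rep\<close> out of the arguments.\<close>

definition perm_act :: "(nat \<Rightarrow> nat \<Rightarrow> nat) \<Rightarrow> (nat \<Rightarrow> nat) set \<Rightarrow> (nat \<Rightarrow> nat) set" where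
  "perm_act q c = loeb_class \<omega> n (\<lambda>k. q k (loeb_rep c k))"

context
  fixes q :: "nat \<Rightarrow> nat \<Rightarrow> nat"
  assumes q: "\<And>k. q k permutes {1..n k}"
begin

lemma permuted_rep_in: "c \<in> loeb_points \<omega> n \<Longrightarrow> (\<lambda>k. q k (loeb_rep c k)) \<in> point_seqs n"
  using loeb_rep_range [of c] permutes_in_image [OF q] by (auto simp: point_seqs_def)

lemma perm_act_in: "c \<in> loeb_points \<omega> n \<Longrightarrow> perm_act q c \<in> loeb_points \<omega> n"
  unfolding perm_act_def by (intro loeb_class_in_points permuted_rep_in)

lemma loeb_rep_perm_act:
  "c \<in> loeb_points \<omega> n \<Longrightarrow> eventually (\<lambda>k. loeb_rep (perm_act q c) k = q k (loeb_rep c k)) \<omega>"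
  unfolding perm_act_def by (intro loeb_rep_class permuted_rep_in)

lemma loeb_lim_perm_act:
  assumes "c \<in> loeb_points \<omega> n"
  shows "loeb_lim \<omega> d (perm_act q c) = loeb_lim \<omega> (\<lambda>k i. d k (q k i)) c"
  unfolding loeb_lim_def
  by (rule Lim_omega_cong) (use loeb_rep_perm_act [OF assms] in eventually_elim, simp)

lemma perm_act_vimage_internal:
  "perm_act q -` internal_set \<omega> n A \<inter> loeb_points \<omega> n = internal_set \<omega> n (\<lambda>k. {i \<in> {1..n k}. q k i \<in> A k})"
proof -
  have "perm_act q c \<in> internal_set \<omega> n A \<longleftrightarrow> c \<in> internal_set \<omega> n (\<lambda>k. {i \<in> {1..n k}. q k i \<in> A k})"
    if "c \<in> loeb_points \<omega> n" for c
    unfolding perm_act_def class_in_internal_set_iff [OF permuted_rep_in [OF that]]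
    using loeb_rep_range [OF that] that by (simp add: internal_set_iff)
  then show ?thesis
    using internal_set_subset by blast
qed

lemma counting_lim_vimage:
  assumes "A \<in> internal_families"
  shows "counting_lim (\<lambda>k. {i \<in> {1..n k}. q k i \<in> A k}) = counting_lim A"
proof -
  have "card {i \<in> {1..n k}. q k i \<in> A k} = card (A k)" for k
  proof (rule bij_betw_same_card [of "q k"])
    have "q k ` {i \<in> {1..n k}. q k i \<in> A k} = A k"
    proof (intro equalityI subsetI)
      fix i assume i: "i \<in> A k"
      then have "i \<in> q k ` {1..n k}"
        using assms permutes_image [OF q [of k]] by blast
      with i show "i \<in> q k ` {i \<in> {1..n k}. q k i \<in> A k}"
        by blast
    qed auto
    then show "bij_betw (q k) {i \<in> {1..n k}. q k i \<in> A k} (A k)"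
      using permutes_inj [OF q [of k]] by (auto simp: bij_betw_def intro: inj_on_subset)
  qed
  then show ?thesis by (simp add: counting_lim_def)
qed

text \<open>Preimages of internal sets are internal with the same counting limit. Internal sets are
  stable under intersection and generate the base sigma-algebra, which gives the claim before
  completion; then both sides are completed.\<close>

lemma perm_act_preserves_measure: "preserves_measure (loeb_space \<omega> n) (loeb_space \<omega> n) (perm_act q)"
  unfolding loeb_space_eq
proof (rule preserves_measure_completion_both, unfold preserves_measure_iff_distr, intro conjI)
  show meas: "perm_act q \<in> measurable loeb_base loeb_base"
  proof (rule measurable_sigma_sets [OF sets_loeb_base])
    show "internal_algebra \<subseteq> Pow (loeb_points \<omega> n)"
      using internal_set_subset by auto
    show "perm_act q \<in> space loeb_base \<rightarrow> loeb_points \<omega> n"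
      using perm_act_in by auto
    show "perm_act q -` a \<inter> space loeb_base \<in> sets loeb_base" if "a \<in> internal_algebra" for a
      using that by (auto simp: perm_act_vimage_internal intro: internal_set_in_base)
  qed
  show "distr loeb_base loeb_base (perm_act q) = loeb_base"
  proof (rule measure_eqI_generator_eq [of internal_algebra "loeb_points \<omega> n" _ _ "\<lambda>_. loeb_points \<omega> n"])
    show "Int_stable internal_algebra"
    proof (rule Int_stableI_image)
      fix A B assume "A \<in> internal_families" "B \<in> internal_families"
      then show "\<exists>C\<in>internal_families. internal_set \<omega> n A \<inter> internal_set \<omega> n B = internal_set \<omega> n C"
        by (intro bexI [of _ "\<lambda>k. A k \<inter> B k"]) (auto simp: internal_set_Int)
    qed
    show "internal_algebra \<subseteq> Pow (loeb_points \<omega> n)"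
      using internal_set_subset by auto
    show "emeasure (distr loeb_base loeb_base (perm_act q)) a = emeasure loeb_base a"
      if a: "a \<in> internal_algebra" for a
    proof -
      obtain A where A: "A \<in> internal_families" "a = internal_set \<omega> n A" using a by blast

      have "emeasure (distr loeb_base loeb_base (perm_act q)) a =
          emeasure loeb_base (perm_act q -` internal_set \<omega> n A \<inter> space loeb_base)"
        unfolding A(2) by (rule emeasure_distr [OF meas internal_set_in_base])
      also have "\<dots> = ennreal (counting_lim (\<lambda>k. {i \<in> {1..n k}. q k i \<in> A k}))"
        unfolding space_loeb_base perm_act_vimage_internal by (rule emeasure_loeb_base_internal) auto
      also have "\<dots> = emeasure loeb_base a"
        unfolding A(2) by (simp only: counting_lim_vimage [OF A(1)] emeasure_loeb_base_internal [OF A(1)])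
      finally show ?thesis .
    qed
    show "range (\<lambda>_::nat. loeb_points \<omega> n) \<subseteq> internal_algebra"
      by (auto simp: internal_set_full [symmetric] simp del: One_nat_def)
    show "emeasure (distr loeb_base loeb_base (perm_act q)) (loeb_points \<omega> n) \<noteq> \<infinity>"
    proof -
      have "perm_act q -` loeb_points \<omega> n \<inter> loeb_points \<omega> n = loeb_points \<omega> n"
        using perm_act_in by auto
      then show ?thesis
        using emeasure_space_loeb_base meas sets.top [of loeb_base] by (simp add: emeasure_distr)
    qed
  qed (simp_all add: sets_loeb_base)
qed

end

section \<open>Null sets and averages\<close>

lemma internal_null_iff:
  assumes "A \<in> internal_families"
  shows "(AE c in loeb_space \<omega> n. c \<notin> internal_set \<omega> n A) \<longleftrightarrow> counting_lim A = 0"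
proof -
  have "(AE c in loeb_space \<omega> n. c \<notin> internal_set \<omega> n A) \<longleftrightarrow> emeasure (loeb_space \<omega> n) (internal_set \<omega> n A) = 0"
    by (rule AE_iff_measurable) (use internal_set_subset in auto)
  also have "\<dots> \<longleftrightarrow> counting_lim A = 0"
    using counting_lim_nonneg [OF assms] by (simp add: emeasure_internal [OF assms])
  finally show ?thesis .
qed

text \<open>By the ultrafilter property, a point outside the internal set has d k \<le> e along
  \<omega>, and the weak inequality passes to the limit.\<close>

lemma loeb_lim_le_outside:
  fixes d :: "nat \<Rightarrow> nat \<Rightarrow> real"
  assumes d: "\<And>k i. i \<in> {1..n k} \<Longrightarrow> norm (d k i) \<le> C" and c: "c \<in> loeb_points \<omega> n"
    and out: "c \<notin> internal_set \<omega> n (\<lambda>k. {i \<in> {1..n k}. d k i > e})"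
  shows "loeb_lim \<omega> d c \<le> e"
proof -
  have "\<not> eventually (\<lambda>k. loeb_rep c k \<in> {i \<in> {1..n k}. d k i > e}) \<omega>"
    using c out by (simp add: internal_set_iff)
  then have "eventually (\<lambda>k. d k (loeb_rep c k) \<le> e) \<omega>"
    unfolding not_eventually_iff using loeb_rep_range [OF c] by (auto elim: eventually_mono)
  then show ?thesis
    by (intro tendsto_upperbound [OF tendsto_loeb_lim [OF d c]]) auto
qed

text \<open>For uniformly bounded nonnegative functions, convergence to 0 in the mean and in measure
  coincide: Markov's inequality in one direction, splitting at a threshold in the other. The
  internal set where d exceeds e translates between counting and the Loeb measure.\<close>

lemma average_tendsto_0_iff:
  fixes d :: "nat \<Rightarrow> nat \<Rightarrow> real"
  assumes nonneg: "\<And>k i. i \<in> {1..n k} \<Longrightarrow> 0 \<le> d k i" and le: "\<And>k i. i \<in> {1..n k} \<Longrightarrow> d k i \<le> C"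
  shows "((\<lambda>k. (\<Sum>i=1..n k. d k i) / real (n k)) \<longlongrightarrow> 0) \<omega> \<longleftrightarrow> (AE c in loeb_space \<omega> n. loeb_lim \<omega> d c = 0)"
proof -
  let ?A = "\<lambda>e k. {i \<in> {1..n k}. d k i > e}"
  have A: "?A e \<in> internal_families" for e by auto
  have bound: "norm (d k i) \<le> C" if "i \<in> {1..n k}" for k i
    using nonneg [OF that] le [OF that] by simp
  \<comment> \<open>Stage 0 contains the index 1, so the bounds on d are not vacuous there.\<close>
  have C: "C \<ge> 0"
    using nonneg [of 1 0] le [of 1 0] n_pos [of 0] by auto
  have lim_nonneg: "loeb_lim \<omega> d c \<ge> 0" if "c \<in> loeb_points \<omega> n" for c
    using nonneg loeb_rep_range [OF that]
    by (intro tendsto_lowerbound [OF tendsto_loeb_lim [OF bound that]]) (auto simp del: One_nat_def)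
  show ?thesis
  proof
    assume avg: "((\<lambda>k. (\<Sum>i=1..n k. d k i) / real (n k)) \<longlongrightarrow> 0) \<omega>"
    have "counting_lim (?A e) = 0" if e: "e > 0" for e
    proof (rule antisym [OF _ counting_lim_nonneg [OF A]])
      have "((\<lambda>k. ((\<Sum>i=1..n k. d k i) / real (n k)) / e) \<longlongrightarrow> 0 / e) \<omega>"
        using e by (intro tendsto_divide avg tendsto_const) simp
      then show "counting_lim (?A e) \<le> 0"
        by (intro tendsto_le [OF _ _ tendsto_counting_lim [OF A]])
          (use card_le_average [OF nonneg e] in \<open>auto simp del: One_nat_def\<close>)
    qed
    then have "AE c in loeb_space \<omega> n. \<forall>j. c \<notin> internal_set \<omega> n (?A (1 / real (Suc j)))"
      unfolding AE_all_countable internal_null_iff [OF A] by simp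
    then show "AE c in loeb_space \<omega> n. loeb_lim \<omega> d c = 0"
      using AE_space
    proof eventually_elim
      case (elim c)
      then have "loeb_lim \<omega> d c \<le> 1 / real (Suc j)" for j
        by (intro loeb_lim_le_outside [OF bound]) auto
      then have "loeb_lim \<omega> d c \<le> 0"
        using nat_approx_posE [of "loeb_lim \<omega> d c"] by (meson not_le)
      then show ?case using lim_nonneg elim by fastforce
    qed
  next
    assume AE0: "AE c in loeb_space \<omega> n. loeb_lim \<omega> d c = 0"
    show "((\<lambda>k. (\<Sum>i=1..n k. d k i) / real (n k)) \<longlongrightarrow> 0) \<omega>"
    proof (rule tendstoI)
      fix e' :: real assume e': "e' > 0"
      \<comment> \<open>One half for the terms below the threshold, the other for the vanishing
        fraction above it.\<close>
      define e where "e = e' / 2"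
      have e: "e > 0" using e' by (simp add: e_def)
      have "AE c in loeb_space \<omega> n. c \<notin> internal_set \<omega> n (?A e)"
        using AE0
      proof eventually_elim
        case (elim c)
        show ?case
        proof
          assume c: "c \<in> internal_set \<omega> n (?A e)"
          then have "e \<le> loeb_lim \<omega> d c"
            by (intro tendsto_lowerbound [OF tendsto_loeb_lim [OF bound]])
              (auto simp: internal_set_iff elim: eventually_mono)
          then show False using elim e by simp
        qed
      qed
      then have "counting_lim (?A e) = 0"
        by (simp only: internal_null_iff [OF A])
      then have "((\<lambda>k. e + C * (real (card (?A e k)) / real (n k))) \<longlongrightarrow> e + C * 0) \<omega>"
        using tendsto_counting_lim [OF A, of e] by (intro tendsto_intros) simp
      then have "eventually (\<lambda>k. e + C * (real (card (?A e k)) / real (n k)) < e') \<omega>"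
        by (rule order_tendstoD) (use e' in \<open>simp add: e_def\<close>)
      then show "eventually (\<lambda>k. dist ((\<Sum>i=1..n k. d k i) / real (n k)) 0 < e') \<omega>"
      proof eventually_elim
        case (elim k)
        have "(\<Sum>i=1..n k. d k i) / real (n k) \<ge> 0"
          by (intro divide_nonneg_nonneg sum_nonneg nonneg) auto
        moreover have "(\<Sum>i=1..n k. d k i) / real (n k) \<le> e + C * (real (card (?A e k)) / real (n k))"
          by (rule average_le_card [OF le e C n_pos])
        ultimately show ?case
          using elim unfolding dist_real_def by linarith
      qed
    qed
  qed
qed

section \<open>Lifting functions of the standard part\<close>

text \<open>The lift of \<open>f \<circ> St\<close> consists of the averages of \<open>f\<close> over the cells of the partition of
  the interval into \<open>n k\<close> pieces. Averaging is a contraction for the \<open>L\<^sup>1\<close>-norm, and the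
  averages of a continuous function converge pointwise.\<close>

lemma cell_average_continuous:
  assumes g: "continuous_on UNIV g" "\<And>x. cmod (g x) \<le> C" and c: "c \<in> loeb_points \<omega> n"
  shows "loeb_lim \<omega> (\<lambda>k. cell_average (n k) g) c = g (St \<omega> n c)"
proof (rule loeb_lim_eqI, rule tendstoI)
  fix e' :: real assume e': "e' > 0"
  define e where "e = e' / 2"
  have e: "e > 0" "e < e'" using e' by (simp_all add: e_def)
  have g_int: "integrable unit_interval g"
    by (rule bounded_integrable_unit_interval [OF continuous_imp_measurable_on_sets_lebesgue [OF continuous_on_subset [OF g(1)]] g(2)]) auto
  define s where "s = St \<omega> n c"
  obtain r where r: "r > 0" "\<And>x. dist x s < r \<Longrightarrow> dist (g x) (g s) < e"
    using g(1) e(1) unfolding continuous_on_iff by (metis UNIV_I)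
  \<comment> \<open>The cell with number i lies within 1 / n_k of its right end i / n_k, so two
    halves of r put the whole cell within r of s.\<close>
  have "eventually (\<lambda>k. dist (real (loeb_rep c k) / real (n k)) s < r / 2) \<omega>"
    unfolding s_def by (rule tendstoD [OF tendsto_St [OF c]]) (use r(1) in simp)
  moreover have "eventually (\<lambda>k. 1 / real (n k) < r / 2) \<omega>"
    by (rule order_tendstoD [OF one_over_n_tendsto]) (use r(1) in simp)
  ultimately show "eventually (\<lambda>k. dist (cell_average (n k) g (loeb_rep c k)) (g s) < e') \<omega>"
  proof eventually_elim
    case (elim k)
    let ?i = "loeb_rep c k"
    have i: "?i \<in> {1..n k}" by (rule loeb_rep_range [OF c])
    have const: "integrable unit_interval (\<lambda>x. g s)"
      by (rule finite_measure.integrable_const [OF finite_measure_unit_interval])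
    have "cmod (cell_average (n k) (\<lambda>x. g x - g s) ?i) \<le> e"
    proof (rule cell_average_bound [OF i Bochner_Integration.integrable_diff [OF g_int const]])
      fix x assume "x \<in> cell (n k) ?i"
      then have "real ?i / real (n k) - 1 / real (n k) < x" "x \<le> real ?i / real (n k)"
        by (simp_all add: cell_def diff_divide_distrib)
      then have "dist x s < r"
        using elim unfolding dist_real_def by linarith
      then show "cmod (g x - g s) \<le> e"
        using r(2) by (simp add: dist_norm less_imp_le)
    qed
    then have "cmod (cell_average (n k) g ?i - g s) \<le> e"
      by (simp add: cell_average_diff [OF i g_int const] cell_average_const [OF i])
    then show ?case using e by (simp add: dist_norm)
  qed
qed

lemma ess_bounded_St_lift:
  assumes f: "f \<in> ess_bounded_fns unit_interval"
  obtains d C where "\<And>k i. i \<in> {1..n k} \<Longrightarrow> cmod (d k i) \<le> C"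
    "AE c in loeb_space \<omega> n. loeb_lim \<omega> d c = f (St \<omega> n c)"
proof -
  let ?L = "loeb_space \<omega> n"
  obtain F C g where fF: "AE x in unit_interval. f x = F x"
    and F_meas: "F \<in> borel_measurable unit_interval" and F_le: "\<And>x. cmod (F x) \<le> C"
    and g_cont: "\<And>j. continuous_on UNIV (g j)" and g_le: "\<And>j x. cmod (g j x) \<le> C"
    and lim: "(\<lambda>j. \<integral>x. cmod (F x - g j x) \<partial>unit_interval) \<longlonglongrightarrow> 0"
    using continuous_approximation_unit_interval [OF f] by blast
  have g_meas: "g j \<in> borel_measurable unit_interval" for j
    by (rule continuous_imp_measurable_on_sets_lebesgue [OF continuous_on_subset [OF g_cont]]) auto
  have F_int: "integrable unit_interval F"
    by (rule bounded_integrable_unit_interval [OF F_meas F_le])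
  have g_int: "integrable unit_interval (g j)" for j
    by (rule bounded_integrable_unit_interval [OF g_meas g_le])
  define \<delta> where "\<delta> j = (\<integral>x. cmod (F x - g j x) \<partial>unit_interval)" for j
  have \<delta>_nonneg: "\<delta> j \<ge> 0" for j by (simp add: \<delta>_def)
  \<comment> \<open>d, the averages of F, is the lift. The averages b j of the continuous g j serve
    for comparison: their Loeb limit is exactly g j o \<open>St\<close>.\<close>
  define d where "d k = cell_average (n k) F" for k
  define b where "b j k = cell_average (n k) (g j)" for j k
  have d_le: "cmod (d k i) \<le> C" if "i \<in> {1..n k}" for k i
    unfolding d_def by (rule cell_average_bound [OF that F_int F_le])
  have b_le: "cmod (b j k i) \<le> C" if "i \<in> {1..n k}" for j k i
    unfolding b_def by (rule cell_average_bound [OF that g_int g_le])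
  have diff_le: "norm (cmod (d k i - b j k i)) \<le> C + C" if "i \<in> {1..n k}" for j k i
    using norm_triangle_ineq4 [of "d k i" "b j k i"] d_le [OF that] b_le [OF that, of j] by simp
  have meas: "loeb_lim \<omega> d \<in> borel_measurable ?L" "(\<lambda>c. F (St \<omega> n c)) \<in> borel_measurable ?L"
    using loeb_lim_measurable [of d C] d_le
      measurable_compose [OF preserves_measure_measurable [OF St_preserves_measure] F_meas] by auto
  \<comment> \<open>One e pays for replacing d by b j at the finite stages, the other for replacing
    F by g j on the interval. Both exceptional sets have measure at most
    \<open>\<delta> j / e\<close> by Markov, while the set to be measured does not depend on
    j.\<close>
  have null: "emeasure ?L {c \<in> space ?L. cmod (loeb_lim \<omega> d c - F (St \<omega> n c)) > e + e} = 0" if e: "e > 0" for e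
  proof -
    let ?A = "\<lambda>j k. {i \<in> {1..n k}. cmod (d k i - b j k i) > e}"
    let ?B = "\<lambda>j. {x \<in> space unit_interval. e \<le> cmod (F x - g j x)}"
    have A: "?A j \<in> internal_families" for j by auto
    have "counting_lim (?A j) \<le> \<delta> j / e" for j
    proof (rule tendsto_upperbound [OF tendsto_counting_lim [OF A]])
      have "(\<Sum>i=1..n k. cmod (d k i - b j k i)) \<le> real (n k) * \<delta> j" for k
      proof -
        have "(\<Sum>i=1..n k. cmod (d k i - b j k i)) = (\<Sum>i=1..n k. cmod (cell_average (n k) (\<lambda>x. F x - g j x) i))"
          by (rule sum.cong) (auto simp: d_def b_def cell_average_diff F_int g_int)
        also have "\<dots> \<le> real (n k) * \<delta> j"
          unfolding \<delta>_def by (rule sum_cell_average_le) (intro Bochner_Integration.integrable_diff F_int g_int)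
        finally show ?thesis .
      qed
      then have avg: "(\<Sum>i=1..n k. cmod (d k i - b j k i)) / real (n k) \<le> \<delta> j" for k
        using n_pos [of k] by (simp add: divide_le_eq mult.commute)
      have "real (card (?A j k)) / real (n k) \<le> \<delta> j / e" for k
        by (rule order_trans [OF card_le_average [OF _ e] divide_right_mono [OF avg]]) (use e in auto)
      then show "eventually (\<lambda>k. real (card (?A j k)) / real (n k) \<le> \<delta> j / e) \<omega>"
        by simp
    qed simp
    then have mA: "emeasure ?L (internal_set \<omega> n (?A j)) \<le> ennreal (\<delta> j / e)" for j
      unfolding emeasure_internal [OF A] by (rule ennreal_leI)
    have mB: "emeasure ?L (St \<omega> n -` ?B j \<inter> space ?L) \<le> ennreal (\<delta> j / e)" for j
    proof -
      have B: "?B j \<in> sets unit_interval"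
        using F_meas g_meas [of j] by measurable
      have "emeasure unit_interval (?B j) \<le> ennreal ((1 / e) * \<delta> j)"
        unfolding \<delta>_def by (rule integral_Markov_inequality [OF _ _ e]) (use F_int g_int in auto)
      then show ?thesis
        unfolding preserves_measure_emeasure [OF St_preserves_measure B] by simp
    qed
    have "emeasure ?L {c \<in> space ?L. cmod (loeb_lim \<omega> d c - F (St \<omega> n c)) > e + e} \<le> ennreal (\<delta> j / e + \<delta> j / e)" for j
    proof -
      have "{c \<in> space ?L. cmod (loeb_lim \<omega> d c - F (St \<omega> n c)) > e + e} \<subseteq>
          internal_set \<omega> n (?A j) \<union> (St \<omega> n -` ?B j \<inter> space ?L)"
      proof (rule subsetI, rule ccontr)
        fix c assume c: "c \<in> {c \<in> space ?L. cmod (loeb_lim \<omega> d c - F (St \<omega> n c)) > e + e}"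
          and "c \<notin> internal_set \<omega> n (?A j) \<union> (St \<omega> n -` ?B j \<inter> space ?L)"
        then have out: "c \<notin> internal_set \<omega> n (?A j)" and B: "St \<omega> n c \<notin> ?B j"
          and c': "c \<in> loeb_points \<omega> n"
          by auto
        have "loeb_lim \<omega> (\<lambda>k i. cmod (d k i - b j k i)) c \<le> e"
          by (rule loeb_lim_le_outside [OF diff_le c' out])
        moreover have "loeb_lim \<omega> (\<lambda>k i. cmod (d k i - b j k i)) c = cmod (loeb_lim \<omega> d c - loeb_lim \<omega> (b j) c)"
          by (rule loeb_lim_eqI) (intro tendsto_intros tendsto_loeb_lim [OF d_le c'] tendsto_loeb_lim [OF b_le c'])
        moreover have "loeb_lim \<omega> (b j) c = g j (St \<omega> n c)"
          unfolding b_def [abs_def] by (rule cell_average_continuous [OF g_cont g_le c'])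
        moreover have "cmod (F (St \<omega> n c) - g j (St \<omega> n c)) < e"
          using B St_range [OF c'] by (auto simp: not_le)
        ultimately have "cmod (loeb_lim \<omega> d c - F (St \<omega> n c)) \<le> e + e"
          using norm_triangle_ineq4 [of "loeb_lim \<omega> d c - g j (St \<omega> n c)" "F (St \<omega> n c) - g j (St \<omega> n c)"]
          by simp
        then show False using c by simp
      qed
      moreover have "St \<omega> n -` ?B j \<inter> space ?L \<in> sets ?L"
        using F_meas g_meas [of j]
        by (intro measurable_sets [OF preserves_measure_measurable [OF St_preserves_measure]]) measurable
      ultimately have "emeasure ?L {c \<in> space ?L. cmod (loeb_lim \<omega> d c - F (St \<omega> n c)) > e + e}
          \<le> emeasure ?L (internal_set \<omega> n (?A j) \<union> (St \<omega> n -` ?B j \<inter> space ?L))"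
        by (intro emeasure_mono sets.Un internal_set_in_sets)
      also have "\<dots> \<le> emeasure ?L (internal_set \<omega> n (?A j)) + emeasure ?L (St \<omega> n -` ?B j \<inter> space ?L)"
        by (rule emeasure_subadditive) (use \<open>_ \<in> sets ?L\<close> in auto)
      also have "\<dots> \<le> ennreal (\<delta> j / e) + ennreal (\<delta> j / e)"
        by (rule add_mono [OF mA mB])
      also have "\<dots> = ennreal (\<delta> j / e + \<delta> j / e)"
        by (rule ennreal_plus [symmetric]) (use e \<delta>_nonneg in auto)
      finally show ?thesis .
    qed
    moreover have "(\<lambda>j. ennreal (\<delta> j / e + \<delta> j / e)) \<longlonglongrightarrow> ennreal (0 / e + 0 / e)"
      using e lim unfolding \<delta>_def by (intro tendsto_ennrealI tendsto_intros) auto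
    ultimately have "emeasure ?L {c \<in> space ?L. cmod (loeb_lim \<omega> d c - F (St \<omega> n c)) > e + e} \<le> ennreal (0 / e + 0 / e)"
      by (intro LIMSEQ_le_const) auto
    then show ?thesis by simp
  qed
  have "AE c in ?L. \<forall>m. \<not> cmod (loeb_lim \<omega> d c - F (St \<omega> n c)) > 1 / real (Suc m) + 1 / real (Suc m)"
    unfolding AE_all_countable
  proof
    fix m
    show "AE c in ?L. \<not> cmod (loeb_lim \<omega> d c - F (St \<omega> n c)) > 1 / real (Suc m) + 1 / real (Suc m)"
    proof (subst AE_iff_measurable [OF _ refl])
      show "{c \<in> space ?L. \<not> \<not> cmod (loeb_lim \<omega> d c - F (St \<omega> n c)) > 1 / real (Suc m) + 1 / real (Suc m)} \<in> sets ?L"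
        using meas by measurable
    qed (use null [of "1 / real (Suc m)"] in simp)
  qed
  moreover have "AE c in ?L. f (St \<omega> n c) = F (St \<omega> n c)"
    by (rule preserves_measure_AE [OF St_preserves_measure fF])
  ultimately have "AE c in ?L. loeb_lim \<omega> d c = f (St \<omega> n c)"
  proof eventually_elim
    case (elim c)
    have "cmod (loeb_lim \<omega> d c - F (St \<omega> n c)) \<le> 0"
    proof (rule ccontr)
      assume "\<not> ?thesis"
      then obtain m where "1 / real (Suc m) < cmod (loeb_lim \<omega> d c - F (St \<omega> n c)) / 2"
        using nat_approx_posE [of "cmod (loeb_lim \<omega> d c - F (St \<omega> n c)) / 2"] by auto
      then have "1 / real (Suc m) + 1 / real (Suc m) < cmod (loeb_lim \<omega> d c - F (St \<omega> n c))"
        by linarith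
      then show False using elim(1) by blast
    qed
    then show ?case using elim(2) by simp
  qed
  with d_le show thesis by (rule that)
qed

section \<open>Diagonal sequences as functions on the Loeb space\<close>

abbreviation diagonal_class :: "(nat \<Rightarrow> nat \<Rightarrow> complex) \<Rightarrow> (nat \<Rightarrow> complex mat) set" where
  "diagonal_class d \<equiv> mat_class \<omega> n (\<lambda>k. diag_mat_of (n k) (d k))"

abbreviation loeb_lim_class :: "(nat \<Rightarrow> nat \<Rightarrow> complex) \<Rightarrow> ((nat \<Rightarrow> nat) set \<Rightarrow> complex) set" where
  "loeb_lim_class d \<equiv> ae_rel (loeb_space \<omega> n) `` {loeb_lim \<omega> d}"

lemma Linf_to_mat_eq:
  "Linf_to_mat \<omega> n B = diagonal_class ` {d \<in> bounded_diagonals n. loeb_lim_class d \<in> B}"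
  unfolding Linf_to_mat_def bounded_diagonals_def by blast

lemma loeb_lim_in_ess_bounded:
  "d \<in> bounded_diagonals n \<Longrightarrow> loeb_lim \<omega> d \<in> ess_bounded_fns (loeb_space \<omega> n)"
  by (erule bounded_diagonalsE) (rule loeb_lim_ess_bounded, blast)

lemma diagonal_in_op_bounded:
  "d \<in> bounded_diagonals n \<Longrightarrow> (\<lambda>k. diag_mat_of (n k) (d k)) \<in> op_bounded_seqs n"
  by (erule bounded_diagonalsE) (rule op_bounded_seqs_diag, blast)

text \<open>The normalised squared norm of the difference is the mean of its squared entries, and by
  continuity the Loeb limit of these is the squared distance of the two limits;
  \<open>average_tendsto_0_iff\<close> compares them. So the identification with functions is well
  defined and injective.\<close>

lemma diagonal_class_eq_iff:
  assumes d: "d \<in> bounded_diagonals n" and e: "e \<in> bounded_diagonals n"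
  shows "diagonal_class d = diagonal_class e \<longleftrightarrow> loeb_lim_class d = loeb_lim_class e"
proof -
  obtain C where "\<forall>k. \<forall>i\<in>{1..n k}. cmod (d k i) \<le> C"
    using bounded_diagonalsE [OF d] .
  then have C: "\<And>k i. i \<in> {1..n k} \<Longrightarrow> cmod (d k i) \<le> C"
    by blast
  obtain D where "\<forall>k. \<forall>i\<in>{1..n k}. cmod (e k i) \<le> D"
    using bounded_diagonalsE [OF e] .
  then have D: "\<And>k i. i \<in> {1..n k} \<Longrightarrow> cmod (e k i) \<le> D"
    by blast
  have lim: "loeb_lim \<omega> (\<lambda>k i. (cmod (d k i - e k i))\<^sup>2) c = (cmod (loeb_lim \<omega> d c - loeb_lim \<omega> e c))\<^sup>2"
    if "c \<in> space (loeb_space \<omega> n)" for c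
    using that by (intro loeb_lim_eqI tendsto_intros tendsto_loeb_lim [OF C] tendsto_loeb_lim [OF D]) auto
  have "diagonal_class d = diagonal_class e \<longleftrightarrow>
      ((\<lambda>k. (\<Sum>i=1..n k. (cmod (d k i - e k i))\<^sup>2) / real (n k)) \<longlongrightarrow> 0) \<omega>"
    by (simp only: mat_class_eq_iff diagonal_in_op_bounded d e diag_mat_of_diff frobenius2_diag)
  also have "\<dots> \<longleftrightarrow> (AE c in loeb_space \<omega> n. loeb_lim \<omega> (\<lambda>k i. (cmod (d k i - e k i))\<^sup>2) c = 0)"
  proof (rule average_tendsto_0_iff)
    show "(cmod (d k i - e k i))\<^sup>2 \<le> (C + D)\<^sup>2" if "i \<in> {1..n k}" for k i
      using norm_triangle_ineq4 [of "d k i" "e k i"] C [OF that] D [OF that] by (intro power_mono) auto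
  qed simp
  also have "\<dots> \<longleftrightarrow> (AE c in loeb_space \<omega> n. loeb_lim \<omega> d c = loeb_lim \<omega> e c)"
    by (rule AE_cong) (simp add: lim)
  also have "\<dots> \<longleftrightarrow> loeb_lim_class d = loeb_lim_class e"
    by (simp only: ae_class_eq_iff loeb_lim_in_ess_bounded d e)
  finally show ?thesis .
qed

lemma loeb_lim_class_in_Linf: "d \<in> bounded_diagonals n \<Longrightarrow> loeb_lim_class d \<in> Linf (loeb_space \<omega> n)"
  unfolding Linf_eq using loeb_lim_in_ess_bounded by blast

text \<open>\<open>Linf_to_mat\<close> only collects classes that have a bounded diagonal lift; by
  this lemma no element of \<open>St_Linf\<close> is lost.\<close>

lemma St_Linf_lift:
  assumes "F \<in> St_Linf \<omega> n"
  obtains d where "d \<in> bounded_diagonals n" "F = loeb_lim_class d"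
proof -
  obtain f where f: "f \<in> ess_bounded_fns unit_interval" "F = ae_rel (loeb_space \<omega> n) `` {\<lambda>c. f (St \<omega> n c)}"
    using assms unfolding St_Linf_def Linf_comp_image_Linf [OF St_preserves_measure] by blast
  obtain d C where d: "\<And>k i. i \<in> {1..n k} \<Longrightarrow> cmod (d k i) \<le> C"
    "AE c in loeb_space \<omega> n. loeb_lim \<omega> d c = f (St \<omega> n c)"
    using ess_bounded_St_lift [OF f(1)] by blast
  then have db: "d \<in> bounded_diagonals n"
    unfolding bounded_diagonals_def by blast
  have "F = loeb_lim_class d"
    unfolding f(2) using d(2)
    by (subst ae_class_eq_iff [OF ess_bounded_fns_comp [OF St_preserves_measure f(1)] loeb_lim_in_ess_bounded [OF db]])
      (auto elim: eventually_mono)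
  with db show thesis by (rule that)
qed

section \<open>Conjugation by permutation matrices\<close>

context
  fixes q :: "nat \<Rightarrow> nat \<Rightarrow> nat"
  assumes q: "\<And>k. q k permutes {1..n k}"
begin

lemma Linf_comp_perm_act_loeb_lim_class:
  assumes d: "d \<in> bounded_diagonals n"
  shows "Linf_comp (loeb_space \<omega> n) (perm_act q) (loeb_lim_class d) = loeb_lim_class (\<lambda>k i. d k (q k i))"
proof -
  note L = loeb_lim_in_ess_bounded [OF d]
  note P = perm_act_preserves_measure [OF q]
  have "AE c in loeb_space \<omega> n. loeb_lim \<omega> d (perm_act q c) = loeb_lim \<omega> (\<lambda>k i. d k (q k i)) c"
    by (rule AE_I2) (simp add: loeb_lim_perm_act [OF q])
  then show ?thesis
    unfolding Linf_comp_class [OF P L]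
      ae_class_eq_iff [OF ess_bounded_fns_comp [OF P L] loeb_lim_in_ess_bounded [OF bounded_diagonals_permute [OF d q]]] .
qed

text \<open>The inverse appears because the adjoint stands on the right here, whereas composition
  with the action corresponds to conjugation with the adjoint on the left.\<close>

lemma conj_diagonal_class:
  assumes d: "d \<in> bounded_diagonals n"
  defines "u \<equiv> mat_class \<omega> n (\<lambda>k. perm_mat (n k) (q k))"
  shows "u \<otimes>\<^bsub>matrix_ultraproduct \<omega> n\<^esub> diagonal_class d \<otimes>\<^bsub>matrix_ultraproduct \<omega> n\<^esub> ultra_adjoint \<omega> n u
     = diagonal_class (\<lambda>k i. d k (Hilbert_Choice.inv (q k) i))"
proof -
  note U = op_bounded_seqs_perm [where n = n and q = q, OF q]
  note D = diagonal_in_op_bounded [OF d]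
  show ?thesis
    unfolding u_def ultra_adjoint_class [OF U] mat_class_mult [OF U D]
      mat_class_mult [OF op_bounded_seqs_mult [OF U D] op_bounded_seqs_adjoint [OF U]] perm_mat_conj_diag [OF q] ..
qed

lemma perm_class_unitary:
  defines "u \<equiv> mat_class \<omega> n (\<lambda>k. perm_mat (n k) (q k))"
  shows "u \<in> carrier (matrix_ultraproduct \<omega> n)"
    and "ultra_adjoint \<omega> n u \<otimes>\<^bsub>matrix_ultraproduct \<omega> n\<^esub> u = \<one>\<^bsub>matrix_ultraproduct \<omega> n\<^esub>"
    and "u \<otimes>\<^bsub>matrix_ultraproduct \<omega> n\<^esub> ultra_adjoint \<omega> n u = \<one>\<^bsub>matrix_ultraproduct \<omega> n\<^esub>"
proof -
  note U = op_bounded_seqs_perm [where n = n and q = q, OF q]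
  note UA = op_bounded_seqs_adjoint [OF U]
  show "u \<in> carrier (matrix_ultraproduct \<omega> n)"
    unfolding u_def by (rule mat_class_in_carrier [OF U])
  show "ultra_adjoint \<omega> n u \<otimes>\<^bsub>matrix_ultraproduct \<omega> n\<^esub> u = \<one>\<^bsub>matrix_ultraproduct \<omega> n\<^esub>"
    unfolding u_def ultra_adjoint_class [OF U] mat_class_mult [OF UA U] perm_mat_adjoint_mult [OF q]
      one_matrix_ultraproduct ..
  show "u \<otimes>\<^bsub>matrix_ultraproduct \<omega> n\<^esub> ultra_adjoint \<omega> n u = \<one>\<^bsub>matrix_ultraproduct \<omega> n\<^esub>"
    unfolding u_def ultra_adjoint_class [OF U] mat_class_mult [OF U UA] perm_mat_mult_adjoint [OF q]
      one_matrix_ultraproduct ..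
qed

text \<open>Both sides say that a bounded diagonal sequence represents an element of \<open>B\<close> if and only
  if its composition with \<open>q\<close> does.\<close>

lemma normaliser_iff_Linf_comp_eq:
  assumes B_lift: "\<And>F. F \<in> B \<Longrightarrow> \<exists>d\<in>bounded_diagonals n. F = loeb_lim_class d"
  shows "mat_class \<omega> n (\<lambda>k. perm_mat (n k) (q k)) \<in> ultra_normaliser \<omega> n (Linf_to_mat \<omega> n B) \<longleftrightarrow>
     Linf_comp (loeb_space \<omega> n) (perm_act q) ` B = B"
proof -
  let ?D = "bounded_diagonals n" and ?T = "Linf_comp (loeb_space \<omega> n) (perm_act q)"
  let ?u = "mat_class \<omega> n (\<lambda>k. perm_mat (n k) (q k))"
  let ?conj = "\<lambda>b. ?u \<otimes>\<^bsub>matrix_ultraproduct \<omega> n\<^esub> b \<otimes>\<^bsub>matrix_ultraproduct \<omega> n\<^esub> ultra_adjoint \<omega> n ?u"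
  define \<sigma> :: "(nat \<Rightarrow> nat \<Rightarrow> complex) \<Rightarrow> nat \<Rightarrow> nat \<Rightarrow> complex"
    where "\<sigma> d = (\<lambda>k i. d k (q k i))" for d
  define \<tau> :: "(nat \<Rightarrow> nat \<Rightarrow> complex) \<Rightarrow> nat \<Rightarrow> nat \<Rightarrow> complex"
    where "\<tau> d = (\<lambda>k i. d k (Hilbert_Choice.inv (q k) i))" for d
  have inv: "\<sigma> (\<tau> d) = d" "\<tau> (\<sigma> d) = d" for d
    using permutes_inverses [OF q] by (simp_all add: \<sigma>_def \<tau>_def)
  have D: "\<sigma> d \<in> ?D" "\<tau> d \<in> ?D" if "d \<in> ?D" for d
    unfolding \<sigma>_def \<tau>_def
    by (rule bounded_diagonals_permute [OF that q], rule bounded_diagonals_permute [OF that permutes_inv [OF q]])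
  have T: "?T (loeb_lim_class d) = loeb_lim_class (\<sigma> d)" if "d \<in> ?D" for d
    unfolding \<sigma>_def by (rule Linf_comp_perm_act_loeb_lim_class [OF that])
  have "?conj ` Linf_to_mat \<omega> n B = (\<lambda>d. diagonal_class (\<tau> d)) ` {d \<in> ?D. loeb_lim_class d \<in> B}"
    unfolding Linf_to_mat_eq image_image \<tau>_def by (intro image_cong refl conj_diagonal_class) simp
  \<comment> \<open>The substitution d = \<open>\<sigma>\<close> e moves the permutation from the
    class to the membership condition.\<close>
  also have "\<dots> = diagonal_class ` {e \<in> ?D. loeb_lim_class (\<sigma> e) \<in> B}"
  proof (intro equalityI subsetI)
    fix x assume "x \<in> (\<lambda>d. diagonal_class (\<tau> d)) ` {d \<in> ?D. loeb_lim_class d \<in> B}"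
    then obtain d where "d \<in> ?D" "loeb_lim_class d \<in> B" "x = diagonal_class (\<tau> d)" by blast
    then show "x \<in> diagonal_class ` {e \<in> ?D. loeb_lim_class (\<sigma> e) \<in> B}"
      using D by (intro image_eqI [of _ _ "\<tau> d"]) (auto simp: inv)
  next
    fix x assume "x \<in> diagonal_class ` {e \<in> ?D. loeb_lim_class (\<sigma> e) \<in> B}"
    then obtain e where "e \<in> ?D" "loeb_lim_class (\<sigma> e) \<in> B" "x = diagonal_class e" by blast
    then show "x \<in> (\<lambda>d. diagonal_class (\<tau> d)) ` {d \<in> ?D. loeb_lim_class d \<in> B}"
      using D by (intro image_eqI [of _ _ "\<sigma> e"]) (auto simp: inv)
  qed
  finally have conj: "?conj ` Linf_to_mat \<omega> n B = diagonal_class ` {e \<in> ?D. loeb_lim_class (\<sigma> e) \<in> B}" .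
  \<comment> \<open>Equal diagonal classes have equal limit classes, so a condition on the limit
    class can be tested on any diagonal sequence representing the matrix class.\<close>
  have mem: "diagonal_class e \<in> diagonal_class ` {d \<in> ?D. P (loeb_lim_class d)} \<longleftrightarrow> P (loeb_lim_class e)"
    if "e \<in> ?D" for e P
  proof
    assume "diagonal_class e \<in> diagonal_class ` {d \<in> ?D. P (loeb_lim_class d)}"
    then obtain d where d: "d \<in> ?D" "P (loeb_lim_class d)" "diagonal_class e = diagonal_class d"
      by blast
    have "loeb_lim_class e = loeb_lim_class d"
      using d(3) by (simp only: diagonal_class_eq_iff [OF that d(1)])
    with d(2) show "P (loeb_lim_class e)" by (simp only:)
  next
    assume "P (loeb_lim_class e)"
    with that show "diagonal_class e \<in> diagonal_class ` {d \<in> ?D. P (loeb_lim_class d)}"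
      by (intro imageI) simp
  qed
  have "?conj ` Linf_to_mat \<omega> n B = Linf_to_mat \<omega> n B \<longleftrightarrow>
      (\<forall>e\<in>?D. ?T (loeb_lim_class e) \<in> B \<longleftrightarrow> loeb_lim_class e \<in> B)"
  proof -
    have "{e \<in> ?D. loeb_lim_class (\<sigma> e) \<in> B} = {e \<in> ?D. ?T (loeb_lim_class e) \<in> B}"
      using T by auto
    then have eq: "?conj ` Linf_to_mat \<omega> n B = diagonal_class ` {e \<in> ?D. ?T (loeb_lim_class e) \<in> B}"
      using conj by simp
    show ?thesis
    proof
      assume *: "?conj ` Linf_to_mat \<omega> n B = Linf_to_mat \<omega> n B"
      show "\<forall>e\<in>?D. ?T (loeb_lim_class e) \<in> B \<longleftrightarrow> loeb_lim_class e \<in> B"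
      proof
        fix e assume e: "e \<in> ?D"
        show "?T (loeb_lim_class e) \<in> B \<longleftrightarrow> loeb_lim_class e \<in> B"
          using mem [OF e, of "\<lambda>F. ?T F \<in> B"] mem [OF e, of "\<lambda>F. F \<in> B"] *
          unfolding eq unfolding Linf_to_mat_eq by simp
      qed
    next
      assume "\<forall>e\<in>?D. ?T (loeb_lim_class e) \<in> B \<longleftrightarrow> loeb_lim_class e \<in> B"
      then have "{e \<in> ?D. ?T (loeb_lim_class e) \<in> B} = {e \<in> ?D. loeb_lim_class e \<in> B}"
        by blast
      then show "?conj ` Linf_to_mat \<omega> n B = Linf_to_mat \<omega> n B"
        unfolding eq unfolding Linf_to_mat_eq by simp
    qed
  qed
  also have "\<dots> \<longleftrightarrow> ?T ` B = B"
  proof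
    assume *: "\<forall>e\<in>?D. ?T (loeb_lim_class e) \<in> B \<longleftrightarrow> loeb_lim_class e \<in> B"
    show "?T ` B = B"
    proof (intro equalityI subsetI)
      fix F assume "F \<in> ?T ` B"
      then obtain e where "e \<in> ?D" "loeb_lim_class e \<in> B" "F = ?T (loeb_lim_class e)"
        using B_lift by blast
      then show "F \<in> B" using * by blast
    next
      fix F assume F: "F \<in> B"
      then obtain d where d: "d \<in> ?D" "F = loeb_lim_class d"
        using B_lift by blast
      \<comment> \<open>Permuting the lift of F back by the inverse yields a preimage of F; the
        assumption then places this preimage in B.\<close>
      then have F_eq: "F = ?T (loeb_lim_class (\<tau> d))"
        using T [OF D(2) [OF d(1)]] by (simp add: inv)
      then have "loeb_lim_class (\<tau> d) \<in> B"
        using * D(2) [OF d(1)] F by blast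
      then show "F \<in> ?T ` B"
        using F_eq by blast
    qed
  next
    assume *: "?T ` B = B"
    have "loeb_lim_class e \<in> B" if e: "e \<in> ?D" and Te: "?T (loeb_lim_class e) \<in> B" for e
    proof -
      have "?T (loeb_lim_class e) \<in> ?T ` B"
        unfolding * by (rule Te)
      \<comment> \<open>F in B has the same image as the class of e; injectivity of the composition
        on L-infinity identifies the two.\<close>
      then obtain F where F: "F \<in> B" "?T (loeb_lim_class e) = ?T F"
        by (elim imageE) (rule that)
      obtain d where d: "d \<in> ?D" "F = loeb_lim_class d"
        using B_lift [OF F(1)] by blast
      have "loeb_lim_class e = F"
        using loeb_lim_class_in_Linf [OF e] loeb_lim_class_in_Linf [OF d(1)]
        unfolding d(2) [symmetric]
        by (rule inj_onD [OF inj_on_Linf_comp [OF perm_act_preserves_measure [OF q]] F(2)])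
      then show ?thesis using F(1) by simp
    qed
    then show "\<forall>e\<in>?D. ?T (loeb_lim_class e) \<in> B \<longleftrightarrow> loeb_lim_class e \<in> B"
      using * by blast
  qed
  finally have "?conj ` Linf_to_mat \<omega> n B = Linf_to_mat \<omega> n B \<longleftrightarrow> ?T ` B = B" .
  then show ?thesis
    using perm_class_unitary by (simp add: ultra_normaliser_def Let_def)
qed

end

end

section \<open>The two characterisations of \<open>GA\<close>\<close>

theorem theorem2p8:
  fixes \<omega> :: "nat filter" and n :: "nat \<Rightarrow> nat" and p :: "(nat \<Rightarrow> nat \<Rightarrow> nat) set"
  assumes "nonprincipal_ultrafilter \<omega>"
    and "strict_mono n" and "\<And>k. n k > 0"
    and "p \<in> carrier (universal_sofic_group \<omega> n)"
  shows "(p \<in> GA \<omega> n \<longleftrightarrow>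
            Linf_comp (loeb_space \<omega> n) (sofic_act \<omega> n p) ` St_Linf \<omega> n = St_Linf \<omega> n) \<and>
         (p \<in> GA \<omega> n \<longleftrightarrow>
            sofic_to_mat \<omega> n p \<in> ultra_normaliser \<omega> n (Linf_to_mat \<omega> n (St_Linf \<omega> n)))"
proof -
  interpret loeb_ultraproduct \<omega> n
    using assms(1-3) by unfold_locales
  have q: "sofic_rep p k permutes {1..n k}" for k
    by (rule sofic_rep_permutes [OF assms(4)])
  have act: "sofic_act \<omega> n p = perm_act (sofic_rep p)"
    by (simp add: fun_eq_iff sofic_act_def perm_act_def)
  have "p \<in> GA \<omega> n \<longleftrightarrow> Linf_comp (loeb_space \<omega> n) (sofic_act \<omega> n p) ` St_Linf \<omega> n = St_Linf \<omega> n"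
    unfolding act St_Linf_def
    using automorphism_iff_Linf_comp_eq [OF complete_loeb St_preserves_measure perm_act_preserves_measure [OF q]] assms(4)
    by (auto simp: GA_def restricts_to_def act)
  moreover have "sofic_to_mat \<omega> n p \<in> ultra_normaliser \<omega> n (Linf_to_mat \<omega> n (St_Linf \<omega> n)) \<longleftrightarrow>
      Linf_comp (loeb_space \<omega> n) (sofic_act \<omega> n p) ` St_Linf \<omega> n = St_Linf \<omega> n"
    unfolding act sofic_to_mat_def
    by (rule normaliser_iff_Linf_comp_eq [OF q]) (use St_Linf_lift in blast)
  ultimately show ?thesis by blast
qed

end
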